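(* Let $\mu$ be a measure on the Borel subsets of $(0,\infty)$ such that $$0<\int_0^\infty\frac{\lambda}{\lambda+1}\,d\mu(\lambda)<\infty,$$ and let $N$ be a nonnegative integer. With $q_\mu$ and $h_\mu(N;x)$ as defined in the context, the inequality $$q_\mu(x)\le h_\mu(N;x)$$ holds for all $x$ in $\mathbb{R}/\mathbb{Z}$. If $\widetilde h(x)$ is a real trigonometric polynomial of degree at most $N$ that satisfies $q_\mu(x)\le\widetilde h(x)$ for all $x$ in $\mathbb{R}/\mathbb{Z}$, then $$\int_{\mathbb{R}/\mathbb{Z}}h_\mu(N;x)\,dx\le\int_{\mathbb{R}/\mathbb{Z}}\widetilde h(x)\,dx.$$ Moreover, there is equality in this last inequality if and only if $\widetilde h(x)=h_\mu(N;x)$.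
   Context: Write $e(x)=e^{2\pi i x}$, and $\operatorname{sgn}(x)=1,0,-1$ according as $x>0$, $x=0$, $x<0$. Integrals over $\mathbb{R}/\mathbb{Z}$ are with respect to Haar measure of total mass $1$. A real trigonometric polynomial of degree at most $N$ is a real valued function of the form $\sum_{n=-N}^N c_ne(nx)$. For $\lambda>0$ and $x\in\mathbb{R}/\mathbb{Z}$ let $$p(\lambda,x)=-\tfrac2\lambda+\sum_{m=-\infty}^\infty e^{-\lambda|x+m|}.$$ Define $q_\mu:\mathbb{R}/\mathbb{Z}\to\mathbb{R}$ by $$q_\mu(x)=\int_0^\infty p(\lambda,x)\,d\mu(\lambda)$$ (under the hypothesis on $\mu$ the integral converges absolutely for every $x$ and $q_\mu$ is continuous). For $\lambda>0$ define the entire function (with removable singularities removed) $$M(\lambda,z)=\left(\frac{\sin\pi z}{\pi}\right)^2\left\{\sum_{k\in\mathbb{Z}}\frac{e^{-\lambda|k|}}{(z-k)^2}-\lambda\sum_{l\in\mathbb{Z}}\frac{\operatorname{sgn}(l)e^{-\lambda|l|}}{z-l}\right\},$$ which is integrable on $\mathbb{R}$, and let $\widehat M(\lambda,t)=\int_{-\infty}^\infty M(\lambda,x)e(-tx)\,dx$. Define $$h_\mu(N;x)=\sum_{n=-N}^N\widehat h_\mu(N;n)e(nx),$$ where $$\widehat h_\mu(N;0)=\int_0^\infty\left\{\tfrac1{N+1}\coth\left(\tfrac{\lambda}{2N+2}\right)-\tfrac2\lambda\right\}d\mu(\lambda),\qquad \widehat h_\mu(N;n)=\tfrac1{N+1}\int_0^\infty\widehat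 M\left(\tfrac{\lambda}{N+1},\tfrac{n}{N+1}\right)d\mu(\lambda)\quad(n\ne0).$$ *)

theory Defs
  imports "HOL-Complex_Analysis.Complex_Analysis"
begin

(* Functions on R/Z are written as functions of a real variable that are (by their formulas)
   1-periodic, and the normalised Haar integral over R/Z as the Lebesgue integral over [0,1]. *)
abbreviation circle_integral :: "(real \<Rightarrow> real) \<Rightarrow> real" where
  "circle_integral f \<equiv> (LBINT x:{0..1}. f x)"

definition unit_exp :: "real \<Rightarrow> complex" where
  "unit_exp x = exp (2 * of_real pi * \<i> * of_real x)"

definition real_trig_poly :: "nat \<Rightarrow> (real \<Rightarrow> real) \<Rightarrow> bool" where
  "real_trig_poly N f \<longleftrightarrow>
     (\<exists>c :: int \<Rightarrow> complex. \<forall>x. complex_of_real (f x)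
        = (\<Sum>n\<in>{- int N..int N}. c n * unit_exp (of_int n * x)))"

definition p_fun :: "real \<Rightarrow> real \<Rightarrow> real" where
  "p_fun l x = - 2 / l + (\<Sum>\<^sub>\<infinity>m\<in>(UNIV::int set). exp (- l * \<bar>x + of_int m\<bar>))"

definition q_fun :: "real measure \<Rightarrow> real \<Rightarrow> real" where
  "q_fun \<mu> x = (\<integral>l. p_fun l x \<partial>\<mu>)"

definition M_fun :: "real \<Rightarrow> complex \<Rightarrow> complex" where
  "M_fun l = remove_sings (\<lambda>z. (sin (of_real pi * z) / of_real pi)\<^sup>2 *
     ((\<Sum>\<^sub>\<infinity>k\<in>(UNIV::int set). of_real (exp (- l * of_int \<bar>k\<bar>)) / (z - of_int k)\<^sup>2)
      - of_real l * (\<Sum>\<^sub>\<infinity>k\<in>(UNIV::int set).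
          of_int (sgn k) * of_real (exp (- l * of_int \<bar>k\<bar>)) / (z - of_int k))))"

definition M_hat :: "real \<Rightarrow> real \<Rightarrow> complex" where
  "M_hat l t = (\<integral>x. M_fun l (of_real x) * unit_exp (- t * x) \<partial>lborel)"

definition coth :: "real \<Rightarrow> real" where
  "coth x = cosh x / sinh x"

definition h_hat :: "real measure \<Rightarrow> nat \<Rightarrow> int \<Rightarrow> complex" where
  "h_hat \<mu> N n =
     (if n = 0
      then of_real (\<integral>l. 1 / (real N + 1) * coth (l / (2 * real N + 2)) - 2 / l \<partial>\<mu>)
      else 1 / (of_nat N + 1) * (\<integral>l. M_hat (l / (real N + 1)) (of_int n / (real N + 1)) \<partial>\<mu>))"

(* Complex-valued, because that is what the defining sum gives; that the values are real
   is part of the claim that h majorises q_fun. *)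
definition h_fun :: "real measure \<Rightarrow> nat \<Rightarrow> real \<Rightarrow> complex" where
  "h_fun \<mu> N x = (\<Sum>n\<in>{- int N..int N}. h_hat \<mu> N n * unit_exp (of_int n * x))"

end

(* For a single l the function p(l,x) + 2/l equals cosh (l (x - 1/2)) / sinh (l/2) on [0,1], which is a
   power series with nonnegative coefficients in v = cos^2 (pi x). A trigonometric polynomial of degree N
   that is even about 0 is a polynomial of degree N in v, and the Hermite interpolant of a power series
   with nonnegative coefficients at nodes of even multiplicity in (0,1) together with the node v = 1 (and
   possibly v = 0) lies above it on [0,1]. Folding frequencies n and n - N - 1 shows that the polynomial
   with coefficients M^(l/(N+1), n/(N+1)) / (N+1) is the Hermite interpolant at the points j/(N+1), once
   the Fourier transform M^ is known in closed form; the latter follows by writing M as the transform of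
   an explicit compactly supported function and applying Fourier inversion. Integrating over l gives the
   majorant h of q, which touches q at all j/(N+1). For another majorant g of degree N the quadrature
   formula with nodes j/(N+1) gives the inequality of the integrals; in the case of equality g - h
   vanishes at all nodes, doubly except at 0, hence identically. *)
theory Submission
  imports Defs "HOL-Probability.Probability" "HOL-Real_Asymp.Real_Asymp"
begin

text \<open>The hypothesis on the measure allows infinite mass near l = 0, so every quantity
  integrated over l has to be of size min 1 l. The mean 2/l and the zeroth coefficient of the
  interpolant satisfy this only in combination. The corner of the periodized exponential at the
  integers allows no tangency there. In the variable v it becomes the endpoint v = 1, where the
  simple factor v - 1 keeps its sign; x = 1/2 becomes the other endpoint v = 0, so double nodes are
  needed only in the interior. The simple-pole terms in the series of M are not integrable over the
  line one by one, so the transform is approached from the other side: the candidate on [0, 1] is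
  expanded in harmonics, and the cosine transform of the harmonic of frequency k is exactly the pair
  of terms with indices k and -k.\<close>

section \<open>Hermite interpolation of absolutely monotone functions\<close>

text \<open>The class is closed under divided differences, which gives the remainder of Hermite
  interpolation a sign.\<close>

definition abs_monotone :: "(real \<Rightarrow> real) \<Rightarrow> bool" where
  "abs_monotone A \<longleftrightarrow>
     (\<exists>a. (\<forall>k. 0 \<le> a k) \<and> (\<forall>v\<in>{0..<1}. (\<lambda>k. a k * v ^ k) sums A v))"

lemma abs_monotone_mono:
  assumes "abs_monotone A" "0 \<le> u" "u \<le> v" "v < 1"
  shows "A u \<le> A v"
proof -
  obtain a where "(\<forall>k. 0 \<le> a k) \<and> (\<forall>v\<in>{0..<1}. (\<lambda>k. a k * v ^ k) sums A v)"
    using assms(1) unfolding abs_monotone_def ..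
  then have a: "\<And>k. 0 \<le> a k" "\<And>v. v \<in> {0..<1} \<Longrightarrow> (\<lambda>k. a k * v ^ k) sums A v" by auto
  show ?thesis
    by (rule sums_le[OF _ a(2) a(2)]) (use assms a(1) in \<open>auto intro!: mult_left_mono power_mono\<close>)
qed

lemma abs_monotone_cmult:
  assumes "abs_monotone A" "0 \<le> c"
  shows "abs_monotone (\<lambda>v. c * A v)"
proof -
  obtain a where "(\<forall>k. 0 \<le> a k) \<and> (\<forall>v\<in>{0..<1}. (\<lambda>k. a k * v ^ k) sums A v)"
    using assms(1) unfolding abs_monotone_def ..
  then have a: "\<And>k. 0 \<le> a k" "\<And>v. v \<in> {0..<1} \<Longrightarrow> (\<lambda>k. a k * v ^ k) sums A v" by auto
  show ?thesis
    unfolding abs_monotone_def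
    by (rule exI[of _ "\<lambda>k. c * a k"]) (use a assms(2) in \<open>auto simp: mult.assoc intro!: sums_mult\<close>)
qed

lemma abs_monotone_differentiable:
  assumes "abs_monotone A" "0 < v" "v < 1"
  shows "\<exists>d. (A has_real_derivative d) (at v)"
proof -
  obtain a where "(\<forall>k. 0 \<le> a k) \<and> (\<forall>v\<in>{0..<1}. (\<lambda>k. a k * v ^ k) sums A v)"
    using assms(1) unfolding abs_monotone_def ..
  then have a: "\<And>v. v \<in> {0..<1} \<Longrightarrow> (\<lambda>k. a k * v ^ k) sums A v" by auto
  obtain K where K: "v < K" "K < 1" using assms dense by blast
  have "((\<lambda>x. \<Sum>n. a n * x ^ n) has_real_derivative (\<Sum>n. diffs a n * v ^ n)) (at v)"
    by (rule termdiffs_strong[of a K]) (use sums_summable[OF a[of K]] K assms(2) in auto)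
  then have "(A has_real_derivative (\<Sum>n. diffs a n * v ^ n)) (at v)"
    by (rule has_field_derivative_transform_within_open[of _ _ _ "{0<..<1}"])
       (use assms(2,3) sums_unique[OF a] in \<open>force+\<close>)
  then show ?thesis by blast
qed

text \<open>Since (v^k - w^k) / (v - w) is the sum of v^i w^(k-1-i), the divided difference has the
  coefficients b i = sum over m of a (i+1+m) w^m, which inherit nonnegativity. What needs work is
  that the new series again converges on all of [0, 1).\<close>

lemma abs_monotone_divided_difference:
  assumes "abs_monotone A" and w: "0 \<le> w" "w < 1"
  shows "\<exists>B. abs_monotone B \<and> (\<forall>v\<in>{0..<1}. A v = A w + (v - w) * B v)"
proof -
  obtain a where "(\<forall>k. 0 \<le> a k) \<and> (\<forall>v\<in>{0..<1}. (\<lambda>k. a k * v ^ k) sums A v)"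
    using assms(1) unfolding abs_monotone_def ..
  then have a0: "\<And>k. 0 \<le> a k" and a: "\<And>v. v \<in> {0..<1} \<Longrightarrow> (\<lambda>k. a k * v ^ k) sums A v" by auto
  define b where "b i = (\<Sum>m. a (i + 1 + m) * w ^ m)" for i
  \<comment> \<open>Cauchy estimate: a k r^k is bounded for each r < 1, and for r > w the sum over m
    costs only the geometric factor 1 / (1 - w/r). So b i grows at most like r^(-i), with r as close
    to 1 as desired.\<close>
  have bsum: "summable (\<lambda>m. a (i + m) * w ^ m)" and
       bnd: "\<exists>C\<ge>0. \<forall>i. (\<Sum>m. a (i + m) * w ^ m) * r ^ i \<le> C" if "w < r" "r < 1" for r i
  proof -
    have r: "0 < r" "r < 1" using that w by auto
    have "summable (\<lambda>k. a k * r ^ k)" using a[of r] r by (auto simp: sums_iff)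
    then have "(\<lambda>k. a k * r ^ k) \<longlonglongrightarrow> 0" by (rule summable_LIMSEQ_zero)
    then have "Bseq (\<lambda>k. a k * r ^ k)" by (simp add: convergent_imp_Bseq convergentI)
    then obtain C where C: "C > 0" "\<And>k. norm (a k * r ^ k) \<le> C" by (auto simp: Bseq_def)
    have le: "a (i + m) * w ^ m \<le> C / r ^ i * (w / r) ^ m" for i m
    proof -
      have "a (i + m) * r ^ (i + m) \<le> C" using C(2)[of "i + m"] by simp
      then have "a (i + m) \<le> C / r ^ (i + m)" using r by (simp add: field_simps)
      then have "a (i + m) * w ^ m \<le> C / r ^ (i + m) * w ^ m" by (rule mult_right_mono) (use w in auto)
      also have "\<dots> = C / r ^ i * (w / r) ^ m" using r by (simp add: power_add power_divide)
      finally show ?thesis .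
    qed
    have sg: "(\<lambda>m. C / r ^ i * (w / r) ^ m) sums (C / r ^ i * (1 / (1 - w / r)))" for i
      by (rule sums_mult, rule geometric_sums) (use that w r in auto)
    have nn: "0 \<le> a (i + m) * w ^ m" for i m using a0 w by auto
    have sm: "summable (\<lambda>m. a (i + m) * w ^ m)" for i
      by (rule summable_comparison_test'[OF sums_summable[OF sg], of 0]) (use le nn in auto)
    show "summable (\<lambda>m. a (i + m) * w ^ m)" by (rule sm)
    show "\<exists>C\<ge>0. \<forall>i. (\<Sum>m. a (i + m) * w ^ m) * r ^ i \<le> C"
    proof (rule exI[of _ "C * (1 / (1 - w / r))"], intro conjI allI)
      show "0 \<le> C * (1 / (1 - w / r))" using C(1) r that by simp
      fix i
      have "(\<Sum>m. a (i + m) * w ^ m) \<le> C / r ^ i * (1 / (1 - w / r))"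
        by (rule sums_le[OF le summable_sums[OF sm] sg])
      then have "(\<Sum>m. a (i + m) * w ^ m) * r ^ i \<le> C / r ^ i * (1 / (1 - w / r)) * r ^ i"
        by (rule mult_right_mono) (use r in auto)
      then show "(\<Sum>m. a (i + m) * w ^ m) * r ^ i \<le> C * (1 / (1 - w / r))" using r by simp
    qed
  qed
  obtain r0 where r0: "w < r0" "r0 < 1" using w dense by blast
  have sm: "summable (\<lambda>m. a (i + m) * w ^ m)" for i by (rule bsum[OF r0])
  have b0: "0 \<le> b i" for i
    unfolding b_def by (rule suminf_nonneg) (use sm[of "i + 1"] a0 w in auto)
  have rec: "(\<Sum>m. a (i + m) * w ^ m) = a i + w * b i" for i
  proof -
    have "(\<Sum>m. a (i + m) * w ^ m) = (\<Sum>m. a (i + Suc m) * w ^ Suc m) + a i"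
      using suminf_split_head[OF sm[of i]] by simp
    also have "(\<Sum>m. a (i + Suc m) * w ^ Suc m) = w * b i"
      unfolding b_def using suminf_mult[OF sm[of "i + 1"], of w] by (simp add: mult_ac)
    finally show ?thesis by simp
  qed
  \<comment> \<open>The recursion \<open>b i = a (i + 1) + w * b (i + 1)\<close> makes the product with \<open>v - w\<close> telescope.\<close>
  have Aw: "A w = a 0 + w * b 0" using rec[of 0] a[of w] w by (simp add: sums_iff)
  have brec: "b i = a (Suc i) + w * b (Suc i)" for i
    using rec[of "Suc i"] by (simp add: b_def)
  define B where "B v = (\<Sum>i. b i * v ^ i)" for v
  have Bs: "(\<lambda>i. b i * v ^ i) sums B v" if v: "v \<in> {0..<1}" for v
  proof -
    \<comment> \<open>r has to exceed w for the tail bound and v for the convergence at v.\<close>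
    obtain r where r: "max v w < r" "r < 1" using v w dense[of "max v w" 1] by auto
    then have r': "w < r" "v < r" "0 < r" using v by auto
    obtain C where C: "C \<ge> 0" "\<And>i. (\<Sum>m. a (i + m) * w ^ m) * r ^ i \<le> C" using bnd[of r] r r' by blast
    have le: "norm (b i * v ^ i) \<le> C / r * (v / r) ^ i" for i
    proof -
      have "b i * r ^ (i + 1) \<le> C" using C(2)[of "i + 1"] by (simp add: b_def)
      then have "b i \<le> C / r ^ (i + 1)" using r' by (simp add: field_simps)
      then have "b i * v ^ i \<le> C / r ^ (i + 1) * v ^ i" by (rule mult_right_mono) (use v in auto)
      moreover have "norm (b i * v ^ i) = b i * v ^ i" using b0[of i] v by simp
      ultimately show ?thesis by (simp add: power_divide)
    qed
    have "summable (\<lambda>i. C / r * (v / r) ^ i)"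
      by (rule summable_mult, rule summable_geometric) (use r' v in auto)
    then have "summable (\<lambda>i. b i * v ^ i)"
      by (rule summable_comparison_test'[where N = 0]) (rule le)
    then show ?thesis unfolding B_def by (rule summable_sums)
  qed
  have "A v = A w + (v - w) * B v" if v: "v \<in> {0..<1}" for v
  proof -
    have 1: "(\<lambda>i. b (Suc i) * v ^ Suc i) sums (B v - b 0)"
      using Bs[OF v] by (subst sums_Suc_iff) simp
    have 2: "(\<lambda>i. a (Suc i) * v ^ Suc i) sums (A v - a 0)"
      using a[OF v] by (subst sums_Suc_iff) simp
    have "(\<lambda>i. v * (b i * v ^ i) - w * (b (Suc i) * v ^ Suc i)) sums (v * B v - w * (B v - b 0))"
      by (intro sums_diff sums_mult Bs[OF v] 1)
    moreover have "v * (b i * v ^ i) - w * (b (Suc i) * v ^ Suc i) = a (Suc i) * v ^ Suc i" for i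
      by (subst brec[of i]) (simp add: algebra_simps)
    ultimately have "v * B v - w * (B v - b 0) = A v - a 0" using 2 by (simp add: sums_iff)
    then show ?thesis using Aw by (simp add: algebra_simps)
  qed
  moreover have "abs_monotone B" unfolding abs_monotone_def using b0 Bs by blast
  ultimately show ?thesis by blast
qed

text \<open>Dividing the power series and the polynomial by v - w together keeps the difference of
  the form series minus polynomial and lowers the degree bound by one. Agreement at w cancels the
  two constant remainders.\<close>

lemma divide_difference_by_node:
  assumes "abs_monotone A" "0 \<le> w" "w < 1" "A w = poly P w" "degree P \<le> Suc n"
  obtains B Q where "abs_monotone B" "degree Q \<le> n"
    "\<forall>v\<in>{0..<1}. A v - poly P v = (v - w) * (B v - poly Q v)"
proof -
  from abs_monotone_divided_difference[OF assms(1-3)]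
  obtain B where B: "abs_monotone B \<and> (\<forall>v\<in>{0..<1}. A v = A w + (v - w) * B v)" ..
  define Q where "Q = synthetic_div P w"
  have P: "P = [:- w, 1:] * Q + [:poly P w:]"
    unfolding Q_def by (rule synthetic_div_correct'[symmetric])
  have Pv: "poly P v = (v - w) * poly Q v + poly P w" for v
    by (subst P) (simp add: algebra_simps)
  have "A v - poly P v = (v - w) * (B v - poly Q v)" if "v \<in> {0..<1}" for v
    using B[THEN conjunct2, rule_format, OF that] assms(4) Pv[of v] by algebra
  moreover have "degree Q \<le> n" using assms(5) by (simp add: Q_def degree_synthetic_div)
  ultimately show thesis using B by (intro that[of B Q] ballI) simp_all
qed

text \<open>A factor q that does not vanish at u passes a double zero of the product on to the
  cofactor. In the induction over the nodes q is the square (v - w)^2 just divided out, and u is one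
  of the nodes still to be treated.\<close>

lemma double_node_factor:
  fixes D E :: "real \<Rightarrow> real"
  assumes "open S" "u \<in> S" "\<And>v. v \<in> S \<Longrightarrow> D v = q v * E v"
    and "(D has_real_derivative 0) (at u)" "D u = 0" "q u \<noteq> 0"
    and "(q has_real_derivative q') (at u)" "(E has_real_derivative e') (at u)"
  shows "E u = 0" "(E has_real_derivative 0) (at u)"
proof -
  show E0: "E u = 0" using assms(2,3,5,6) by auto
  have "((\<lambda>v. q v * E v) has_real_derivative (q' * E u + e' * q u)) (at u)"
    by (rule DERIV_mult[OF assms(7,8), THEN DERIV_cong]) simp
  then have "(D has_real_derivative (q' * E u + e' * q u)) (at u)"
    by (rule has_field_derivative_transform_within_open[OF _ assms(1,2)]) (use assms(3) in auto)
  then have "q' * E u + e' * q u = 0" using assms(4) DERIV_unique by blast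
  then have "e' = 0" using E0 assms(6) by simp
  then show "(E has_real_derivative 0) (at u)" using assms(8) by simp
qed

lemma divide_double_nodes:
  assumes "finite J" "J \<subseteq> {0<..<1}" "abs_monotone A" "degree P \<le> 2 * card J + n"
    and "\<forall>v\<in>J. A v = poly P v \<and> ((\<lambda>v. A v - poly P v) has_real_derivative 0) (at v)"
  shows "\<exists>B Q. abs_monotone B \<and> degree Q \<le> n
     \<and> (\<forall>v\<in>{0..<1}. A v - poly P v = (\<Prod>u\<in>J. (v - u)\<^sup>2) * (B v - poly Q v))"
  using assms
proof (induction J arbitrary: A P rule: finite_induct)
  case empty
  then show ?case by (intro exI[of _ A] exI[of _ P]) simp
next
  case (insert w J)
  have w: "0 < w" "w < 1" using insert.prems(1) by auto
  have nodes: "A v = poly P v" "((\<lambda>v. A v - poly P v) has_real_derivative 0) (at v)"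
    if "v \<in> insert w J" for v
    using bspec[OF insert.prems(4) that] by simp_all
  have dP: "degree P \<le> Suc (Suc (2 * card J + n))" using insert.prems(3) insert.hyps by simp
  obtain B Q where B: "abs_monotone B" "degree Q \<le> Suc (2 * card J + n)"
      "\<forall>v\<in>{0..<1}. A v - poly P v = (v - w) * (B v - poly Q v)"
    by (rule divide_difference_by_node[OF insert.prems(2) _ w(2) nodes(1)[of w] dP]) (use w in simp_all)
  obtain e' where e': "(B has_real_derivative e') (at w)"
    using abs_monotone_differentiable[OF B(1) w] ..
  \<comment> \<open>At w the derivative of (v - w) * (B - Q) is B w - Q w. The second order of
    contact at w is therefore agreement of the quotients at w, which permits a second division by v
    - w.\<close>
  have "((\<lambda>v. (v - w) * (B v - poly Q v)) has_real_derivative (B w - poly Q w)) (at w)"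
    by (rule DERIV_cong[OF DERIV_mult[OF DERIV_diff[OF DERIV_ident DERIV_const] DERIV_diff[OF e' poly_DERIV]]]) simp
  then have "((\<lambda>v. A v - poly P v) has_real_derivative (B w - poly Q w)) (at w)"
    by (rule has_field_derivative_transform_within_open[of _ _ _ "{0<..<1}"])
       (use w in \<open>simp_all add: B(3)[rule_format]\<close>)
  then have "B w - poly Q w = 0" using nodes(2)[of w] by (intro DERIV_unique[of "\<lambda>v. A v - poly P v" _ w]) simp_all
  then have Bw: "B w = poly Q w" by simp
  obtain C R where C: "abs_monotone C" "degree R \<le> 2 * card J + n"
      "\<forall>v\<in>{0..<1}. B v - poly Q v = (v - w) * (C v - poly R v)"
    by (rule divide_difference_by_node[OF B(1) _ w(2) Bw B(2)]) (use w in simp_all)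
  have AP: "A v - poly P v = (v - w)\<^sup>2 * (C v - poly R v)" if "v \<in> {0..<1}" for v
    using B(3)[rule_format, OF that] C(3)[rule_format, OF that] by (simp only: power2_eq_square mult.assoc)
  have J: "C u = poly R u \<and> ((\<lambda>v. C v - poly R v) has_real_derivative 0) (at u)" if "u \<in> J" for u
  proof -
    have u: "0 < u" "u < 1" "u \<noteq> w" using that insert.prems(1) insert.hyps(2) by auto
    obtain c' where c': "(C has_real_derivative c') (at u)"
      using abs_monotone_differentiable[OF C(1) u(1,2)] ..
    have 1: "((\<lambda>v. (v - w)\<^sup>2) has_real_derivative 2 * (u - w)) (at u)"
      by (rule derivative_eq_intros refl | simp)+
    have 2: "((\<lambda>v. C v - poly R v) has_real_derivative c' - poly (pderiv R) u) (at u)"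
      by (intro DERIV_diff c' poly_DERIV)
    have "C u - poly R u = 0"
      by (rule double_node_factor(1)[OF _ _ AP nodes(2) _ _ 1 2, where S = "{0<..<1}"])
         (use u that nodes(1)[of u] in auto)
    moreover have "((\<lambda>v. C v - poly R v) has_real_derivative 0) (at u)"
      by (rule double_node_factor(2)[OF _ _ AP nodes(2) _ _ 1 2, where S = "{0<..<1}"])
         (use u that nodes(1)[of u] in auto)
    ultimately show ?thesis by simp
  qed
  have "\<exists>B Q. abs_monotone B \<and> degree Q \<le> n
     \<and> (\<forall>v\<in>{0..<1}. C v - poly R v = (\<Prod>u\<in>J. (v - u)\<^sup>2) * (B v - poly Q v))"
  proof (rule insert.IH[OF _ C(1,2)])
    show "J \<subseteq> {0<..<1}" using insert.prems(1) by simp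
    show "\<forall>v\<in>J. C v = poly R v \<and> ((\<lambda>v. C v - poly R v) has_real_derivative 0) (at v)"
      by (intro ballI J)
  qed
  then obtain E where "\<exists>Q. abs_monotone E \<and> degree Q \<le> n
     \<and> (\<forall>v\<in>{0..<1}. C v - poly R v = (\<Prod>u\<in>J. (v - u)\<^sup>2) * (E v - poly Q v))" ..
  then obtain S where E: "abs_monotone E \<and> degree S \<le> n
     \<and> (\<forall>v\<in>{0..<1}. C v - poly R v = (\<Prod>u\<in>J. (v - u)\<^sup>2) * (E v - poly S v))" ..
  have "A v - poly P v = (\<Prod>u\<in>insert w J. (v - u)\<^sup>2) * (E v - poly S v)" if "v \<in> {0..<1}" for v
    unfolding AP[OF that] E[THEN conjunct2, THEN conjunct2, rule_format, OF that] prod.insert[OF insert.hyps] by (simp only: mult.assoc)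
  with E show ?case by (intro exI[of _ E] exI[of _ S] conjI ballI) simp_all
qed

text \<open>The last node \<open>v = 1\<close> lies on the boundary of the disc of convergence, hence it enters through
  a limit: the quotient \<open>C\<close> increases to the constant \<open>k\<close>.\<close>

lemma hermite_interpolant_majorizes:
  assumes A: "abs_monotone A" and J: "finite J" "J \<subseteq> {0<..<1}"
    and deg: "degree P \<le> 2 * card J + n" "n \<le> 1" "n = 1 \<Longrightarrow> A 0 = poly P 0"
    and nodes: "\<forall>v\<in>J. A v = poly P v \<and> ((\<lambda>v. A v - poly P v) has_real_derivative 0) (at v)"
    and lim: "((\<lambda>v. A v - poly P v) \<longlongrightarrow> 0) (at_left 1)"
    and v: "0 \<le> v" "v < 1"
  shows "A v \<le> poly P v"
proof -
  from divide_double_nodes[OF J A deg(1) nodes]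
  obtain B where "\<exists>Q. abs_monotone B \<and> degree Q \<le> n
     \<and> (\<forall>v\<in>{0..<1}. A v - poly P v = (\<Prod>u\<in>J. (v - u)\<^sup>2) * (B v - poly Q v))" ..
  then obtain Q where "abs_monotone B \<and> degree Q \<le> n
     \<and> (\<forall>v\<in>{0..<1}. A v - poly P v = (\<Prod>u\<in>J. (v - u)\<^sup>2) * (B v - poly Q v))" ..
  then have B: "abs_monotone B" "degree Q \<le> n"
     "\<forall>v\<in>{0..<1}. A v - poly P v = (\<Prod>u\<in>J. (v - u)\<^sup>2) * (B v - poly Q v)"
    by simp_all
  have J1: "(1 - u)\<^sup>2 > 0" if "u \<in> J" for u using that J(2) by auto
  \<comment> \<open>W collects the squares (v - u)^2 and, for n = 1, the factor v. What is left of
    the polynomial is a constant k, so that only the sign of C - k matters.\<close>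
  obtain C k W where C: "abs_monotone C" "\<forall>v\<in>{0..<1}. A v - poly P v = W v * (C v - k)"
      "\<forall>v\<in>{0..<1}. W v \<ge> 0" "W 1 > 0" "isCont W 1"
  proof (cases "n = 0")
    case True
    then obtain k where k: "Q = [:k:]" using B(2) degree_eq_zeroE by auto
    show thesis
      by (rule that[OF B(1), of "\<lambda>v. \<Prod>u\<in>J. (v - u)\<^sup>2" k])
         (use B(3) k in \<open>auto intro!: prod_nonneg prod_pos continuous_intros J1\<close>)
  next
    case False
    then have n: "n = 1" using deg(2) by simp
    have "(\<Prod>u\<in>J. (0 - u)\<^sup>2) \<noteq> 0" using J by auto
    then have B0: "B 0 = poly Q 0" using B(3)[rule_format, of 0] deg(3) n by simp
    obtain C R where C: "abs_monotone C" "degree R \<le> 0"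
      "\<forall>v\<in>{0..<1}. B v - poly Q v = (v - 0) * (C v - poly R v)"
    proof (rule divide_difference_by_node[OF B(1) _ _ B0])
      show "degree Q \<le> Suc 0" using n B(2) by simp
    qed simp_all
    then obtain k where k: "R = [:k:]" using degree_eq_zeroE by auto
    have "A v - poly P v = (\<Prod>u\<in>J. (v - u)\<^sup>2) * v * (C v - k)" if "v \<in> {0..<1}" for v
      using B(3)[rule_format, OF that] C(3)[rule_format, OF that] k by simp
    then show thesis
      by (intro that[OF C(1), of "\<lambda>v. (\<Prod>u\<in>J. (v - u)\<^sup>2) * v" k] ballI)
         (auto intro!: prod_nonneg prod_pos mult_nonneg_nonneg continuous_intros J1)
  qed
  \<comment> \<open>W is positive at 1, so contact at 1 becomes convergence of C to k.\<close>
  have lim1: "((\<lambda>v. (A v - poly P v) / W v) \<longlongrightarrow> 0 / W 1) (at_left 1)"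
  proof (intro tendsto_divide lim)
    show "(W \<longlongrightarrow> W 1) (at_left 1)" using C(5) by (simp add: isCont_def filterlim_at_split)
    show "W 1 \<noteq> 0" using C(4) by simp
  qed
  have "eventually (\<lambda>v. W v > 0) (at_left 1)"
    using order_tendstoD(1)[of W "W 1" "at_left 1" 0] C(4,5) by (simp add: isCont_def filterlim_at_split)
  then have ev: "eventually (\<lambda>v. (A v - poly P v) / W v = C v - k) (at_left 1)"
    using eventually_at_left_real[of 0 1, OF zero_less_one]
  proof eventually_elim
    case (elim v)
    then have "A v - poly P v = W v * (C v - k)" by (intro bspec[OF C(2)]) simp
    then show ?case using elim(1) by (simp add: field_simps)
  qed
  have lim2: "((\<lambda>v. C v - k) \<longlongrightarrow> 0 / W 1) (at_left 1)"
    by (rule Lim_transform_eventually[OF lim1 ev])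
  have "eventually (\<lambda>u. C v - k \<le> C u - k) (at_left 1)"
    using eventually_at_left_real[OF v(2)]
  proof eventually_elim
    case (elim u)
    then show ?case using abs_monotone_mono[OF C(1) v(1), of u] by simp
  qed
  then have "C v - k \<le> 0 / W 1" by (rule tendsto_lowerbound[OF lim2]) simp
  moreover have "W v \<ge> 0" by (rule bspec[OF C(3)]) (use v in simp)
  ultimately have "W v * (C v - k) \<le> 0" by (intro mult_nonneg_nonpos) auto
  moreover have "A v - poly P v = W v * (C v - k)" by (rule bspec[OF C(2)]) (use v in simp)
  ultimately show ?thesis by linarith
qed

section \<open>The power series of cosh (b t) in the square of sin t\<close>

lemma cosh_ode_unique:
  fixes Y Y' :: "real \<Rightarrow> real"
  assumes "convex S" "0 \<in> S" "\<theta> \<in> S"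
    and Y: "\<And>t. t \<in> S \<Longrightarrow> (Y has_real_derivative Y' t) (at t)"
    and Y': "\<And>t. t \<in> S \<Longrightarrow> (Y' has_real_derivative b\<^sup>2 * Y t) (at t)"
    and init: "Y 0 = 1" "Y' 0 = 0"
  shows "Y \<theta> = cosh (b * \<theta>)"
proof -
  \<comment> \<open>This is the Wronskian of Y and cosh (b t). It is constant and vanishes at 0, so
    the quotient Y / cosh (b t) has derivative 0.\<close>
  have "((\<lambda>t. Y' t * cosh (b * t) - b * Y t * sinh (b * t)) has_real_derivative 0) (at t within S)"
    if "t \<in> S" for t
    by (rule DERIV_subset[of _ _ _ UNIV], (rule derivative_eq_intros Y[OF that] Y'[OF that] refl)+)
       (auto simp: algebra_simps power2_eq_square)
  from has_field_derivative_zero_constant[OF assms(1) this]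
  obtain c where c: "\<And>t. t \<in> S \<Longrightarrow> Y' t * cosh (b * t) - b * Y t * sinh (b * t) = c" by blast
  have "c = 0" using c[OF assms(2)] init by simp
  then have W: "Y' t * cosh (b * t) = b * Y t * sinh (b * t)" if "t \<in> S" for t
    using c[OF that] \<open>c = 0\<close> by simp
  have dcosh: "((\<lambda>t. cosh (b * t)) has_real_derivative b * sinh (b * t)) (at t)" for t
    by (auto intro!: derivative_eq_intros)
  have "((\<lambda>t. Y t / cosh (b * t)) has_real_derivative 0) (at t within S)" if "t \<in> S" for t
  proof (rule DERIV_subset[of _ _ _ UNIV])
    have "Y' t * cosh (b * t) - Y t * (b * sinh (b * t)) = 0" using W[OF that] by (simp add: mult_ac)
    then show "((\<lambda>t. Y t / cosh (b * t)) has_real_derivative 0) (at t)"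
      using DERIV_divide[OF Y[OF that] dcosh[of t]] by simp
  qed simp
  from has_field_derivative_zero_constant[OF assms(1) this]
  obtain c where c: "\<And>t. t \<in> S \<Longrightarrow> Y t / cosh (b * t) = c" by blast
  have "Y \<theta> / cosh (b * \<theta>) = Y 0 / cosh (b * 0)" unfolding c[OF assms(3)] c[OF assms(2)] ..
  then show ?thesis using init by simp
qed

text \<open>Substituting \<open>v = (sin \<theta>)\<^sup>2\<close> into a power series \<open>A\<close> turns \<open>Y'' = b\<^sup>2 Y\<close> into
  \<open>4 v (1 - v) A'' + 2 (1 - 2 v) A' = b\<^sup>2 A\<close>, which determines the coefficients.\<close>

primrec cosh_coeff :: "real \<Rightarrow> nat \<Rightarrow> real" where
  "cosh_coeff b 0 = 1"
| "cosh_coeff b (Suc k) = cosh_coeff b k * ((4 * (real k)\<^sup>2 + b\<^sup>2) / ((2 * real k + 1) * (2 * real k + 2)))"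

lemma cosh_coeff_nonneg: "0 \<le> cosh_coeff b k"
  by (induction k) auto

lemma summable_cosh_coeff:
  assumes "\<bar>v\<bar> < 1"
  shows "summable (\<lambda>k. cosh_coeff b k * v ^ k)"
proof -
  obtain c where c: "\<bar>v\<bar> < c" "c < 1" using assms dense by blast
  have "(\<lambda>k. (4 * (real k)\<^sup>2 + b\<^sup>2) / ((2 * real k + 1) * (2 * real k + 2))) \<longlonglongrightarrow> 1"
    by real_asymp
  then have "(\<lambda>k. (4 * (real k)\<^sup>2 + b\<^sup>2) / ((2 * real k + 1) * (2 * real k + 2)) * \<bar>v\<bar>) \<longlonglongrightarrow> 1 * \<bar>v\<bar>"
    by (intro tendsto_mult tendsto_const)
  then have "eventually (\<lambda>k. (4 * (real k)\<^sup>2 + b\<^sup>2) / ((2 * real k + 1) * (2 * real k + 2)) * \<bar>v\<bar> < c) sequentially"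
    using c(1) by (intro order_tendstoD(2)[where y = "1 * \<bar>v\<bar>"]) auto
  then obtain M where M: "\<And>k. k \<ge> M \<Longrightarrow> (4 * (real k)\<^sup>2 + b\<^sup>2) / ((2 * real k + 1) * (2 * real k + 2)) * \<bar>v\<bar> < c"
    by (auto simp: eventually_sequentially)
  show ?thesis
  proof (rule summable_ratio_test[OF c(2), of M])
    fix k assume k: "M \<le> k"
    have "norm (cosh_coeff b (Suc k) * v ^ Suc k) =
        ((4 * (real k)\<^sup>2 + b\<^sup>2) / ((2 * real k + 1) * (2 * real k + 2)) * \<bar>v\<bar>) * norm (cosh_coeff b k * v ^ k)"
      using cosh_coeff_nonneg[of b k] by (simp add: abs_mult power_abs)
    also have "\<dots> \<le> c * norm (cosh_coeff b k * v ^ k)"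
      by (rule mult_right_mono) (use M[OF k] in auto)
    finally show "norm (cosh_coeff b (Suc k) * v ^ Suc k) \<le> c * norm (cosh_coeff b k * v ^ k)" .
  qed
qed

lemma cosh_power_series_sin_squared:
  assumes "\<bar>\<theta>\<bar> < pi / 2"
  shows "(\<lambda>k. cosh_coeff b k * (sin \<theta> ^ 2) ^ k) sums cosh (b * \<theta>)"
proof -
  define a where "a = cosh_coeff b"
  define A where "A v = (\<Sum>k. a k * v ^ k)" for v
  define A1 where "A1 v = (\<Sum>k. diffs a k * v ^ k)" for v
  define A2 where "A2 v = (\<Sum>k. diffs (diffs a) k * v ^ k)" for v
  have s0: "summable (\<lambda>k. a k * v ^ k)" if "\<bar>v\<bar> < 1" for v
    using summable_cosh_coeff[OF that] by (simp add: a_def)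
  have s1: "summable (\<lambda>k. diffs a k * v ^ k)" if "\<bar>v\<bar> < 1" for v
    by (rule termdiff_converges[of v 1]) (use that s0 in auto)
  have s2: "summable (\<lambda>k. diffs (diffs a) k * v ^ k)" if "\<bar>v\<bar> < 1" for v
    by (rule termdiff_converges[of v 1]) (use that s1 in auto)
  have d: "(A has_real_derivative A1 v) (at v)" "(A1 has_real_derivative A2 v) (at v)" if v: "\<bar>v\<bar> < 1" for v
  proof -
    obtain K where K: "\<bar>v\<bar> < K" "K < 1" using v dense by blast
    show "(A has_real_derivative A1 v) (at v)" unfolding A_def A1_def
      by (rule termdiffs_strong[of a K]) (use s0[of K] K in auto)
    show "(A1 has_real_derivative A2 v) (at v)" unfolding A1_def A2_def
      by (rule termdiffs_strong[of "diffs a" K]) (use s1[of K] K in auto)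
  qed
  have ode: "4 * v * (1 - v) * A2 v + 2 * (1 - 2 * v) * A1 v = b\<^sup>2 * A v" if v: "\<bar>v\<bar> < 1" for v
  proof -
    have p2: "(\<lambda>k. real k * diffs a k * v ^ (k - 1)) sums A2 v"
      unfolding A2_def One_nat_def by (rule diffs_equiv[OF s2[OF v]])
    have p1: "(\<lambda>k. real k * a k * v ^ (k - 1)) sums A1 v"
      unfolding A1_def One_nat_def by (rule diffs_equiv[OF s1[OF v]])
    have q0: "(\<lambda>k. diffs a k * v ^ k) sums A1 v"
      using s1[OF v] unfolding A1_def by (rule summable_sums)
    \<comment> \<open>For k = 0 the truncated exponent k - 1 is harmless because of the factor
      \<open>real k\<close>.\<close>
    have vv: "real k * x * v ^ (k - 1) * v = real k * x * v ^ k" for k :: nat and x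
      by (cases k) simp_all
    have q2: "(\<lambda>k. real k * diffs a k * v ^ k) sums (A2 v * v)"
      using sums_mult2[OF p2, of v] by (simp only: vv)
    have q1: "(\<lambda>k. real k * a k * v ^ k) sums (A1 v * v)"
      using sums_mult2[OF p1, of v] by (simp only: vv)
    have "(\<lambda>k. real (Suc k) * (real k * a (Suc k)) * v ^ k) sums (A2 v * v)"
      using q2 by (simp add: diffs_def mult_ac)
    then have "(\<lambda>k. real (Suc k) * (real k * a (Suc k)) * v ^ k * v) sums (A2 v * v * v)"
      by (rule sums_mult2)
    then have "(\<lambda>k. real (Suc k) * (real (Suc k - 1) * a (Suc k)) * v ^ Suc k) sums (A2 v * v * v)"
      by (simp add: mult_ac)
    then have q3: "(\<lambda>k. real k * (real (k - 1) * a k) * v ^ k) sums (A2 v * v * v)"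
      by (subst (asm) sums_Suc_iff) simp
    \<comment> \<open>The coefficient of v^k on the left is (4k + 2)(k + 1) a (k+1) - 4 k^2 a k, and
      (4k + 2)(k + 1) = (2k + 1)(2k + 2). Equating it with b^2 a k is the recursion of
      \<open>cosh_coeff\<close>.\<close>
    have "(\<lambda>k. 4 * (real k * diffs a k * v ^ k) - 4 * (real k * (real (k - 1) * a k) * v ^ k)
         + 2 * (diffs a k * v ^ k) - 4 * (real k * a k * v ^ k)) sums
         (4 * (A2 v * v) - 4 * (A2 v * v * v) + 2 * A1 v - 4 * (A1 v * v))"
      by (rule sums_diff[OF sums_add[OF sums_diff[OF sums_mult[OF q2] sums_mult[OF q3]] sums_mult[OF q0]] sums_mult[OF q1]])
    moreover have "4 * (real k * diffs a k * v ^ k) - 4 * (real k * (real (k - 1) * a k) * v ^ k)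
         + 2 * (diffs a k * v ^ k) - 4 * (real k * a k * v ^ k) = b\<^sup>2 * (a k * v ^ k)" for k
    proof -
      have "(2 * real k + 1) * (2 * real k + 2) * a (Suc k) = (4 * (real k)\<^sup>2 + b\<^sup>2) * a k"
        by (simp add: a_def)
      moreover have "diffs a k = (real k + 1) * a (Suc k)" by (simp add: diffs_def)
      ultimately have dk: "4 * real k * diffs a k + 2 * diffs a k = (4 * (real k)\<^sup>2 + b\<^sup>2) * a k"
        by algebra
      have kk: "real k * real (k - 1) = (real k)\<^sup>2 - real k"
        by (cases k) (simp_all add: algebra_simps power2_eq_square)
      have "4 * (x * d * w) - 4 * (x * (z * y) * w) + 2 * (d * w) - 4 * (x * y * w) = b\<^sup>2 * (y * w)"
        if "4 * x * d + 2 * d = (4 * x\<^sup>2 + b\<^sup>2) * y" "x * z = x\<^sup>2 - x" for x y z d w :: real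
        using that by algebra
      from this[OF dk kk] show ?thesis .
    qed
    ultimately have "(\<lambda>k. b\<^sup>2 * (a k * v ^ k)) sums (4 * (A2 v * v) - 4 * (A2 v * v * v) + 2 * A1 v - 4 * (A1 v * v))"
      by simp
    moreover have "(\<lambda>k. b\<^sup>2 * (a k * v ^ k)) sums (b\<^sup>2 * A v)"
      using s0[OF v] by (intro sums_mult) (simp add: A_def summable_sums)
    ultimately have "4 * (A2 v * v) - 4 * (A2 v * v * v) + 2 * A1 v - 4 * (A1 v * v) = b\<^sup>2 * A v"
      by (rule sums_unique2)
    then show ?thesis by (simp add: algebra_simps)
  qed
  have sin1: "\<bar>(sin t)\<^sup>2\<bar> < 1" if "t \<in> {- (pi/2)<..<pi/2}" for t
  proof -
    have "cos t > 0" using that by (intro cos_gt_zero_pi) auto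
    then have "(cos t)\<^sup>2 > 0" by (intro zero_less_power)
    then have "(sin t)\<^sup>2 < 1" using sin_cos_squared_add[of t] by linarith
    then show ?thesis by (subst abs_of_nonneg[OF zero_le_power2])
  qed
  have "A ((sin \<theta>)\<^sup>2) = cosh (b * \<theta>)"
  proof (rule cosh_ode_unique[where S = "{- (pi/2)<..<pi/2}" and Y = "\<lambda>t. A ((sin t)\<^sup>2)"
        and Y' = "\<lambda>t. A1 ((sin t)\<^sup>2) * (2 * sin t * cos t)"])
    fix t :: real assume t: "t \<in> {- (pi/2)<..<pi/2}"
    have ds: "((\<lambda>t. (sin t)\<^sup>2) has_real_derivative 2 * sin t * cos t) (at t)"
    proof (rule DERIV_cong)
      show "((\<lambda>t. (sin t)\<^sup>2) has_real_derivative of_nat 2 * (cos t * sin t ^ (2 - Suc 0))) (at t)"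
        by (rule DERIV_power[OF DERIV_sin])
    qed simp
    show "((\<lambda>t. A ((sin t)\<^sup>2)) has_real_derivative A1 ((sin t)\<^sup>2) * (2 * sin t * cos t)) (at t)"
      by (rule DERIV_chain2[where g = "\<lambda>t. (sin t)\<^sup>2", OF d(1)[OF sin1[OF t]] ds])
    have d2: "((\<lambda>t. A1 ((sin t)\<^sup>2)) has_real_derivative A2 ((sin t)\<^sup>2) * (2 * sin t * cos t)) (at t)"
      by (rule DERIV_chain2[where g = "\<lambda>t. (sin t)\<^sup>2", OF d(2)[OF sin1[OF t]] ds])
    have ds2: "((\<lambda>t. 2 * sin t * cos t) has_real_derivative 2 * (1 - 2 * (sin t)\<^sup>2)) (at t)"
    proof (rule DERIV_cong)
      show "((\<lambda>t. 2 * sin t * cos t) has_real_derivative 2 * cos t * cos t + - sin t * (2 * sin t)) (at t)"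
        by (rule DERIV_mult[OF DERIV_cmult[OF DERIV_sin] DERIV_cos])
      show "2 * cos t * cos t + - sin t * (2 * sin t) = 2 * (1 - 2 * (sin t)\<^sup>2)"
        using cos_squared_eq[of t] by algebra
    qed
    have sc: "2 * sin t * cos t * (2 * sin t * cos t) = 4 * (sin t)\<^sup>2 * (1 - (sin t)\<^sup>2)"
      using cos_squared_eq[of t] by algebra
    note DERIV_mult[OF d2 ds2]
    also have "A2 ((sin t)\<^sup>2) * (2 * sin t * cos t) * (2 * sin t * cos t)
        + 2 * (1 - 2 * (sin t)\<^sup>2) * A1 ((sin t)\<^sup>2) =
        4 * (sin t)\<^sup>2 * (1 - (sin t)\<^sup>2) * A2 ((sin t)\<^sup>2) + 2 * (1 - 2 * (sin t)\<^sup>2) * A1 ((sin t)\<^sup>2)"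
      unfolding mult.assoc[of "A2 _"] sc by (simp only: mult.commute)
    also have "\<dots> = b\<^sup>2 * A ((sin t)\<^sup>2)" by (rule ode[OF sin1[OF t]])
    finally show "((\<lambda>t. A1 ((sin t)\<^sup>2) * (2 * sin t * cos t)) has_real_derivative b\<^sup>2 * A ((sin t)\<^sup>2)) (at t)" .
  qed (use assms s0 in \<open>auto simp: A_def a_def abs_less_iff\<close>)
  moreover have "(\<lambda>k. a k * ((sin \<theta>)\<^sup>2) ^ k) sums A ((sin \<theta>)\<^sup>2)"
    unfolding A_def by (intro summable_sums s0 sin1) (use assms in \<open>simp add: abs_if split: if_splits; linarith\<close>)
  ultimately show ?thesis by (simp add: a_def)
qed

text \<open>The shift by 1/2 turns the sine into a cosine up to sign, so with b = l / pi the series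
  in the square of a sine becomes one in v = (cos (pi x))^2. In this variable the corner x = 0 sits
  at v = 1 and the minimum x = 1/2 at v = 0.\<close>

lemma cosh_abs_monotone:
  "\<exists>A. abs_monotone A \<and> (\<forall>x\<in>{0<..<1}. cosh (l * (x - 1 / 2)) = A ((cos (pi * x))\<^sup>2))"
proof (intro exI conjI ballI)
  define A where "A v = (\<Sum>k. cosh_coeff (l / pi) k * v ^ k)" for v
  have sA: "(\<lambda>k. cosh_coeff (l / pi) k * v ^ k) sums A v" if "v \<in> {0..<1}" for v
    unfolding A_def using summable_cosh_coeff[of v "l / pi"] that by (intro summable_sums) auto
  show "abs_monotone A" unfolding abs_monotone_def using sA cosh_coeff_nonneg by blast
  fix x :: real assume x: "x \<in> {0<..<1}"
  have "\<bar>pi * (x - 1 / 2)\<bar> < pi / 2"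
  proof -
    have "\<bar>x - 1 / 2\<bar> < 1 / 2" using x unfolding greaterThanLessThan_iff by linarith
    then have "pi * \<bar>x - 1 / 2\<bar> < pi * (1 / 2)" by (intro mult_strict_left_mono) simp_all
    then show ?thesis by (simp add: abs_mult)
  qed
  from cosh_power_series_sin_squared[OF this, of "l / pi"]
  have "(\<lambda>k. cosh_coeff (l / pi) k * ((sin (pi * (x - 1 / 2)))\<^sup>2) ^ k) sums cosh (l * (x - 1 / 2))" by simp
  moreover have "(sin (pi * (x - 1 / 2)))\<^sup>2 = (cos (pi * x))\<^sup>2"
    by (simp add: right_diff_distrib sin_diff)
  ultimately show "cosh (l * (x - 1 / 2)) = A ((cos (pi * x))\<^sup>2)" by (simp add: A_def sums_iff)
qed

section \<open>Discrete Fourier transform of the interpolation data\<close>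

lemma unit_exp_cis: "unit_exp x = cis (2 * pi * x)"
  by (simp add: unit_exp_def cis_conv_exp mult_ac)

lemma unit_exp_add: "unit_exp (x + y) = unit_exp x * unit_exp y"
  by (simp add: unit_exp_cis cis_mult distrib_left)

lemma unit_exp_0 [simp]: "unit_exp 0 = 1"
  by (simp add: unit_exp_cis)

lemma unit_exp_of_int [simp]: "unit_exp (of_int k) = 1"
  using cis_multiple_2pi[of "of_int k"] by (simp add: unit_exp_cis)

lemma unit_exp_of_nat [simp]: "unit_exp (of_nat k) = 1"
  using unit_exp_of_int[of "int k"] by (simp del: unit_exp_of_int)

lemma norm_unit_exp [simp]: "norm (unit_exp x) = 1"
  by (simp add: unit_exp_cis)

lemma unit_exp_of_nat_mult: "unit_exp (of_nat n * x) = unit_exp x ^ n"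
  by (simp add: unit_exp_cis Complex.DeMoivre mult_ac)

lemma unit_exp_eq_1_iff: "unit_exp x = 1 \<longleftrightarrow> x \<in> \<int>"
proof
  assume "unit_exp x = 1"
  then have "cos (2 * pi * x) = 1" by (simp add: unit_exp_cis complex_eq_iff)
  then obtain n :: int where "2 * pi * x = of_int n * 2 * pi" using cos_one_2pi_int by auto
  then have "x = of_int n" by simp
  then show "x \<in> \<int>" by simp
qed (auto elim: Ints_cases)

lemma sum_unit_exp_multiples:
  fixes L :: nat and k :: int
  assumes "L > 0"
  shows "(\<Sum>j<L. unit_exp (of_int k * of_nat j / of_nat L)) = (if int L dvd k then of_nat L else 0)"
proof -
  define z where "z = unit_exp (of_int k / of_nat L)"
  have e: "unit_exp (of_int k * of_nat j / of_nat L) = z ^ j" for j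
    using unit_exp_of_nat_mult[of j "of_int k / of_nat L"] by (simp add: z_def mult_ac)
  have zL: "z ^ L = 1" using e[of L] assms by simp
  have z1: "z = 1 \<longleftrightarrow> int L dvd k"
  proof -
    have "z = 1 \<longleftrightarrow> (of_int k / of_nat L :: real) \<in> \<int>" by (simp add: z_def unit_exp_eq_1_iff)
    also have "\<dots> \<longleftrightarrow> int L dvd k"
      using of_int_div_of_int_in_Ints_iff[of k "int L", where 'a = real] assms by simp
    finally show ?thesis .
  qed
  show ?thesis
  proof (cases "z = 1")
    case True
    then show ?thesis using z1 e by simp
  next
    case False
    then show ?thesis using z1 e geometric_sum[OF False, of L] zL by simp
  qed
qed

text \<open>Both signs s are allowed because the inversion is applied in either direction: from grid
  values back to folded coefficients, and from the discrete transform back to grid values.\<close>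

lemma discrete_fourier_inversion:
  fixes B :: "nat \<Rightarrow> complex"
  assumes "m < L" and s: "s = 1 \<or> s = (- 1 :: real)"
  shows "(\<Sum>j<L. (\<Sum>n<L. B n * unit_exp (s * (of_nat n * of_nat j / of_nat L)))
           * unit_exp (- s * (of_nat m * of_nat j / of_nat L))) = of_nat L * B m"
proof -
  have L: "L > 0" using assms(1) by simp
  obtain \<sigma> :: int where \<sigma>: "s = of_int \<sigma>" "\<sigma> = 1 \<or> \<sigma> = -1" using s by (metis of_int_1 of_int_minus)
  have *: "unit_exp (s * (of_nat n * of_nat j / of_nat L)) * unit_exp (- s * (of_nat m * of_nat j / of_nat L))
      = unit_exp (of_int (\<sigma> * (int n - int m)) * of_nat j / of_nat L)" for n j
    unfolding unit_exp_add[symmetric] \<sigma> by (rule arg_cong[of _ _ unit_exp]) (simp add: field_simps diff_divide_distrib)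
  have dvd: "int L dvd \<sigma> * (int n - int m) \<longleftrightarrow> n = m" if "n < L" for n
  proof -
    have "int L dvd \<sigma> * (int n - int m) \<longleftrightarrow> int L dvd int n - int m"
      using \<sigma>(2) dvd_minus_iff[of "int L" "int n - int m"] by auto
    also have "\<dots> \<longleftrightarrow> int n - int m = 0"
      using dvd_imp_le_int[of "int n - int m" "int L"] that assms(1) by fastforce
    finally show ?thesis by auto
  qed
  have "(\<Sum>j<L. (\<Sum>n<L. B n * unit_exp (s * (of_nat n * of_nat j / of_nat L)))
           * unit_exp (- s * (of_nat m * of_nat j / of_nat L)))
      = (\<Sum>j<L. \<Sum>n<L. B n * unit_exp (of_int (\<sigma> * (int n - int m)) * of_nat j / of_nat L))"
    by (simp only: sum_distrib_right mult.assoc *)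
  also have "\<dots> = (\<Sum>n<L. B n * (\<Sum>j<L. unit_exp (of_int (\<sigma> * (int n - int m)) * of_nat j / of_nat L)))"
    by (subst sum.swap) (simp only: sum_distrib_left)
  also have "\<dots> = (\<Sum>n<L. if n = m then B n * of_nat L else 0)"
    by (intro sum.cong refl) (simp add: sum_unit_exp_multiples[OF L] dvd del: of_int_mult of_int_diff)
  also have "\<dots> = of_nat L * B m" using assms(1) by simp
  finally show ?thesis .
qed

text \<open>At the points j/(N+1) the frequencies n and n - (N+1) cannot be told apart, so 2N+1
  coefficients fold into N+1. Frequency 0 stays alone, since its partner -(N+1) is out of
  range.\<close>

lemma sum_symmetric_fold:
  fixes a :: "int \<Rightarrow> complex" and j :: int
  shows "(\<Sum>n\<in>{- int N..int N}. a n * unit_exp (of_int n * (of_int j / (real N + 1))))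
     = (\<Sum>n<Suc N. (a (int n) + (if n = 0 then 0 else a (int n - int (Suc N))))
          * unit_exp (of_nat n * (of_int j / (real N + 1))))"
proof -
  let ?x = "of_int j / (real N + 1)"
  have U: "{- int N..int N} = int ` {..<Suc N} \<union> (\<lambda>n. int n - int (Suc N)) ` {1..<Suc N}"
  proof (intro equalityI subsetI)
    fix n assume n: "n \<in> {- int N..int N}"
    show "n \<in> int ` {..<Suc N} \<union> (\<lambda>n. int n - int (Suc N)) ` {1..<Suc N}"
    proof (cases "n \<ge> 0")
      case True
      then show ?thesis using n by (intro UnI1 image_eqI[of _ _ "nat n"]) auto
    next
      case False
      then show ?thesis using n by (intro UnI2 image_eqI[of _ _ "nat (n + int (Suc N))"]) auto
    qed
  qed auto
  have per: "unit_exp (of_int (int n - int (Suc N)) * ?x) = unit_exp (of_nat n * ?x)" for n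
  proof -
    have "(of_int (int n - int (Suc N)) * ?x) = of_nat n * ?x + of_int (- j)"
      by (simp add: field_simps)
    then show ?thesis by (simp only: unit_exp_add unit_exp_of_int mult_1_right)
  qed
  have "(\<Sum>n\<in>{- int N..int N}. a n * unit_exp (of_int n * ?x)) =
     (\<Sum>n\<in>int ` {..<Suc N}. a n * unit_exp (of_int n * ?x))
     + (\<Sum>n\<in>(\<lambda>n. int n - int (Suc N)) ` {1..<Suc N}. a n * unit_exp (of_int n * ?x))"
    unfolding U by (rule sum.union_disjoint) auto
  also have "(\<Sum>n\<in>int ` {..<Suc N}. a n * unit_exp (of_int n * ?x))
     = (\<Sum>n<Suc N. a (int n) * unit_exp (of_nat n * ?x))"
    by (subst sum.reindex) (auto simp: inj_on_def)
  also have "(\<Sum>n\<in>(\<lambda>n. int n - int (Suc N)) ` {1..<Suc N}. a n * unit_exp (of_int n * ?x))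
     = (\<Sum>n\<in>{1..<Suc N}. a (int n - int (Suc N)) * unit_exp (of_nat n * ?x))"
    by (subst sum.reindex) (simp add: inj_on_def, simp only: o_def per)
  also have "\<dots> = (\<Sum>n\<in>{..<Suc N}. (if n = 0 then 0 else a (int n - int (Suc N))) * unit_exp (of_nat n * ?x))"
    by (rule sum.mono_neutral_cong_left) auto
  finally show ?thesis by (simp only: sum.distrib[symmetric] distrib_right)
qed

text \<open>The Poisson kernel of the unit disc at radius exp (-l): the sum over all integers k of
  exp (-l |k|) e(kt).\<close>

definition poisson :: "real \<Rightarrow> real \<Rightarrow> real" where
  "poisson l t = sinh l / (cosh l - cos (2 * pi * t))"

text \<open>On \<open>[-1, 1]\<close> this is the Fourier transform of the majorant \<open>M(l, x)\<close>.\<close>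

definition phi :: "real \<Rightarrow> real \<Rightarrow> real" where
  "phi l t = ((1 - \<bar>t\<bar>) * sinh l + l / (2 * pi) * sin (2 * pi * \<bar>t\<bar>)) / (cosh l - cos (2 * pi * t))"

text \<open>Stands for the periodic sum of exponentials on [0, 1] only. It is not continued
  periodically: for l > 0 the formula is smooth and convex in x on the whole line, so derivatives
  and tangent lines are available without treating the integers separately.\<close>

definition periodized :: "real \<Rightarrow> real \<Rightarrow> real" where
  "periodized l x = cosh (l * (x - 1 / 2)) / sinh (l / 2)"

lemma cosh_gt_cos:
  assumes "0 < (l :: real)" shows "0 < cosh l - cos y"
proof -
  have "1 < cosh l" using assms cosh_real_strict_mono[of 0 l] by simp
  then show ?thesis using cos_le_one[of y] by linarith
qed

text \<open>The first sum governs the values on the grid, the second one, weighted by the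
  frequencies, the derivatives. In the first the tent factors add up to 1 and the sine parts cancel;
  in the second the roles are exchanged. The two linear equations determine \<open>phi\<close> at t
  and t - 1, which explains its formula.\<close>

lemma phi_fold:
  assumes "0 < l" "0 < t" "t < 1"
  shows "phi l t + phi l (t - 1) = poisson l t"
    and "t * phi l t + (t - 1) * phi l (t - 1) = l / (2 * pi) * sin (2 * pi * t) / (cosh l - cos (2 * pi * t))"
proof -
  have c: "cos (2 * pi * (t - 1)) = cos (2 * pi * t)" "sin (2 * pi * \<bar>t - 1\<bar>) = - sin (2 * pi * t)"
    using assms by (simp_all add: right_diff_distrib cos_diff sin_diff)
  have 1: "phi l t = ((1 - t) * sinh l + l / (2 * pi) * sin (2 * pi * t)) / (cosh l - cos (2 * pi * t))"
    using assms by (simp add: phi_def)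
  have 2: "phi l (t - 1) = (t * sinh l - l / (2 * pi) * sin (2 * pi * t)) / (cosh l - cos (2 * pi * t))"
    unfolding phi_def c using assms by simp
  show "phi l t + phi l (t - 1) = poisson l t"
    unfolding 1 2 poisson_def add_divide_distrib[symmetric] by (simp add: algebra_simps)
  show "t * phi l t + (t - 1) * phi l (t - 1) = l / (2 * pi) * sin (2 * pi * t) / (cosh l - cos (2 * pi * t))"
    unfolding 1 2 times_divide_eq_right add_divide_distrib[symmetric]
    by (rule arg_cong2[of _ _ _ _ "(/)"]) (algebra, rule refl)
qed

lemma phi_0: "phi l 0 = poisson l 0"
  by (simp add: phi_def poisson_def)

lemma sum_geometric_cosh:
  fixes w :: complex and q :: complex
  assumes q: "q \<noteq> 0" and w: "w \<noteq> 0" "w ^ L = 1" and ne: "q * w \<noteq> 1" "w / q \<noteq> 1"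
  shows "(\<Sum>j<L. (q ^ j * y + y' / q ^ j) * w ^ j)
    = y * (q ^ L - 1) / (q * w - 1) + y' * (1 / q ^ L - 1) / (w / q - 1)"
proof -
  have "(\<Sum>j<L. (q ^ j * y + y' / q ^ j) * w ^ j) = (\<Sum>j<L. y * (q * w) ^ j + y' * (w / q) ^ j)"
    by (intro sum.cong refl) (simp add: field_simps power_mult_distrib)
  also have "\<dots> = y * (\<Sum>j<L. (q * w) ^ j) + y' * (\<Sum>j<L. (w / q) ^ j)"
    by (simp add: sum.distrib sum_distrib_left)
  also have "\<dots> = y * (((q * w) ^ L - 1) / (q * w - 1)) + y' * (((w / q) ^ L - 1) / (w / q - 1))"
    unfolding geometric_sum[OF ne(1)] geometric_sum[OF ne(2)] ..
  finally show ?thesis using w(2) by (simp add: power_mult_distrib power_divide)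
qed

text \<open>The samples are combinations of q^j and q^(-j) with q = exp (l/L), so the transform
  consists of two geometric sums. With h = exp (l/2) one has q^L = h^2, and both numerators become
  plus or minus S = 2 sinh (l/2), which cancels the denominator of
  \<open>periodized\<close>.\<close>

lemma poisson_transform:
  fixes L n :: nat
  assumes "0 < l" "0 < L"
  shows "(\<Sum>j<L. of_real (periodized l (of_nat j / of_nat L)) * unit_exp (- 1 * (of_nat n * of_nat j / of_nat L)))
     = of_real (poisson (l / L) (n / L))"
proof -
  define k where "k = l / L"
  have k: "0 < k" "l = k * L" using assms by (simp_all add: k_def)
  define q where "q = complex_of_real (exp k)"
  define w where "w = unit_exp (- (of_nat n / of_nat L))"
  define h where "h = complex_of_real (exp (l / 2))"
  have h0: "h \<noteq> 0" by (simp add: h_def)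
  have q0: "q \<noteq> 0" by (simp add: q_def)
  have hq: "q ^ L = h ^ 2"
  proof -
    have "exp k ^ L = exp (l / 2) ^ 2"
      using k by (simp add: exp_of_nat_mult[symmetric] mult_ac)
    then show ?thesis unfolding q_def h_def of_real_power[symmetric] by (rule arg_cong)
  qed
  have nw: "norm w = 1" by (simp add: w_def)
  then have w0: "w \<noteq> 0" by auto
  have wL: "w ^ L = 1"
    using unit_exp_of_nat_mult[of L "- (of_nat n / of_nat L)", symmetric] unit_exp_of_int[of "- int n"] assms(2)
    by (simp add: w_def)
  have wj: "unit_exp (- 1 * (of_nat n * of_nat j / of_nat L)) = w ^ j" for j
    using unit_exp_of_nat_mult[of j "- (of_nat n / of_nat L)"] by (simp add: w_def mult_ac)
  have "exp k > 1" using k by simp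
  then have nq: "norm q > 1" by (simp add: q_def)
  have ne: "q * w \<noteq> 1" "w / q \<noteq> 1"
  proof -
    show "q * w \<noteq> 1" using nq nw by (metis mult.right_neutral norm_mult norm_one less_irrefl)
    show "w / q \<noteq> 1" using nq nw q0 by (metis divide_eq_1_iff less_irrefl)
  qed
  define S where "S = complex_of_real (2 * sinh (l / 2))"
  have S0: "S \<noteq> 0" using assms(1) by (simp add: S_def)
  have Sh: "S = h - 1 / h" by (simp add: S_def h_def sinh_field_def exp_minus field_simps)
  have r: "of_real (periodized l (of_nat j / of_nat L)) = (q ^ j * (1 / h) + h / q ^ j) / S" for j
  proof -
    have a: "l * (real j / real L - 1 / 2) = real j * k - l / 2" using k assms(2) by (simp add: field_simps)
    have "2 * cosh (l * (real j / real L - 1 / 2)) = exp (real j * k) / exp (l / 2) + exp (l / 2) / exp (real j * k)"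
    proof -
      have "exp (- (real j * k - l / 2)) = exp (l / 2) / exp (real j * k)"
        unfolding minus_diff_eq by (rule exp_diff)
      then show ?thesis unfolding a cosh_field_def exp_diff by (simp add: mult.commute)
    qed
    then have "periodized l (of_nat j / of_nat L) = (exp (real j * k) / exp (l / 2) + exp (l / 2) / exp (real j * k)) / (2 * sinh (l / 2))"
      unfolding periodized_def by (metis mult_divide_mult_cancel_left_if zero_neq_numeral)
    then show ?thesis by (simp add: q_def h_def S_def exp_of_nat_mult)
  qed
  have "(\<Sum>j<L. of_real (periodized l (of_nat j / of_nat L)) * unit_exp (- 1 * (of_nat n * of_nat j / of_nat L)))
     = (\<Sum>j<L. (q ^ j * (1 / h) + h / q ^ j) * w ^ j) / S"
    by (simp only: r wj sum_divide_distrib times_divide_eq_left)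
  also have "\<dots> = (1 / h * (q ^ L - 1) / (q * w - 1) + h * (1 / q ^ L - 1) / (w / q - 1)) / S"
    by (subst sum_geometric_cosh[OF q0 w0 wL ne]) (rule refl)
  also have "1 / h * (q ^ L - 1) = S" using h0 by (simp add: hq Sh power2_eq_square field_simps)
  also have "h * (1 / q ^ L - 1) = - S" using h0 by (simp add: hq Sh power2_eq_square field_simps)
  also have "(S / (q * w - 1) + - S / (w / q - 1)) / S = 1 / (q * w - 1) + 1 / (1 - w / q)"
  proof -
    have "(S / u + - S / v) / S = 1 / u + 1 / (- v)" for u v
      using S0 by (simp add: add_divide_distrib diff_divide_distrib)
    from this[of "q * w - 1" "w / q - 1"] show ?thesis by simp
  qed
  also have "\<dots> = ((q - 1 / q) / 2) / ((q + 1 / q) / 2 - (w + 1 / w) / 2)"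
  proof -
    have e: "(q * w - 1) * (1 - w / q) = w * (q + 1 / q - (w + 1 / w))"
      using q0 w0 by (simp add: field_simps)
    have ne': "q * w - 1 \<noteq> 0" "1 - w / q \<noteq> 0" using ne by simp_all
    then have p: "q + 1 / q - (w + 1 / w) \<noteq> 0" using e by (metis mult_eq_0_iff)
    have "1 / (q * w - 1) + 1 / (1 - w / q) = ((1 - w / q) + (q * w - 1)) / ((q * w - 1) * (1 - w / q))"
    proof -
      have "1 / x + 1 / y = (y + x) / (x * y)" if "x \<noteq> 0" "y \<noteq> 0" for x y :: complex
        using that by (simp add: field_simps)
      from this[OF ne'] show ?thesis .
    qed
    also have "\<dots> = (w * (q - 1 / q)) / (w * (q + 1 / q - (w + 1 / w)))"
      unfolding e by (simp add: algebra_simps)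
    also have "\<dots> = (q - 1 / q) / (q + 1 / q - (w + 1 / w))" using w0 by simp
    also have "\<dots> = ((q - 1 / q) / 2) / ((q + 1 / q) / 2 - (w + 1 / w) / 2)"
    proof -
      have "x / (y - z) = (x / 2) / (y / 2 - z / 2)" for x y z :: complex
        by (simp add: diff_divide_distrib[symmetric])
      then show ?thesis .
    qed
    finally show ?thesis .
  qed
  also have "(q - 1 / q) / 2 = of_real (sinh k)"
    by (simp add: q_def sinh_field_def exp_minus inverse_eq_divide)
  also have "(q + 1 / q) / 2 = of_real (cosh k)"
    by (simp add: q_def cosh_field_def exp_minus inverse_eq_divide)
  also have "(w + 1 / w) / 2 = of_real (cos (2 * pi * (n / L)))"
  proof -
    have "1 / w = cnj w" using nw w0 complex_norm_square[of w] by (simp add: field_simps)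
    then show ?thesis by (simp add: w_def unit_exp_cis complex_eq_iff)
  qed
  finally show ?thesis by (simp add: poisson_def k_def)
qed

text \<open>The index j = L, where x = 1 repeats x = 0, is included because the derivative at the
  last inner node refers to its right neighbour.\<close>

lemma poisson_inverse_transform:
  fixes L j :: nat
  assumes "0 < l" "j \<le> L" "0 < L"
  shows "(\<Sum>n<L. of_real (poisson (l / L) (n / L)) * unit_exp (of_nat n * (of_nat j / of_nat L)))
     = of_nat L * of_real (periodized l (of_nat j / of_nat L))"
proof -
  have *: "(\<Sum>n<L. of_real (poisson (l / L) (n / L)) * unit_exp (of_nat n * (of_nat j / of_nat L)))
     = of_nat L * of_real (periodized l (of_nat j / of_nat L))" if "j < L" for j
    using discrete_fourier_inversion[OF that, of "-1" "\<lambda>j. of_real (periodized l (of_nat j / of_nat L))"]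
    unfolding mult.commute[of "of_nat _ :: real" "of_nat _ :: real"]
    using poisson_transform[OF assms(1,3)] by (simp add: mult_ac)
  show ?thesis
  proof (cases "j = L")
    case True
    have "periodized l 1 = periodized l 0" using cosh_minus[of "l / 2"] by (simp add: periodized_def)
    then show ?thesis using *[of 0] assms(3) True by simp
  next
    case False
    then show ?thesis using * assms by simp
  qed
qed

section \<open>The interpolating trigonometric polynomial at the grid points\<close>

definition interp_coeff :: "nat \<Rightarrow> real \<Rightarrow> int \<Rightarrow> real" where
  "interp_coeff N l n = phi (l / (real N + 1)) (of_int n / (real N + 1)) / (real N + 1)"

definition interp :: "nat \<Rightarrow> real \<Rightarrow> real \<Rightarrow> real" where
  "interp N l x = (\<Sum>n\<in>{- int N..int N}. interp_coeff N l n * cos (2 * pi * (of_int n * x)))"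

definition interp_deriv :: "nat \<Rightarrow> real \<Rightarrow> real \<Rightarrow> real" where
  "interp_deriv N l x =
     (\<Sum>n\<in>{- int N..int N}. interp_coeff N l n * (- (2 * pi * of_int n) * sin (2 * pi * (of_int n * x))))"

lemma interp_coeff_uminus [simp]: "interp_coeff N l (- n) = interp_coeff N l n"
  by (simp add: interp_coeff_def phi_def)

lemma has_real_derivative_interp: "(interp N l has_real_derivative interp_deriv N l x) (at x)"
  unfolding interp_def interp_deriv_def
proof (rule DERIV_sum)
  fix n
  have "((\<lambda>x. cos (2 * pi * (of_int n * x))) has_real_derivative - (2 * pi * of_int n) * sin (2 * pi * (of_int n * x))) (at x)"
    by (auto intro!: derivative_eq_intros)
  then show "((\<lambda>x. interp_coeff N l n * cos (2 * pi * (of_int n * x))) has_real_derivative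
      interp_coeff N l n * (- (2 * pi * of_int n) * sin (2 * pi * (of_int n * x)))) (at x)"
    by (rule DERIV_cmult)
qed

lemma sum_odd_symmetric:
  fixes f :: "int \<Rightarrow> real"
  assumes "\<And>n. f (- n) = - f n"
  shows "(\<Sum>n\<in>{- int N..int N}. f n) = 0"
proof -
  have "(\<Sum>n\<in>{- int N..int N}. f n) = (\<Sum>n\<in>{- int N..int N}. f (- n))"
    by (rule sum.reindex_bij_witness[of _ uminus uminus]) auto
  also have "\<dots> = - (\<Sum>n\<in>{- int N..int N}. f n)" by (simp add: assms sum_negf)
  finally show ?thesis by simp
qed

lemma of_real_interp:
  "complex_of_real (interp N l x) = (\<Sum>n\<in>{- int N..int N}. of_real (interp_coeff N l n) * unit_exp (of_int n * x))"
proof (rule complex_eqI)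
  show "Im (complex_of_real (interp N l x)) =
      Im (\<Sum>n\<in>{- int N..int N}. of_real (interp_coeff N l n) * unit_exp (of_int n * x))"
    using sum_odd_symmetric[of "\<lambda>n. interp_coeff N l n * sin (2 * pi * (of_int n * x))" N]
    by (simp add: unit_exp_cis)
qed (simp add: interp_def unit_exp_cis)

lemma of_real_interp_deriv:
  "complex_of_real (interp_deriv N l x) =
     2 * pi * \<i> * (\<Sum>n\<in>{- int N..int N}. (of_int n * of_real (interp_coeff N l n)) * unit_exp (of_int n * x))"
proof (rule complex_eqI)
  show "Im (complex_of_real (interp_deriv N l x)) =
      Im (2 * pi * \<i> * (\<Sum>n\<in>{- int N..int N}. (of_int n * of_real (interp_coeff N l n)) * unit_exp (of_int n * x)))"
    using sum_odd_symmetric[of "\<lambda>n. (of_int n * interp_coeff N l n) * cos (2 * pi * (of_int n * x))" N]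
    by (simp add: unit_exp_cis)
  show "Re (complex_of_real (interp_deriv N l x)) =
      Re (2 * pi * \<i> * (\<Sum>n\<in>{- int N..int N}. (of_int n * of_real (interp_coeff N l n)) * unit_exp (of_int n * x)))"
    by (simp add: unit_exp_cis interp_deriv_def sum_distrib_left sum_negf mult_ac)
qed

text \<open>By the first relation of \<open>phi_fold\<close> the folded coefficients are values of
  the Poisson kernel divided by N+1, and these form the discrete transform of the samples of
  \<open>periodized\<close>.\<close>

lemma interp_node:
  assumes "0 < l" "j \<le> Suc N"
  shows "interp N l (of_nat j / (real N + 1)) = periodized l (of_nat j / (real N + 1))"
proof -
  let ?L = "real N + 1"
  have L: "?L = real (Suc N)" by simp
  have k: "0 < l / ?L" using assms(1) by simp
  have co: "of_real (interp_coeff N l (int n)) + (if n = 0 then 0 else of_real (interp_coeff N l (int n - int (Suc N))))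
     = complex_of_real (poisson (l / ?L) (n / ?L)) / of_nat (Suc N)" if "n < Suc N" for n
  proof (cases "n = 0")
    case True
    then show ?thesis by (simp add: interp_coeff_def phi_0)
  next
    case False
    have t: "of_int (int n - int (Suc N)) / ?L = n / ?L - 1" by (simp add: field_simps)
    have "interp_coeff N l (int n) + interp_coeff N l (int n - int (Suc N)) = poisson (l / ?L) (n / ?L) / ?L"
      unfolding interp_coeff_def t add_divide_distrib[symmetric]
      using phi_fold(1)[OF k, of "n / ?L"] False that by (simp add: field_simps del: of_nat_Suc)
    then have "complex_of_real (interp_coeff N l (int n) + interp_coeff N l (int n - int (Suc N)))
        = complex_of_real (poisson (l / ?L) (n / ?L) / ?L)" by (rule arg_cong)
    then show ?thesis using False by simp
  qed
  have "complex_of_real (interp N l (of_nat j / ?L)) =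
     (\<Sum>n<Suc N. (of_real (interp_coeff N l (int n)) + (if n = 0 then 0 else of_real (interp_coeff N l (int n - int (Suc N)))))
         * unit_exp (of_nat n * (of_int (int j) / ?L)))"
    unfolding of_real_interp using sum_symmetric_fold[of "\<lambda>n. of_real (interp_coeff N l n)" "int j" N]
    by (simp only: of_int_of_nat_eq)
  also have "\<dots> = (\<Sum>n<Suc N. complex_of_real (poisson (l / ?L) (n / ?L)) * unit_exp (of_nat n * (of_nat j / ?L))) / of_nat (Suc N)"
    unfolding sum_divide_distrib
    by (intro sum.cong refl) (simp only: co lessThan_iff of_int_of_nat_eq times_divide_eq_left)
  also have "\<dots> = of_real (periodized l (of_nat j / ?L))"
    unfolding L poisson_inverse_transform[OF assms zero_less_Suc] by (simp del: of_nat_Suc)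
  finally show ?thesis by (simp only: of_real_eq_iff)
qed

text \<open>By the second relation of \<open>phi_fold\<close> the folded coefficients of the
  derivative are Poisson kernel times sine. The sine is a difference of two exponentials, which
  shift the grid point to its neighbours j+1 and j-1; the derivative is thus a multiple of a central
  difference of \<open>periodized\<close>. The addition theorem turns this into the true derivative,
  because the factor sinh k cancels.\<close>

lemma interp_deriv_node:
  assumes "0 < l" "0 < j" "j < Suc N"
  shows "interp_deriv N l (of_nat j / (real N + 1))
     = l * sinh (l * (of_nat j / (real N + 1) - 1 / 2)) / sinh (l / 2)"
proof -
  let ?L = "real N + 1"
  define k where "k = l / ?L"
  have L: "?L = real (Suc N)" by simp
  have k: "0 < k" using assms(1) by (simp add: k_def)
  \<comment> \<open>Chosen so that 2 K sinh k = k / (2 pi), the constant in front of the sine in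
    \<open>phi_fold\<close>.\<close>
  define K where "K = k / (4 * pi * sinh k)"
  have skn: "sinh k \<noteq> 0" using k by simp
  have co: "of_int (int n) * of_real (interp_coeff N l (int n))
       + (if n = 0 then 0 else of_int (int n - int (Suc N)) * of_real (interp_coeff N l (int n - int (Suc N))))
     = complex_of_real (2 * K * poisson k (n / ?L) * sin (2 * pi * (n / ?L)))" if "n < Suc N" for n
  proof (cases "n = 0")
    case True
    then show ?thesis by simp
  next
    case False
    define t where "t = n / ?L"
    have t: "of_int (int n - int (Suc N)) / ?L = t - 1" "of_int (int n - int (Suc N)) = ?L * (t - 1)"
      "of_int (int n) = ?L * t" "of_int (int n) / ?L = t"
      by (simp_all add: field_simps t_def)
    have t01: "0 < t" "t < 1" using False that by (simp_all add: t_def)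
    have "of_int (int n) * interp_coeff N l (int n) + of_int (int n - int (Suc N)) * interp_coeff N l (int n - int (Suc N))
        = t * phi k t + (t - 1) * phi k (t - 1)"
      unfolding interp_coeff_def t k_def[symmetric] by simp
    also have "\<dots> = 2 * K * poisson k t * sin (2 * pi * t)"
      unfolding phi_fold(2)[OF k t01] K_def poisson_def using skn by (simp add: mult_ac)
    finally have "complex_of_real (of_int (int n) * interp_coeff N l (int n) + of_int (int n - int (Suc N)) * interp_coeff N l (int n - int (Suc N)))
        = complex_of_real (2 * K * poisson k t * sin (2 * pi * t))" by (rule arg_cong)
    then show ?thesis using False
      by (simp only: t_def of_real_add of_real_mult of_real_of_int_eq if_False)
  qed
  have sn: "complex_of_real (2 * K * P * sin (2 * pi * (n / ?L))) * unit_exp (of_nat n * (of_int (int j) / ?L))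
     = of_real K / \<i> * (of_real P * unit_exp (of_nat n * (of_nat (j + 1) / ?L)) - of_real P * unit_exp (of_nat n * (of_nat (j - 1) / ?L)))"
    for n :: nat and P :: real
  proof -
    have a: "of_nat n * (of_nat (j + 1) / ?L) = of_nat n * (of_nat j / ?L) + n / ?L"
      "of_nat n * (of_nat (j - 1) / ?L) = of_nat n * (of_nat j / ?L) + - (n / ?L)"
      using assms(2) by (simp_all add: of_nat_diff add_divide_distrib diff_divide_distrib algebra_simps)
    have "unit_exp (n / ?L) - unit_exp (- (n / ?L)) = 2 * \<i> * of_real (sin (2 * pi * (n / ?L)))"
      by (simp add: unit_exp_cis complex_eq_iff)
    then have s: "of_real (sin (2 * pi * (n / ?L))) = (unit_exp (n / ?L) - unit_exp (- (n / ?L))) / (2 * \<i>)"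
      by (simp add: field_simps)
    show ?thesis unfolding a unit_exp_add of_real_mult s by (simp add: field_simps)
  qed
  have "complex_of_real (interp_deriv N l (of_nat j / ?L)) = 2 * pi * \<i> *
     (\<Sum>n<Suc N. (of_int (int n) * of_real (interp_coeff N l (int n))
       + (if n = 0 then 0 else of_int (int n - int (Suc N)) * of_real (interp_coeff N l (int n - int (Suc N)))))
         * unit_exp (of_nat n * (of_int (int j) / ?L)))"
    unfolding of_real_interp_deriv
    using sum_symmetric_fold[of "\<lambda>n. of_int n * of_real (interp_coeff N l n)" "int j" N]
    by (simp only: of_int_of_nat_eq)
  also have "(\<Sum>n<Suc N. (of_int (int n) * of_real (interp_coeff N l (int n))
       + (if n = 0 then 0 else of_int (int n - int (Suc N)) * of_real (interp_coeff N l (int n - int (Suc N)))))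
         * unit_exp (of_nat n * (of_int (int j) / ?L))) =
       (\<Sum>n<Suc N. complex_of_real (2 * K * poisson k (n / ?L) * sin (2 * pi * (n / ?L)))
         * unit_exp (of_nat n * (of_int (int j) / ?L)))"
    by (intro sum.cong refl) (simp only: co lessThan_iff)
  also have "\<dots> = of_real K / \<i> *
     ((\<Sum>n<Suc N. of_real (poisson k (n / ?L)) * unit_exp (of_nat n * (of_nat (j + 1) / ?L)))
      - (\<Sum>n<Suc N. of_real (poisson k (n / ?L)) * unit_exp (of_nat n * (of_nat (j - 1) / ?L))))"
    unfolding sn sum_subtractf[symmetric] sum_distrib_left ..
  also have "\<dots> = of_real K / \<i> * (?L * of_real (periodized l (of_nat (j + 1) / ?L)) - ?L * of_real (periodized l (of_nat (j - 1) / ?L)))"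
    unfolding L k_def using assms
    by (subst (1 2) poisson_inverse_transform[OF assms(1) _ zero_less_Suc]) simp_all
  also have "2 * pi * \<i> * \<dots> = of_real (2 * pi * K * ?L * (periodized l (of_nat (j + 1) / ?L) - periodized l (of_nat (j - 1) / ?L)))"
    by (simp add: algebra_simps)
  finally have "interp_deriv N l (of_nat j / ?L) = 2 * pi * K * ?L * (periodized l (of_nat (j + 1) / ?L) - periodized l (of_nat (j - 1) / ?L))"
    by (simp only: of_real_eq_iff)
  also have "periodized l (of_nat (j + 1) / ?L) - periodized l (of_nat (j - 1) / ?L)
     = 2 * sinh (l * (of_nat j / ?L - 1 / 2)) * sinh k / sinh (l / 2)"
  proof -
    have a: "l * (of_nat (j + 1) / ?L - 1 / 2) = l * (of_nat j / ?L - 1 / 2) + k"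
      "l * (of_nat (j - 1) / ?L - 1 / 2) = l * (of_nat j / ?L - 1 / 2) - k"
    proof -
      have r: "of_nat (j + 1) / ?L = of_nat j / ?L + 1 / ?L" by (simp add: add_divide_distrib)
      have "real (j - 1) = real j - 1" using assms(2) by simp
      then have r': "of_nat (j - 1) / ?L = of_nat j / ?L - 1 / ?L" by (simp only: diff_divide_distrib)
      have kd: "k = l * (1 / ?L)" by (simp add: k_def)
      have "l * (y + d - 1 / 2) = l * (y - 1 / 2) + l * d" "l * (y - d - 1 / 2) = l * (y - 1 / 2) - l * d" for y d
        by algebra+
      then show "l * (of_nat (j + 1) / ?L - 1 / 2) = l * (of_nat j / ?L - 1 / 2) + k"
        "l * (of_nat (j - 1) / ?L - 1 / 2) = l * (of_nat j / ?L - 1 / 2) - k"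
        unfolding r r' kd by blast+
    qed
    show ?thesis unfolding periodized_def a diff_divide_distrib[symmetric] cosh_add cosh_diff by simp
  qed
  also have "2 * pi * K * ?L * \<dots> = l * sinh (l * (of_nat j / ?L - 1 / 2)) / sinh (l / 2)"
    using skn by (simp add: K_def k_def)
  finally show ?thesis .
qed

lemma cos_three_term:
  fixes x :: real
  shows "cos (of_nat (Suc (Suc m)) * x) + cos (of_nat m * x) = 2 * cos x * cos (of_nat (Suc m) * x)"
proof -
  have e: "of_nat (Suc (Suc m)) * x = of_nat (Suc m) * x + x" "of_nat m * x = of_nat (Suc m) * x - x"
    by (simp_all add: distrib_right)
  show ?thesis unfolding e cos_add cos_diff by simp
qed

text \<open>These are the Chebyshev polynomials taken at cos (2 pi x) = 2 v - 1, built by their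
  three-term recurrence.\<close>

lemma cos_multiple_poly:
  "\<exists>P :: real poly. degree P \<le> n \<and> (\<forall>x. cos (of_nat n * (2 * pi * x)) = poly P ((cos (pi * x))\<^sup>2))"
proof (induction n rule: less_induct)
  case (less n)
  have c2: "cos (2 * pi * x) = 2 * (cos (pi * x))\<^sup>2 - 1" for x
    using cos_double_cos[of "pi * x"] by (simp add: mult_ac)
  consider "n = 0" | "n = 1" | m where "n = Suc (Suc m)"
    by (cases n; cases "n - 1") auto
  then show ?case
  proof cases
    case 1
    then show ?thesis by (intro exI[of _ 1]) simp
  next
    case 2
    then show ?thesis by (intro exI[of _ "[:-1, 2:]"]) (simp add: c2)
  next
    case 3
    have lt: "Suc m < n" "m < n" using 3 by simp_all
    from less.IH[OF lt(1)]
    obtain P :: "real poly" where P: "degree P \<le> Suc m \<and> (\<forall>x. cos (of_nat (Suc m) * (2 * pi * x)) = poly P ((cos (pi * x))\<^sup>2))" ..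
    from less.IH[OF lt(2)]
    obtain Q :: "real poly" where Q: "degree Q \<le> m \<and> (\<forall>x. cos (of_nat m * (2 * pi * x)) = poly Q ((cos (pi * x))\<^sup>2))" ..
    have PQ: "cos (of_nat (Suc m) * (2 * pi * x)) = poly P ((cos (pi * x))\<^sup>2)"
      "cos (of_nat m * (2 * pi * x)) = poly Q ((cos (pi * x))\<^sup>2)" for x
      using P Q by blast+
    define R where "R = smult 2 ([:-1, 2:] * P) - Q"
    have R: "poly R v = 2 * (2 * v - 1) * poly P v - poly Q v" for v
      unfolding R_def by (simp add: algebra_simps)
    have "degree ([:-1, 2:] * P) \<le> degree [:-1, 2 :: real:] + degree P" by (rule degree_mult_le)
    then have "degree ([:-1, 2:] * P) \<le> n" using P 3 by simp
    then have "degree (smult 2 ([:-1, 2:] * P)) \<le> n" by (rule order_trans[OF degree_smult_le])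
    moreover have "degree Q \<le> n" using Q 3 by simp
    ultimately have degR: "degree R \<le> n" unfolding R_def by (rule degree_diff_le)
    have "cos (of_nat n * (2 * pi * x)) = poly R ((cos (pi * x))\<^sup>2)" for x
      using cos_three_term[of m "2 * pi * x"] unfolding 3[symmetric] PQ[of x] c2[of x] R by linarith
    with degR show ?thesis by (intro exI[of _ R] conjI allI)
  qed
qed

lemma interp_poly:
  "\<exists>P :: real poly. degree P \<le> N \<and> (\<forall>x. interp N l x = poly P ((cos (pi * x))\<^sup>2))"
proof -
  have "\<forall>n. \<exists>P :: real poly. degree P \<le> n \<and> (\<forall>x. cos (of_nat n * (2 * pi * x)) = poly P ((cos (pi * x))\<^sup>2))"
    by (rule allI, rule cos_multiple_poly)
  from choice[OF this] obtain P :: "nat \<Rightarrow> real poly" where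
    P': "\<forall>n. degree (P n) \<le> n \<and> (\<forall>x. cos (of_nat n * (2 * pi * x)) = poly (P n) ((cos (pi * x))\<^sup>2))" ..
  have P: "degree (P n) \<le> n" "cos (of_nat n * (2 * pi * x)) = poly (P n) ((cos (pi * x))\<^sup>2)" for n x
    using P' by blast+
  have c: "cos (2 * pi * (of_int n * x)) = poly (P (nat \<bar>n\<bar>)) ((cos (pi * x))\<^sup>2)" for n :: int and x
  proof -
    have "cos (2 * pi * (of_int n * x)) = cos (of_nat (nat \<bar>n\<bar>) * (2 * pi * x))"
    proof (cases "n \<ge> 0")
      case True
      then have "of_nat (nat \<bar>n\<bar>) * (2 * pi * x) = 2 * pi * (of_int n * x)" by simp
      then show ?thesis by (simp only:)
    next
      case False
      then have "of_nat (nat \<bar>n\<bar>) * (2 * pi * x) = - (2 * pi * (of_int n * x))" by simp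
      then show ?thesis by (simp only: cos_minus)
    qed
    then show ?thesis by (simp only: P(2))
  qed
  define Q where "Q = (\<Sum>n\<in>{- int N..int N}. smult (interp_coeff N l n) (P (nat \<bar>n\<bar>)))"
  have "degree Q \<le> N"
    unfolding Q_def
  proof (rule degree_sum_le[OF finite_atLeastAtMost_int])
    fix m assume "m \<in> {- int N..int N}"
    then have "\<bar>m\<bar> \<le> int N" by (simp only: atLeastAtMost_iff abs_le_iff minus_le_iff simp_thms)
    then have m: "nat \<bar>m\<bar> \<le> N" by (simp only: nat_le_iff)
    show "degree (smult (interp_coeff N l m) (P (nat \<bar>m\<bar>))) \<le> N"
      by (rule order_trans[OF degree_smult_le order_trans[OF P(1) m]])
  qed
  moreover have "interp N l x = poly Q ((cos (pi * x))\<^sup>2)" for x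
    unfolding interp_def c Q_def poly_sum poly_smult ..
  ultimately show ?thesis by (intro exI[of _ Q] conjI allI)
qed

section \<open>The periodic majorant of the exponential\<close>

lemma has_real_derivative_periodized:
  "(periodized l has_real_derivative l * sinh (l * (x - 1 / 2)) / sinh (l / 2)) (at x)"
  unfolding periodized_def divide_inverse
  by (auto intro!: derivative_eq_intros)

lemma periodized_abs_monotone:
  assumes "0 < l"
  shows "\<exists>A. abs_monotone A \<and> (\<forall>x\<in>{0<..<1}. periodized l x = A ((cos (pi * x))\<^sup>2))"
proof -
  from cosh_abs_monotone[of l]
  obtain A where A: "abs_monotone A \<and> (\<forall>x\<in>{0<..<1}. cosh (l * (x - 1 / 2)) = A ((cos (pi * x))\<^sup>2))" ..
  have "0 \<le> 1 / sinh (l / 2)" using assms by simp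
  with A have "abs_monotone (\<lambda>v. 1 / sinh (l / 2) * A v)" by (intro abs_monotone_cmult) simp_all
  moreover have "\<forall>x\<in>{0<..<1}. periodized l x = 1 / sinh (l / 2) * A ((cos (pi * x))\<^sup>2)"
    using A by (simp add: periodized_def)
  ultimately show ?thesis by (intro exI[of _ "\<lambda>v. 1 / sinh (l / 2) * A v"] conjI)
qed

lemma cos_pi_times_pos: "0 \<le> x \<Longrightarrow> x < 1 / 2 \<Longrightarrow> 0 < cos (pi * x)"
proof (rule cos_gt_zero_pi)
  assume x: "0 \<le> x" "x < 1 / 2"
  have "0 \<le> pi * x" using x by simp
  then show "- (pi / 2) < pi * x" using pi_gt_zero by linarith
  have "pi * x < pi * (1 / 2)" using x by (intro mult_strict_left_mono) simp_all
  then show "pi * x < pi / 2" by simp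
qed

lemma sin_pi_times_pos: "0 < x \<Longrightarrow> x < 1 \<Longrightarrow> 0 < sin (pi * x)"
proof (rule sin_gt_zero)
  assume x: "0 < x" "x < 1"
  show "0 < pi * x" using x by simp
  have "pi * x < pi * 1" using x by (intro mult_strict_left_mono) simp_all
  then show "pi * x < pi" by simp
qed

lemma cos_pi_times_squared_less_1:
  assumes "0 < x" "x < 1" shows "(cos (pi * x))\<^sup>2 < 1"
proof -
  have "(sin (pi * x))\<^sup>2 > 0" using sin_pi_times_pos[OF assms] by (intro zero_less_power)
  then show ?thesis using sin_cos_squared_add[of "pi * x"] by linarith
qed

lemma continuous_periodized: "continuous_on S (periodized l)"
  by (intro DERIV_continuous_on[OF DERIV_subset[OF has_real_derivative_periodized]]) simp

lemma continuous_interp: "continuous_on S (interp N l)"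
  by (intro DERIV_continuous_on[OF DERIV_subset[OF has_real_derivative_interp]]) simp

text \<open>The points j and N+1-j coincide in v. So the grid gives N div 2 double nodes in (0, 1),
  the simple node v = 1 from j = 0 and, for odd N, the simple node v = 0 from x = 1/2. These are N+1
  conditions, which is the right number for degree N in v.\<close>

lemma periodized_le_interp:
  assumes l: "0 < l" and x: "0 \<le> x" "x \<le> 1"
  shows "periodized l x \<le> interp N l x"
proof (cases "x = 0 \<or> x = 1")
  case True
  then show ?thesis
  proof
    assume "x = 0" then show ?thesis using interp_node[OF l, of 0 N] by simp
  next
    assume "x = 1"
    moreover have "of_nat (Suc N) / (real N + 1) = 1" by (simp add: field_simps)
    ultimately show ?thesis using interp_node[OF l, of "Suc N" N] by (simp only: order_refl)
  qed
next
  case False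
  then have x01: "0 < x" "x < 1" using x by simp_all
  let ?L = "real N + 1"
  define c where "c x = (cos (pi * x))\<^sup>2" for x
  from periodized_abs_monotone[OF l]
  obtain A where A': "abs_monotone A \<and> (\<forall>x\<in>{0<..<1}. periodized l x = A ((cos (pi * x))\<^sup>2))" ..
  then have A: "abs_monotone A" by (rule conjunct1)
  have perA: "periodized l x = A (c x)" if "0 < x" "x < 1" for x
    using bspec[OF conjunct2[OF A'], of x] that unfolding c_def by simp
  from interp_poly[of N l]
  obtain P where P': "degree P \<le> N \<and> (\<forall>x. interp N l x = poly P ((cos (pi * x))\<^sup>2))" ..
  then have intP: "interp N l x = poly P (c x)" for x unfolding c_def by (elim conjE allE)
  define J where "J = (\<lambda>j. c (real j / ?L)) ` {1..N div 2}"
  have jr: "0 < real j / ?L" "real j / ?L < 1 / 2" "j < Suc N" if "j \<in> {1..N div 2}" for j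
  proof -
    have "1 \<le> j" "2 * j \<le> N" using that by auto
    then show "j < Suc N" "0 < real j / ?L" by simp_all
    have "2 * real j \<le> real N" using \<open>2 * j \<le> N\<close> by linarith
    then show "real j / ?L < 1 / 2" by (simp add: field_simps)
  qed
  have inj: "inj_on (\<lambda>j. c (real j / ?L)) {1..N div 2}"
  proof (rule inj_onI)
    fix i j assume i: "i \<in> {1..N div 2}" and j: "j \<in> {1..N div 2}" and eq: "c (real i / ?L) = c (real j / ?L)"
    note ri = jr[OF i] and rj = jr[OF j]
    have cos_eq: "cos (pi * (real i / ?L)) = cos (pi * (real j / ?L))"
    proof (rule power_eq_imp_eq_base[where n = 2])
      show "(cos (pi * (real i / ?L)))\<^sup>2 = (cos (pi * (real j / ?L)))\<^sup>2" using eq unfolding c_def .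
      show "0 \<le> cos (pi * (real i / ?L))" "0 \<le> cos (pi * (real j / ?L))"
        by (rule less_imp_le[OF cos_pi_times_pos[OF less_imp_le[OF ri(1)] ri(2)]],
            rule less_imp_le[OF cos_pi_times_pos[OF less_imp_le[OF rj(1)] rj(2)]])
    qed (rule zero_less_numeral)
    have pi_mult: "0 \<le> pi * y" "pi * y \<le> pi" if "0 < y" "y < 1 / 2" for y
    proof -
      have "pi * y \<le> pi * 1" using that by (intro mult_left_mono) simp_all
      then show "0 \<le> pi * y" "pi * y \<le> pi" using that by simp_all
    qed
    have "pi * (real i / ?L) = pi * (real j / ?L)"
      by (rule cos_inj_pi[OF pi_mult[OF ri(1,2)] pi_mult[OF rj(1,2)] cos_eq])
    then have "real i / ?L = real j / ?L" using pi_neq_zero by (simp only: mult_cancel_left simp_thms)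
    then show "i = j" by simp
  qed
  have cardJ: "card J = N div 2" unfolding J_def card_image[OF inj] by simp
  have Jsub: "J \<subseteq> {0<..<1}"
  proof
    fix v assume "v \<in> J"
    then obtain j where j: "j \<in> {1..N div 2}" "v = c (real j / ?L)" unfolding J_def by blast
    note r = jr[OF j(1)]
    have "real j / ?L < 1" using r(2) by linarith
    then have "c (real j / ?L) < 1" unfolding c_def by (rule cos_pi_times_squared_less_1[OF r(1)])
    moreover have "0 < c (real j / ?L)"
      unfolding c_def by (rule zero_less_power[OF cos_pi_times_pos[OF less_imp_le[OF r(1)] r(2)]])
    ultimately show "v \<in> {0<..<1}" unfolding j(2) greaterThanLessThan_iff by (rule conjI[rotated])
  qed
  have nodes: "A v = poly P v \<and> ((\<lambda>v. A v - poly P v) has_real_derivative 0) (at v)" if vJ: "v \<in> J" for v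
  proof -
    obtain j where j: "j \<in> {1..N div 2}" "v = c (real j / ?L)" using vJ unfolding J_def by blast
    note r = jr[OF j(1)]
    define y where "y = real j / ?L"
    have y: "0 < y" "y < 1 / 2" "v = c y" using r j(2) by (simp_all add: y_def)
    have v: "0 < v" "v < 1" using Jsub vJ by auto
    have "A v = poly P v"
      using interp_node[OF l, of j N] r(3) perA[of y] intP[of y] y unfolding y_def by simp
    \<comment> \<open>The contact of first order is known in the variable x. As the derivative of
      \<open>c\<close> does not vanish at y, the chain rule carries it over to v.\<close>
    moreover have "((\<lambda>v. A v - poly P v) has_real_derivative 0) (at v)"
    proof -
      from abs_monotone_differentiable[OF A v]
      obtain d where d: "(A has_real_derivative d) (at v)" ..
      define e where "e = d - poly (pderiv P) v"
      have D: "((\<lambda>v. A v - poly P v) has_real_derivative e) (at (c y))"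
        unfolding e_def y(3)[symmetric] by (intro DERIV_diff d poly_DERIV)
      have dc: "(c has_real_derivative 2 * (- sin (pi * y) * pi) * cos (pi * y)) (at y)"
        unfolding c_def by (auto intro!: derivative_eq_intros)
      have 1: "((\<lambda>x. A (c x) - poly P (c x)) has_real_derivative e * (2 * (- sin (pi * y) * pi) * cos (pi * y))) (at y)"
        by (rule DERIV_chain2[where f = "\<lambda>v. A v - poly P v" and g = c, OF D dc])
      have "((\<lambda>x. periodized l x - interp N l x) has_real_derivative
          l * sinh (l * (y - 1 / 2)) / sinh (l / 2) - interp_deriv N l y) (at y)"
        by (intro DERIV_diff has_real_derivative_periodized has_real_derivative_interp)
      moreover have "interp_deriv N l y = l * sinh (l * (y - 1 / 2)) / sinh (l / 2)"
        unfolding y_def by (rule interp_deriv_node[OF l]) (use r j(1) in auto)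
      ultimately have "((\<lambda>x. periodized l x - interp N l x) has_real_derivative 0) (at y)" by (simp only: diff_self)
      then have 2: "((\<lambda>x. A (c x) - poly P (c x)) has_real_derivative 0) (at y)"
        by (rule has_field_derivative_transform_within_open[of _ _ _ "{0<..<1}"])
           (use y in \<open>simp_all add: perA intP\<close>)
      have "e * (2 * (- sin (pi * y) * pi) * cos (pi * y)) = 0" by (rule DERIV_unique[OF 1 2])
      moreover have "sin (pi * y) \<noteq> 0" "cos (pi * y) \<noteq> 0"
        using sin_pi_times_pos[of y] cos_pi_times_pos[of y] y by simp_all
      ultimately have "e = 0" by simp
      then show ?thesis using D unfolding y(3) by simp
    qed
    ultimately show ?thesis ..
  qed
  have lim: "((\<lambda>v. A v - poly P v) \<longlongrightarrow> 0) (at_left 1)"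
  proof -
    \<comment> \<open>\<open>s\<close> inverts \<open>c\<close> on [0, 1/2], so v tending to 1 from
      the left means x tending to 0, where both functions are continuous and agree.\<close>
    define s where "s v = arccos (sqrt v) / pi" for v
    define g where "g v = periodized l (s v) - interp N l (s v)" for v
    have "continuous_on {0..1} s" unfolding s_def
      by (intro continuous_intros continuous_on_arccos' continuous_on_compose2[OF continuous_on_arccos'])
         (auto simp: real_sqrt_le_1_iff intro: order_trans[of _ 0])
    then have "continuous_on {0..1} g" unfolding g_def
      by (intro continuous_on_diff continuous_on_compose2[OF continuous_periodized[of UNIV]]
           continuous_on_compose2[OF continuous_interp[of UNIV]]) simp_all
    then have "(g \<longlongrightarrow> g 1) (at 1 within {0..1})" by (simp add: continuous_on)
    then have "(g \<longlongrightarrow> g 1) (at_left 1)" by (simp add: at_within_Icc_at_left)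
    moreover have "g 1 = 0" using interp_node[OF l, of 0 N] by (simp add: g_def s_def)
    moreover have "eventually (\<lambda>v. g v = A v - poly P v) (at_left 1)"
      using eventually_at_left_real[of 0 1, OF zero_less_one]
    proof eventually_elim
      case (elim v)
      have sv: "0 < sqrt v" "sqrt v < 1" using elim by simp_all
      then have sv1: "- 1 < sqrt v" by linarith
      have "0 < arccos (sqrt v)" using arccos_less_mono[of 1 "sqrt v"] sv by simp
      then have s0: "0 < s v" unfolding s_def by simp
      have "arccos (sqrt v) < pi" using arccos_less_mono[of "sqrt v" "-1"] sv sv1 by simp
      then have s1: "s v < 1" unfolding s_def by simp
      have "cos (arccos (sqrt v)) = sqrt v" using sv sv1 by (intro cos_arccos) linarith+
      then have "c (s v) = v" using elim by (simp add: c_def s_def)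
      then show ?case unfolding g_def perA[OF s0 s1] intP by simp
    qed
    ultimately show ?thesis using Lim_transform_eventually[of g "g 1"] by simp
  qed
  have zero: "A 0 = poly P 0" if "N mod 2 = 1"
  proof -
    define m where "m = N div 2"
    have m: "N = 2 * m + 1" using that unfolding m_def by presburger
    have half: "real (Suc m) / ?L = 1 / 2" unfolding m by (simp add: divide_eq_eq)
    have "Suc m \<le> Suc N" using m by linarith
    from interp_node[OF l this] have "interp N l (1 / 2) = periodized l (1 / 2)" by (simp only: half)
    moreover have "c (1 / 2) = 0" by (simp add: c_def)
    ultimately show ?thesis
      using perA[of "1 / 2"] intP[of "1 / 2"] by simp
  qed
  have "A (c x) \<le> poly P (c x)"
  proof (rule hermite_interpolant_majorizes[where A = A and J = J and P = P and n = "N mod 2" and v = "c x"])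
    show "abs_monotone A" by (rule A)
    show "finite J" unfolding J_def by simp
    show "J \<subseteq> {0<..<1}" by (rule Jsub)
    show "degree P \<le> 2 * card J + N mod 2" unfolding cardJ using conjunct1[OF P'] by simp
    show "N mod 2 \<le> 1" by simp
    show "A 0 = poly P 0" if "N mod 2 = 1" using that by (rule zero)
    show "\<forall>v\<in>J. A v = poly P v \<and> ((\<lambda>v. A v - poly P v) has_real_derivative 0) (at v)"
      by (intro ballI nodes)
    show "((\<lambda>v. A v - poly P v) \<longlongrightarrow> 0) (at_left 1)" by (rule lim)
    show "0 \<le> c x" by (simp add: c_def)
    show "c x < 1" unfolding c_def by (rule cos_pi_times_squared_less_1[OF x01])
  qed
  then show ?thesis by (simp only: perA[OF x01] intP)
qed

section \<open>The Fourier transform of M\<close>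

text \<open>\<open>phi\<close> freed from the absolute values: smooth in t for l > 0, also across t
  = 0. Its value 0 at t = 1 permits a continuous extension by zero.\<close>

definition psi :: "real \<Rightarrow> real \<Rightarrow> real" where
  "psi l t = ((1 - t) * sinh l + l / (2 * pi) * sin (2 * pi * t)) / (cosh l - cos (2 * pi * t))"

lemma phi_eq_psi: "phi l t = psi l \<bar>t\<bar>"
  by (cases "t \<ge> 0") (simp_all add: phi_def psi_def)

text \<open>Real and imaginary parts of w + w^2 + ... = w / (1 - w) with w = exp (-l) cis y.\<close>

lemma poisson_kernel_series:
  assumes "0 < l"
  shows "(\<lambda>k. exp (- l) ^ Suc k * cos (real (Suc k) * y)) sums ((sinh l / (cosh l - cos y) - 1) / 2)"
    and "(\<lambda>k. exp (- l) ^ Suc k * sin (real (Suc k) * y)) sums (sin y / (2 * (cosh l - cos y)))"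
proof -
  define r where "r = exp (- l)"
  have r: "0 < r" "r < 1" using assms by (simp_all add: r_def)
  define w where "w = of_real r * cis y"
  have nw: "norm w < 1" using r by (simp add: w_def norm_mult)
  have S: "(\<lambda>k. w ^ Suc k) sums (w / (1 - w))"
    using sums_mult[OF geometric_sums[OF nw], of w] by simp
  have wk: "w ^ Suc k = of_real (r ^ Suc k) * cis (real (Suc k) * y)" for k
    unfolding w_def power_mult_distrib Complex.DeMoivre by simp
  have D: "cosh l - cos y > 0" by (rule cosh_gt_cos[OF assms])
  have c2: "1 - 2 * r * cos y + r\<^sup>2 = 2 * r * (cosh l - cos y)"
    "1 - r\<^sup>2 = 2 * r * sinh l"
  proof -
    have "r * exp l = 1" by (simp add: r_def exp_minus)
    moreover have "2 * cosh l = exp l + r" "2 * sinh l = exp l - r"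
      by (simp_all add: cosh_field_def sinh_field_def r_def)
    ultimately have "2 * r * cosh l = 1 + r\<^sup>2" "2 * r * sinh l = 1 - r\<^sup>2" by algebra+
    then show "1 - 2 * r * cos y + r\<^sup>2 = 2 * r * (cosh l - cos y)" "1 - r\<^sup>2 = 2 * r * sinh l"
      by (simp_all add: algebra_simps)
  qed
  have q: "(1 - r * cos y)\<^sup>2 + (r * sin y)\<^sup>2 = 2 * r * (cosh l - cos y)"
    using sin_cos_squared_add[of y] unfolding c2(1)[symmetric] by algebra
  have Re: "Re (w / (1 - w)) = (r * cos y * (1 - r * cos y) - r * sin y * (r * sin y)) / (2 * r * (cosh l - cos y))"
    unfolding Re_divide q[symmetric] by (simp add: w_def)
  have Im: "Im (w / (1 - w)) = (r * sin y * (1 - r * cos y) + r * cos y * (r * sin y)) / (2 * r * (cosh l - cos y))"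
    unfolding Im_divide q[symmetric] by (simp add: w_def)
  have "(\<lambda>k. Re (w ^ Suc k)) sums Re (w / (1 - w))" by (rule sums_Re[OF S])
  moreover have "Re (w / (1 - w)) = (sinh l / (cosh l - cos y) - 1) / 2"
  proof -
    have n: "r * cos y * (1 - r * cos y) - r * sin y * (r * sin y) = r * (sinh l - (cosh l - cos y))"
      using sin_cos_squared_add[of y] c2 by algebra
    have "r * (a - b) / (2 * r * b) = (a / b - 1) / 2" if "b > 0" for a b
      using r that by (simp add: field_simps)
    from this[OF D] show ?thesis unfolding Re n .
  qed
  ultimately show "(\<lambda>k. exp (- l) ^ Suc k * cos (real (Suc k) * y)) sums ((sinh l / (cosh l - cos y) - 1) / 2)"
    unfolding wk r_def[symmetric] by simp
  have "(\<lambda>k. Im (w ^ Suc k)) sums Im (w / (1 - w))" by (rule sums_Im[OF S])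
  moreover have "Im (w / (1 - w)) = sin y / (2 * (cosh l - cos y))"
  proof -
    have n: "r * sin y * (1 - r * cos y) + r * cos y * (r * sin y) = r * sin y" by algebra
    show ?thesis unfolding Im n using r by simp
  qed
  ultimately show "(\<lambda>k. exp (- l) ^ Suc k * sin (real (Suc k) * y)) sums (sin y / (2 * (cosh l - cos y)))"
    unfolding wk r_def[symmetric] by simp
qed

text \<open>The part of \<open>psi\<close> of frequency k+1; frequency 0 contributes the tent 1 - t
  and is kept apart. The transform of this part produces the two terms of M with indices k+1 and
  -(k+1).\<close>

definition psi_term :: "real \<Rightarrow> nat \<Rightarrow> real \<Rightarrow> real" where
  "psi_term l k t = exp (- l) ^ Suc k *
     (2 * (1 - t) * cos (real (Suc k) * (2 * pi * t)) + l / pi * sin (real (Suc k) * (2 * pi * t)))"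

lemma psi_series:
  assumes "0 < l"
  shows "(\<lambda>k. psi_term l k t) sums (psi l t - (1 - t))"
proof -
  let ?y = "2 * pi * t"
  have D: "cosh l - cos ?y > 0" by (rule cosh_gt_cos[OF assms])
  have "(\<lambda>k. 2 * (1 - t) * (exp (- l) ^ Suc k * cos (real (Suc k) * ?y)) + l / pi * (exp (- l) ^ Suc k * sin (real (Suc k) * ?y)))
     sums (2 * (1 - t) * ((sinh l / (cosh l - cos ?y) - 1) / 2) + l / pi * (sin ?y / (2 * (cosh l - cos ?y))))"
    by (rule sums_add[OF sums_mult[OF poisson_kernel_series(1)[OF assms]] sums_mult[OF poisson_kernel_series(2)[OF assms]]])
  moreover have "2 * (1 - t) * ((sinh l / (cosh l - cos ?y) - 1) / 2) + l / pi * (sin ?y / (2 * (cosh l - cos ?y)))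
     = psi l t - (1 - t)"
  proof -
    have "2 * (1 - t) * ((S / d - 1) / 2) + l / pi * (s / (2 * d)) = ((1 - t) * S + l / (2 * pi) * s) / d - (1 - t)"
      if "d > 0" for S d s
      using that by (simp add: field_simps)
    from this[OF D] show ?thesis unfolding psi_def .
  qed
  moreover have "R * (2 * (1 - t) * c + d * s) = 2 * (1 - t) * (R * c) + d * (R * s)" for R c d s :: real
    by algebra
  ultimately show ?thesis unfolding psi_term_def by (simp only:)
qed

lemma psi_term_bound:
  assumes "0 < l" "0 \<le> t" "t \<le> 1"
  shows "\<bar>psi_term l k t\<bar> \<le> (2 + l / pi) * exp (- l) ^ Suc k"
proof -
  have "\<bar>2 * (1 - t) * cos y + l / pi * sin y\<bar> \<le> 2 + l / pi" for y
  proof -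
    have "\<bar>2 * (1 - t) * cos y\<bar> \<le> 2 * 1"
      unfolding abs_mult using assms by (intro mult_mono) auto
    moreover have "\<bar>l / pi * sin y\<bar> \<le> l / pi * 1"
      unfolding abs_mult using assms by (intro mult_mono) auto
    ultimately show ?thesis by linarith
  qed
  from mult_left_mono[OF this[of "real (Suc k) * (2 * pi * t)"], of "exp (- l) ^ Suc k"]
  show ?thesis unfolding psi_term_def abs_mult by (simp add: mult.commute)
qed

section \<open>The cosine transform of \<open>psi\<close>, term by term\<close>

lemma integral_tent_cos:
  fixes w :: complex
  assumes "w \<noteq> 0"
  shows "((\<lambda>t. 2 * of_real (1 - t) * cos (w * of_real t)) has_integral 2 * (1 - cos w) / w\<^sup>2) {0..1}"
proof -
  define a where "a = 1 / w"
  have aw: "a * w = 1" using assms by (simp add: a_def)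
  define F where "F z = 2 * ((1 - z) * sin (w * z) * a - cos (w * z) * a\<^sup>2)" for z
  have "((\<lambda>t. 2 * of_real (1 - t) * cos (w * of_real t)) has_integral (F (of_real 1) - F (of_real 0))) {0..1}"
  proof (rule fundamental_theorem_of_calculus)
    fix t :: real
    have "(F has_field_derivative 2 * (1 - z) * cos (w * z)) (at z)" for z :: complex
    proof (rule DERIV_cong)
      show "(F has_field_derivative 2 * ((- 1 * sin (w * z) + (1 - z) * (cos (w * z) * w)) * a - (- sin (w * z) * w) * a\<^sup>2)) (at z)"
        unfolding F_def by (auto intro!: derivative_eq_intros simp: mult_ac)
      show "2 * ((- 1 * sin (w * z) + (1 - z) * (cos (w * z) * w)) * a - (- sin (w * z) * w) * a\<^sup>2) = 2 * (1 - z) * cos (w * z)"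
        using aw by algebra
    qed
    from has_vector_derivative_real_field[OF this[of "of_real t"]]
    show "((\<lambda>t. F (of_real t)) has_vector_derivative 2 * of_real (1 - t) * cos (w * of_real t)) (at t within {0..1})"
      by simp
  qed simp
  moreover have "F (of_real 1) - F (of_real 0) = 2 * (1 - cos w) / w\<^sup>2"
    by (simp add: F_def a_def power_divide algebra_simps diff_divide_distrib)
  ultimately show ?thesis by (simp only:)
qed

lemma integral_sin:
  fixes w :: complex
  assumes "w \<noteq> 0"
  shows "((\<lambda>t. sin (w * of_real t)) has_integral (1 - cos w) / w) {0..1}"
proof -
  have "((\<lambda>t. sin (w * of_real t)) has_integral (- cos (w * of_real 1) / w - - cos (w * of_real 0) / w)) {0..1}"
  proof (rule fundamental_theorem_of_calculus)
    fix t :: real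
    have "((\<lambda>z. - cos (w * z) / w) has_field_derivative sin (w * z)) (at z)" for z :: complex
    proof (rule DERIV_cong)
      show "((\<lambda>z. - cos (w * z) / w) has_field_derivative - (- sin (w * z) * w) / w) (at z)"
        by (auto intro!: derivative_eq_intros simp: assms)
    qed (use assms in simp)
    from has_vector_derivative_real_field[OF this[of "of_real t"]]
    show "((\<lambda>t. - cos (w * of_real t) / w) has_vector_derivative sin (w * of_real t)) (at t within {0..1})" .
  qed simp
  then show ?thesis by (simp add: diff_divide_distrib)
qed

text \<open>Product formulas split the integrand into the frequencies u = 2 pi (z - (k+1)) and v = 2
  pi (z + (k+1)). By periodicity 1 - cos u and 1 - cos v both equal 2 pi^2 c, which is where the
  factor (sin (pi z) / pi)^2 of M comes from. The tent yields the double poles and the sine the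
  simple ones.\<close>

lemma integral_psi_term:
  fixes z :: complex
  assumes z: "z \<notin> \<int>"
  defines "c \<equiv> (sin (of_real pi * z) / of_real pi)\<^sup>2"
  shows "((\<lambda>t. 2 * of_real (psi_term l k t) * cos (2 * of_real pi * z * of_real t)) has_integral
      of_real (exp (- l) ^ Suc k) * (c * (1 / (z - of_nat (Suc k))\<^sup>2 + 1 / (z + of_nat (Suc k))\<^sup>2)
        - of_real l * (c * (1 / (z - of_nat (Suc k)) - 1 / (z + of_nat (Suc k)))))) {0..1}"
proof -
  let ?k = "of_nat (Suc k) :: complex"
  let ?p = "2 * of_real pi :: complex"
  define u where "u = ?p * (z - ?k)"
  define v where "v = ?p * (z + ?k)"
  have zk: "z - ?k \<noteq> 0" "z + ?k \<noteq> 0"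
  proof -
    show "z - ?k \<noteq> 0" using z by (metis Ints_of_nat eq_iff_diff_eq_0)
    show "z + ?k \<noteq> 0" using z by (metis Ints_minus Ints_of_nat eq_neg_iff_add_eq_0)
  qed
  then have uv: "u \<noteq> 0" "v \<noteq> 0" by (simp_all add: u_def v_def)
  have per: "cos (x - ?p * ?k) = cos x" "cos (x + ?p * ?k) = cos x" for x :: complex
  proof -
    have s: "sin (?p * ?k) = 0" "cos (?p * ?k) = 1"
      using sin_of_real[of "2 * pi * real (Suc k)", where 'a = complex] cos_of_real[of "2 * pi * real (Suc k)", where 'a = complex]
        sin_2npi[of "Suc k"] cos_2npi[of "Suc k"] by (simp_all add: mult_ac del: of_nat_Suc sin_2npi cos_2npi)
    show "cos (x - ?p * ?k) = cos x" "cos (x + ?p * ?k) = cos x"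
      unfolding cos_diff cos_add s by simp_all
  qed
  have c1: "cos u = cos (?p * z)" "cos v = cos (?p * z)"
    unfolding u_def v_def right_diff_distrib distrib_left by (rule per)+
  have c2: "1 - cos (?p * z) = 2 * (of_real pi)\<^sup>2 * c"
    using cos_double_sin[of "of_real pi * z"] by (simp add: c_def power_divide mult.assoc)
  have "((\<lambda>t. 2 * of_real (1 - t) * cos (u * of_real t) + 2 * of_real (1 - t) * cos (v * of_real t)
       + of_real (l / pi) * (sin (v * of_real t) - sin (u * of_real t))) has_integral
     (2 * (1 - cos u) / u\<^sup>2 + 2 * (1 - cos v) / v\<^sup>2 + of_real (l / pi) * ((1 - cos v) / v - (1 - cos u) / u))) {0..1}"
    by (intro has_integral_add has_integral_diff has_integral_mult_right integral_tent_cos integral_sin uv)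
  from has_integral_mult_right[OF this, of "of_real (exp (- l) ^ Suc k)"]
  have I: "((\<lambda>t. of_real (exp (- l) ^ Suc k) * (2 * of_real (1 - t) * cos (u * of_real t) + 2 * of_real (1 - t) * cos (v * of_real t)
       + of_real (l / pi) * (sin (v * of_real t) - sin (u * of_real t)))) has_integral
     of_real (exp (- l) ^ Suc k) * (2 * (1 - cos u) / u\<^sup>2 + 2 * (1 - cos v) / v\<^sup>2 + of_real (l / pi) * ((1 - cos v) / v - (1 - cos u) / u))) {0..1}" .
  have f: "of_real (exp (- l) ^ Suc k) * (2 * of_real (1 - t) * cos (u * of_real t) + 2 * of_real (1 - t) * cos (v * of_real t)
       + of_real (l / pi) * (sin (v * of_real t) - sin (u * of_real t)))
     = 2 * of_real (psi_term l k t) * cos (?p * z * of_real t)" for t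
  proof -
    define A where "A = ?p * z * of_real t"
    define y where "y = real (Suc k) * (2 * pi * t)"
    have a: "u * of_real t = A - of_real y" "v * of_real t = A + of_real y"
      by (simp_all add: u_def v_def A_def y_def algebra_simps)
    show ?thesis unfolding a A_def[symmetric] psi_term_def y_def[symmetric] cos_add cos_diff sin_add sin_diff
        of_real_mult of_real_add cos_of_real[symmetric] sin_of_real[symmetric]
      by (simp add: algebra_simps)
  qed
  have v: "2 * (1 - cos u) / u\<^sup>2 + 2 * (1 - cos v) / v\<^sup>2 + of_real (l / pi) * ((1 - cos v) / v - (1 - cos u) / u)
     = c * (1 / (z - ?k)\<^sup>2 + 1 / (z + ?k)\<^sup>2) - of_real l * (c * (1 / (z - ?k) - 1 / (z + ?k)))"
  proof -
    define P where "P = complex_of_real pi"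
    have P: "P \<noteq> 0" by (simp add: P_def)
    have "2 * (2 * P\<^sup>2 * c) / (2 * P * a)\<^sup>2 = c * (1 / a\<^sup>2)" "of_real l / P * ((2 * P\<^sup>2 * c) / (2 * P * a)) = of_real l * (c * (1 / a))"
      if "a \<noteq> 0" for a using that P by (simp_all add: field_simps power2_eq_square)
    from this[OF zk(1)] this[OF zk(2)] show ?thesis
      unfolding c1 c2 unfolding u_def v_def of_real_divide P_def[symmetric] right_diff_distrib distrib_left
      by (simp only:) simp
  qed
  show ?thesis using I unfolding f v .
qed

lemma integral_tent:
  fixes z :: complex
  assumes z: "z \<notin> \<int>"
  shows "((\<lambda>t. 2 * of_real (1 - t) * cos (2 * of_real pi * z * of_real t)) has_integral
      (sin (of_real pi * z) / of_real pi)\<^sup>2 * (1 / z\<^sup>2)) {0..1}"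
proof -
  have z0: "z \<noteq> 0" using z by auto
  have "2 * (1 - cos (2 * of_real pi * z)) / (2 * of_real pi * z)\<^sup>2 = (sin (of_real pi * z) / of_real pi)\<^sup>2 * (1 / z\<^sup>2)"
  proof -
    have "1 - cos (2 * of_real pi * z) = 2 * (sin (of_real pi * z))\<^sup>2"
      using cos_double_sin[of "of_real pi * z"] by (simp add: mult.assoc)
    then show ?thesis by (simp add: power_mult_distrib power_divide)
  qed
  moreover have "2 * of_real pi * z \<noteq> 0" using z0 by simp
  note integral_tent_cos[OF this]
  ultimately show ?thesis by (simp only:)
qed

text \<open>The Fourier transform, at a complex argument, of the even extension of
  \<open>psi\<close> by zero outside [-1, 1], folded to [0, 1]. It is continuous everywhere and so
  supplies the values of M at the removable singularities.\<close>

definition transform :: "real \<Rightarrow> complex \<Rightarrow> complex" where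
  "transform l z = integral {0..1} (\<lambda>t. 2 * of_real (psi l t) * cos (2 * of_real pi * z * of_real t))"

lemma continuous_psi [continuous_intros]:
  fixes f :: "'a :: t2_space \<Rightarrow> real"
  assumes "0 < l" "continuous_on S f"
  shows "continuous_on S (\<lambda>x. psi l (f x))"
  unfolding psi_def using cosh_gt_cos[OF assms(1)]
  by (intro continuous_intros assms(2)) (auto simp: less_imp_neq[symmetric])

text \<open>Termwise integration of the harmonic expansion of \<open>psi\<close>. Convergence is
  uniform on [0, 1] by the geometric bound on \<open>psi_term\<close>; the cosine, although of
  complex argument, is bounded on the interval.\<close>

lemma transform_sums:
  assumes l: "0 < l" and z: "z \<notin> \<int>"
  defines "c \<equiv> (sin (of_real pi * z) / of_real pi)\<^sup>2"
  shows "(\<lambda>k. of_real (exp (- l) ^ Suc k) * (c * (1 / (z - of_nat (Suc k))\<^sup>2 + 1 / (z + of_nat (Suc k))\<^sup>2)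
        - of_real l * (c * (1 / (z - of_nat (Suc k)) - 1 / (z + of_nat (Suc k))))))
     sums (transform l z - c * (1 / z\<^sup>2))"
proof -
  define C where "C t = cos (2 * of_real pi * z * of_real t)" for t :: real
  define V where "V k = of_real (exp (- l) ^ Suc k) * (c * (1 / (z - of_nat (Suc k))\<^sup>2 + 1 / (z + of_nat (Suc k))\<^sup>2)
        - of_real l * (c * (1 / (z - of_nat (Suc k)) - 1 / (z + of_nat (Suc k)))))" for k
  have contC: "continuous_on {0..1} C" unfolding C_def by (intro continuous_intros)
  then have "bounded (C ` {0..1})" by (intro compact_imp_bounded compact_continuous_image) simp_all
  then obtain K where K: "K > 0" "\<And>t. t \<in> {0..1} \<Longrightarrow> norm (C t) \<le> K" by (auto simp: bounded_pos)
  define f where "f k t = 2 * of_real (psi_term l k t) * C t" for k t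
  define g where "g t = 2 * of_real (psi l t - (1 - t)) * C t" for t
  have fsums: "(\<lambda>k. f k t) sums g t" for t
    unfolding f_def g_def
    by (intro sums_mult sums_mult2 sums_of_real psi_series[OF l])
  have "uniform_limit {0..1} (\<lambda>n t. \<Sum>k<n. f k t) (\<lambda>t. \<Sum>k. f k t) sequentially"
  proof (rule Weierstrass_m_test)
    fix k t assume t: "t \<in> {0..1::real}"
    have "norm (f k t) = 2 * \<bar>psi_term l k t\<bar> * norm (C t)" by (simp add: f_def norm_mult)
    also have "\<dots> \<le> 2 * ((2 + l / pi) * exp (- l) ^ Suc k) * K"
    proof (rule mult_mono)
      show "2 * \<bar>psi_term l k t\<bar> \<le> 2 * ((2 + l / pi) * exp (- l) ^ Suc k)"
        using psi_term_bound[OF l, of t k] t by simp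
      show "0 \<le> 2 * ((2 + l / pi) * exp (- l) ^ Suc k)" using l by simp
    qed (use K t in simp_all)
    finally show "norm (f k t) \<le> 2 * ((2 + l / pi) * exp (- l) ^ Suc k) * K" .
  next
    have "summable (\<lambda>k. exp (- l) ^ k)" using l by (intro summable_geometric) simp
    then have "summable (\<lambda>k. exp (- l) ^ Suc k)" by (subst summable_Suc_iff)
    then show "summable (\<lambda>k. 2 * ((2 + l / pi) * exp (- l) ^ Suc k) * K)"
      by (intro summable_mult2 summable_mult)
  qed
  moreover have "(\<lambda>t. \<Sum>k. f k t) = g" using fsums by (simp add: sums_iff fun_eq_iff)
  ultimately have "uniform_limit {0..1} (\<lambda>n t. \<Sum>k<n. f k t) g sequentially" by simp
  moreover have "continuous_on {0..1} (\<lambda>t. \<Sum>k<n. f k t)" for n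
    unfolding f_def psi_term_def by (intro continuous_intros contC) simp_all
  ultimately obtain I J where IJ: "\<And>n. ((\<lambda>t. \<Sum>k<n. f k t) has_integral I n) {0..1}" "(g has_integral J) {0..1}" "I \<longlonglongrightarrow> J"
  proof (rule uniform_limit_integral[OF _ _ trivial_limit_sequentially])
    fix I J assume "\<And>n. ((\<lambda>t. \<Sum>k<n. f k t) has_integral I n) {0..1}" "(g has_integral J) {0..1}" "I \<longlonglongrightarrow> J"
    then show thesis by (rule that)
  qed
  have IV: "((\<lambda>t. \<Sum>k<n. f k t) has_integral (\<Sum>k<n. V k)) {0..1}" for n
    unfolding f_def C_def V_def c_def
    by (intro has_integral_sum integral_psi_term z) simp
  have "I = (\<lambda>n. \<Sum>k<n. V k)" by (rule ext, rule has_integral_unique[OF IJ(1) IV])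
  then have "V sums J" using IJ(3) by (simp add: sums_def)
  moreover have "J = transform l z - c * (1 / z\<^sup>2)"
  proof -
    have "((\<lambda>t. g t + 2 * of_real (1 - t) * C t) has_integral (J + c * (1 / z\<^sup>2))) {0..1}"
      unfolding C_def c_def by (intro has_integral_add integral_tent z) (use IJ(2) in simp)
    moreover have "g t + 2 * of_real (1 - t) * C t = 2 * of_real (psi l t) * C t" for t
      by (simp add: g_def algebra_simps)
    ultimately have "transform l z = J + c * (1 / z\<^sup>2)"
      unfolding transform_def C_def[symmetric] by (intro integral_unique) simp
    then show ?thesis by simp
  qed
  ultimately show ?thesis unfolding V_def[symmetric] by (simp only:)
qed

text \<open>Pairs n with -n, the form in which the terms of \<open>transform\<close> arise.\<close>

lemma has_sum_int:
  fixes f :: "int \<Rightarrow> 'a :: banach"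
  assumes "summable (\<lambda>n. norm (f (int (Suc n))))" "summable (\<lambda>n. norm (f (- int (Suc n))))"
  shows "(f has_sum (f 0 + (\<Sum>n. f (int (Suc n)) + f (- int (Suc n))))) UNIV"
proof -
  have U: "(UNIV :: int set) = {0} \<union> (range (\<lambda>n. int (Suc n)) \<union> range (\<lambda>n. - int (Suc n)))"
  proof (intro equalityI subsetI)
    fix k :: int
    consider "k = 0" | "k > 0" | "k < 0" by linarith
    then show "k \<in> {0} \<union> (range (\<lambda>n. int (Suc n)) \<union> range (\<lambda>n. - int (Suc n)))"
    proof cases
      case 2
      then have "k = int (Suc (nat (k - 1)))" by simp
      then show ?thesis by blast
    next
      case 3
      then have "k = - int (Suc (nat (- k - 1)))" by simp
      then show ?thesis by blast
    qed simp
  qed simp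
  have s: "summable (\<lambda>n. f (int (Suc n)))" "summable (\<lambda>n. f (- int (Suc n)))"
    using assms by (auto intro: summable_norm_cancel)
  have "(f has_sum (\<Sum>n. f (int (Suc n)))) (range (\<lambda>n. int (Suc n)))"
    using norm_summable_imp_has_sum[OF assms(1) summable_sums[OF s(1)]]
    by (subst has_sum_reindex) (simp_all add: inj_on_def o_def)
  moreover have "(f has_sum (\<Sum>n. f (- int (Suc n)))) (range (\<lambda>n. - int (Suc n)))"
    using norm_summable_imp_has_sum[OF assms(2) summable_sums[OF s(2)]]
    by (subst has_sum_reindex) (simp_all add: inj_on_def o_def)
  ultimately have 1: "(f has_sum ((\<Sum>n. f (int (Suc n))) + (\<Sum>n. f (- int (Suc n)))))
      (range (\<lambda>n. int (Suc n)) \<union> range (\<lambda>n. - int (Suc n)))"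
    by (rule has_sum_Un_disjoint) auto
  have 2: "(f has_sum f 0) {0}" using has_sum_finite[of "{0}" f] by simp
  have "(f has_sum (f 0 + ((\<Sum>n. f (int (Suc n))) + (\<Sum>n. f (- int (Suc n)))))) UNIV"
    by (subst U, rule has_sum_Un_disjoint[OF 2 1]) auto
  then show ?thesis by (simp only: suminf_add[OF s])
qed

text \<open>As soon as n exceeds norm z + 1 the denominators have norm at least 1 and the
  exponential factor alone gives convergence. The unit s stands for the signs 1 and -1.\<close>

lemma summable_exp_over_power:
  fixes z s :: complex
  assumes "0 < l" "norm s = 1"
  shows "summable (\<lambda>n. norm (of_real (exp (- l * of_int (int (Suc n)))) / (z - s * of_nat (Suc n)) ^ m))"
proof -
  obtain M :: nat where M: "norm z + 1 < real M" using reals_Archimedean2 by blast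
  have sg: "summable (\<lambda>n. exp (- l) ^ n)" using assms by (intro summable_geometric) simp
  show ?thesis
  proof (rule summable_comparison_test'[OF sg, of M])
    fix n assume n: "M \<le> n"
    have "real (Suc n) - norm z \<le> norm (z - s * of_nat (Suc n))"
      using norm_triangle_ineq2[of "s * of_nat (Suc n)" z] assms(2)
      by (simp add: norm_mult norm_minus_commute del: of_nat_Suc)
    then have "1 \<le> norm (z - s * of_nat (Suc n))" using M n by simp
    then have "1 \<le> norm (z - s * of_nat (Suc n)) ^ m" by (rule one_le_power)
    then have "exp (- l * real (Suc n)) / norm (z - s * of_nat (Suc n)) ^ m \<le> exp (- l * real (Suc n)) / 1"
      by (intro divide_left_mono) simp_all
    also have "exp (- l * real (Suc n)) \<le> exp (- l * real n)" using assms(1) by simp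
    also have "exp (- l * real n) = exp (- l) ^ n" using exp_of_nat2_mult[of "- l" n] by simp
    finally show "norm (norm (of_real (exp (- l * of_int (int (Suc n)))) / (z - s * of_nat (Suc n)) ^ m)) \<le> exp (- l) ^ n"
      by (simp add: norm_divide norm_power)
  qed
qed

text \<open>M before its singularities are removed. At an integer k the sine factor makes this 0,
  whereas the limit there is exp (-l |k|).\<close>

definition M_series :: "real \<Rightarrow> complex \<Rightarrow> complex" where
  "M_series l z = (sin (of_real pi * z) / of_real pi)\<^sup>2 *
     ((\<Sum>\<^sub>\<infinity>k\<in>(UNIV::int set). of_real (exp (- l * of_int \<bar>k\<bar>)) / (z - of_int k)\<^sup>2)
      - of_real l * (\<Sum>\<^sub>\<infinity>k\<in>(UNIV::int set).
          of_int (sgn k) * of_real (exp (- l * of_int \<bar>k\<bar>)) / (z - of_int k)))"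

lemma M_series_eq_transform:
  assumes l: "0 < l" and z: "z \<notin> \<int>"
  shows "M_series l z = transform l z"
proof -
  define c where "c = (sin (of_real pi * z) / of_real pi)\<^sup>2"
  define f where "f k = complex_of_real (exp (- l * of_int \<bar>k\<bar>)) / (z - of_int k)\<^sup>2" for k
  define g where "g k = of_int (sgn k) * complex_of_real (exp (- l * of_int \<bar>k\<bar>)) / (z - of_int k)" for k
  define E where "E n = complex_of_real (exp (- l) ^ Suc n)" for n
  have E: "complex_of_real (exp (- l * of_int (int (Suc n)))) = E n" for n
    using exp_of_nat2_mult[of "- l" "Suc n"] by (simp add: E_def del: of_nat_Suc power_Suc)
  have fp: "f (int (Suc n)) = of_real (exp (- l * of_int (int (Suc n)))) / (z - 1 * of_nat (Suc n)) ^ 2"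
    and fm: "f (- int (Suc n)) = of_real (exp (- l * of_int (int (Suc n)))) / (z - (- 1) * of_nat (Suc n)) ^ 2"
    and gp: "g (int (Suc n)) = of_real (exp (- l * of_int (int (Suc n)))) / (z - 1 * of_nat (Suc n)) ^ 1"
    and gm: "g (- int (Suc n)) = - (of_real (exp (- l * of_int (int (Suc n)))) / (z - (- 1) * of_nat (Suc n)) ^ 1)" for n
    by (simp_all add: f_def g_def)
  have sf: "(f has_sum (f 0 + (\<Sum>n. f (int (Suc n)) + f (- int (Suc n))))) UNIV"
    by (rule has_sum_int; unfold fp fm; rule summable_exp_over_power[OF l]) simp_all
  have sg: "(g has_sum (g 0 + (\<Sum>n. g (int (Suc n)) + g (- int (Suc n))))) UNIV"
    by (rule has_sum_int; unfold gp gm norm_minus_cancel; rule summable_exp_over_power[OF l]) simp_all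
  have sumf: "summable (\<lambda>n. f (int (Suc n)) + f (- int (Suc n)))"
    unfolding fp fm
    by (intro summable_add summable_norm_cancel[OF summable_exp_over_power[OF l]]) simp_all
  have sumg: "summable (\<lambda>n. g (int (Suc n)) + g (- int (Suc n)))"
    unfolding gp gm
    by (intro summable_add summable_minus summable_norm_cancel[OF summable_exp_over_power[OF l]]) simp_all
  define F where "F = (\<Sum>n. f (int (Suc n)) + f (- int (Suc n)))"
  define G where "G = (\<Sum>n. g (int (Suc n)) + g (- int (Suc n)))"
  have "M_series l z = c * ((f 0 + F) - of_real l * (g 0 + G))"
    unfolding M_series_def c_def f_def[symmetric] g_def[symmetric] infsumI[OF sf] infsumI[OF sg] F_def G_def ..
  also have "\<dots> = c * (1 / z\<^sup>2) + (c * F - of_real l * (c * G))"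
    by (simp add: f_def g_def algebra_simps)
  also have "c * F - of_real l * (c * G) = transform l z - c * (1 / z\<^sup>2)"
  proof (rule sums_unique2)
    show "(\<lambda>n. c * (f (int (Suc n)) + f (- int (Suc n))) - of_real l * (c * (g (int (Suc n)) + g (- int (Suc n)))))
        sums (c * F - of_real l * (c * G))"
      unfolding F_def G_def
      by (intro sums_diff sums_mult summable_sums sumf sumg)
    have "c * (f (int (Suc n)) + f (- int (Suc n))) - of_real l * (c * (g (int (Suc n)) + g (- int (Suc n))))
       = of_real (exp (- l) ^ Suc n) * (c * (1 / (z - of_nat (Suc n))\<^sup>2 + 1 / (z + of_nat (Suc n))\<^sup>2)
        - of_real l * (c * (1 / (z - of_nat (Suc n)) - 1 / (z + of_nat (Suc n)))))" for n
    proof -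
      have a: "z - (- 1) * of_nat (Suc n) = z + of_nat (Suc n)" "z - 1 * of_nat (Suc n) = z - of_nat (Suc n)"
        by simp_all
      have "c * (e / x\<^sup>2 + e / y\<^sup>2) - L * (c * (e / x ^ 1 + - (e / y ^ 1)))
         = e * (c * (1 / x\<^sup>2 + 1 / y\<^sup>2) - L * (c * (1 / x - 1 / y)))" for e x y L :: complex
        by (simp add: algebra_simps)
      then show ?thesis unfolding fp fm gp gm a E unfolding E_def .
    qed
    then show "(\<lambda>n. c * (f (int (Suc n)) + f (- int (Suc n))) - of_real l * (c * (g (int (Suc n)) + g (- int (Suc n)))))
        sums (transform l z - c * (1 / z\<^sup>2))"
      using transform_sums[OF l z] unfolding c_def[symmetric] by (simp only:)
  qed
  finally show ?thesis by simp
qed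

lemma continuous_transform:
  assumes "0 < l" shows "continuous_on UNIV (transform l)"
proof -
  have "continuous_on UNIV (\<lambda>z :: complex. integral (cbox 0 1) (\<lambda>t. 2 * of_real (psi l t) * cos (2 * of_real pi * z * of_real t)))"
    by (rule integral_continuous_on_param) (auto simp: case_prod_unfold intro!: continuous_intros assms)
  then show ?thesis by (simp add: transform_def[abs_def])
qed

text \<open>Off the integers the series agrees with the continuous function
  \<open>transform\<close>. Its limit at any point, integers included, is therefore the value of
  \<open>transform\<close>, and this limit is what \<open>remove_sings\<close> takes.\<close>

lemma M_fun_eq_transform:
  assumes l: "0 < l"
  shows "M_fun l z = transform l z"
proof -
  have M: "M_fun l = remove_sings (M_series l)" unfolding M_fun_def M_series_def ..
  have "open (- (\<int> - {z}))" by (rule open_Compl, rule closed_subset_Ints) blast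
  then have "eventually (\<lambda>w. w \<in> - (\<int> - {z})) (nhds z)"
    by (rule eventually_nhds_in_open) simp
  then have "eventually (\<lambda>w. transform l w = M_series l w) (at z)"
    unfolding eventually_at_filter
    by (rule eventually_mono) (auto simp: M_series_eq_transform[OF l])
  moreover have "(transform l) \<midarrow>z\<rightarrow> transform l z"
    using continuous_transform[OF l] by (simp add: continuous_on_eq_continuous_at isCont_def)
  ultimately have "(M_series l) \<midarrow>z\<rightarrow> transform l z"
    by (rule Lim_transform_eventually[rotated])
  then show ?thesis unfolding M by (rule remove_sings_eqI)
qed

section \<open>Fourier inversion by Gaussian summation\<close>

lemma gaussian_unit_exp_integral:
  assumes "0 < \<epsilon>"
  shows "integrable lborel (\<lambda>x. exp (- (2 * pi * \<epsilon> * x)\<^sup>2 / 2))"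
    and "(\<integral>x. unit_exp (u * x) * of_real (exp (- (2 * pi * \<epsilon> * x)\<^sup>2 / 2)) \<partial>lborel)
       = of_real (std_normal_density (u / \<epsilon>) / \<epsilon>)"
proof -
  define c where "c = 2 * pi * \<epsilon>"
  have c: "c > 0" using assms by (simp add: c_def)
  have n: "std_normal_density y = exp (- y\<^sup>2 / 2) / sqrt (2 * pi)" for y
    by (simp add: std_normal_density_def)
  have e: "exp (- y\<^sup>2 / 2) = sqrt (2 * pi) * std_normal_density y" for y
    by (simp add: n)
  have I: "integrable lborel (\<lambda>y :: real. exp (- y\<^sup>2 / 2))"
    unfolding e using integrable_std_normal_moment[of 0] by (intro integrable_mult_right) simp
  have "integrable lborel (\<lambda>x. exp (- (0 + c * x)\<^sup>2 / 2))"
    by (rule lborel_integrable_real_affine[OF I]) (use c in simp)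
  then show "integrable lborel (\<lambda>x. exp (- (2 * pi * \<epsilon> * x)\<^sup>2 / 2))" by (simp add: c_def)
  define w where "w = u / \<epsilon>"
  have "char std_normal_distribution w = (\<integral>y. std_normal_density y *\<^sub>R iexp (w * y) \<partial>lborel)"
    unfolding char_def by (rule integral_density) simp_all
  then have ch: "(\<integral>y. std_normal_density y *\<^sub>R iexp (w * y) \<partial>lborel) = of_real (exp (- w\<^sup>2 / 2))"
    unfolding char_std_normal_distribution by simp
  \<comment> \<open>The substitution y = c x with c = 2 pi \<epsilon> brings the characteristic
    function of the standard normal distribution to the normalisation e(ux).\<close>
  have "(\<integral>y. std_normal_density y *\<^sub>R iexp (w * y) \<partial>lborel)
     = \<bar>c\<bar> *\<^sub>R (\<integral>x. std_normal_density (0 + c * x) *\<^sub>R iexp (w * (0 + c * x)) \<partial>lborel)"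
    by (rule lborel_integral_real_affine) (use c in simp)
  also have "(\<lambda>x. std_normal_density (0 + c * x) *\<^sub>R iexp (w * (0 + c * x)))
     = (\<lambda>x. of_real (1 / sqrt (2 * pi)) * (unit_exp (u * x) * of_real (exp (- (2 * pi * \<epsilon> * x)\<^sup>2 / 2))))"
  proof
    fix x
    have "w * (0 + c * x) = 2 * pi * (u * x)" using assms by (simp add: w_def c_def)
    then have "iexp (w * (0 + c * x)) = unit_exp (u * x)"
      by (simp only: unit_exp_cis cis_conv_exp)
    then show "std_normal_density (0 + c * x) *\<^sub>R iexp (w * (0 + c * x))
      = of_real (1 / sqrt (2 * pi)) * (unit_exp (u * x) * of_real (exp (- (2 * pi * \<epsilon> * x)\<^sup>2 / 2)))"
      by (simp add: n scaleR_conv_of_real c_def)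
  qed
  finally have "of_real (exp (- w\<^sup>2 / 2)) = c *\<^sub>R (of_real (1 / sqrt (2 * pi)) *
     (\<integral>x. unit_exp (u * x) * of_real (exp (- (2 * pi * \<epsilon> * x)\<^sup>2 / 2)) \<partial>lborel))"
    unfolding ch using c by simp
  then have "(\<integral>x. unit_exp (u * x) * of_real (exp (- (2 * pi * \<epsilon> * x)\<^sup>2 / 2)) \<partial>lborel)
     = of_real (exp (- w\<^sup>2 / 2) * sqrt (2 * pi) / c)"
    using c by (simp add: scaleR_conv_of_real field_simps)
  also have "exp (- w\<^sup>2 / 2) * sqrt (2 * pi) / c = std_normal_density (u / \<epsilon>) / \<epsilon>"
  proof -
    have "sqrt (2 * pi) * sqrt (2 * pi) = 2 * pi" by simp
    then have "s * s = 2 * pi \<Longrightarrow> s > 0 \<Longrightarrow> x * s / c = x / s / \<epsilon>" for s x :: real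
      unfolding c_def using assms by (simp add: field_simps)
    from this[of "sqrt (2 * pi)" "exp (- w\<^sup>2 / 2)"] show ?thesis by (simp add: n w_def)
  qed
  finally show "(\<integral>x. unit_exp (u * x) * of_real (exp (- (2 * pi * \<epsilon> * x)\<^sup>2 / 2)) \<partial>lborel)
       = of_real (std_normal_density (u / \<epsilon>) / \<epsilon>)" .
qed

lemma continuous_unit_exp [continuous_intros]:
  "continuous_on S f \<Longrightarrow> continuous_on S (\<lambda>x. unit_exp (f x))"
  unfolding unit_exp_def by (intro continuous_intros)

lemma measurable_unit_exp [measurable]: "unit_exp \<in> borel_measurable borel"
  by (intro borel_measurable_continuous_onI continuous_intros)

text \<open>Damping \<open>G\<close> by a Gaussian makes Fubini applicable and turns the left side
  into the mean of \<open>f\<close> around s against a normal density of width \<epsilon>. As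
  \<epsilon> tends to 0 both sides converge by dominated convergence, with the majorants
  \<open>norm (G x)\<close> and \<open>B\<close> times the density.\<close>

theorem fourier_inversion:
  fixes f :: "real \<Rightarrow> complex"
  assumes f: "continuous_on UNIV f" "integrable lborel f" and B: "\<And>t. norm (f t) \<le> B"
    and G: "\<And>x. G x = (\<integral>t. f t * unit_exp (t * x) \<partial>lborel)" and iG: "integrable lborel G"
  shows "(\<integral>x. G x * unit_exp (- s * x) \<partial>lborel) = f s"
proof -
  have [measurable]: "f \<in> borel_measurable borel" using f(1) by (rule borel_measurable_continuous_onI)
  have [measurable]: "G \<in> borel_measurable lborel" using iG by (rule borel_measurable_integrable)
  define \<gamma> where "\<gamma> \<epsilon> x = exp (- (2 * pi * \<epsilon> * x)\<^sup>2 / 2)" for \<epsilon> x :: real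
  have [measurable]: "\<gamma> \<epsilon> \<in> borel_measurable borel" for \<epsilon> unfolding \<gamma>_def by measurable
  have \<gamma>: "0 \<le> \<gamma> \<epsilon> x" "\<gamma> \<epsilon> x \<le> 1" for \<epsilon> x by (simp_all add: \<gamma>_def)
  have key: "(\<integral>x. G x * unit_exp (- s * x) * of_real (\<gamma> \<epsilon> x) \<partial>lborel)
     = (\<integral>v. f (s + \<epsilon> * v) * of_real (std_normal_density v) \<partial>lborel)" if \<epsilon>: "0 < \<epsilon>" for \<epsilon>
  proof -
    note gi = gaussian_unit_exp_integral[OF \<epsilon>, folded \<gamma>_def]
    define h where "h x t = f t * (unit_exp ((t - s) * x) * of_real (\<gamma> \<epsilon> x))" for x t
    have nh: "norm (h x t) = norm (f t) * \<gamma> \<epsilon> x" for x t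
      using \<gamma>(1) by (simp add: h_def norm_mult)
    have "integrable (lborel \<Otimes>\<^sub>M lborel) (case_prod h)"
    proof (rule lborel_pair.Fubini_integrable)
      show "case_prod h \<in> borel_measurable (lborel \<Otimes>\<^sub>M lborel)" unfolding h_def by measurable
      show "integrable lborel (\<lambda>x. \<integral>y. norm (case_prod h (x, y)) \<partial>lborel)"
        unfolding prod.case nh using gi(1) by simp
      have "integrable lborel (h x)" for x
      proof (rule Bochner_Integration.integrable_bound[OF integrable_mult_left[OF integrable_norm[OF f(2)], of 1]])
        show "h x \<in> borel_measurable lborel" unfolding h_def by measurable
        show "AE t in lborel. norm (h x t) \<le> norm (norm (f t) * 1)"
          unfolding nh using \<gamma> by (intro AE_I2) (simp add: mult_left_le)
      qed
      then show "AE x in lborel. integrable lborel (\<lambda>y. case_prod h (x, y))" by simp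
    qed
    then have sw: "(\<integral>t. (\<integral>x. h x t \<partial>lborel) \<partial>lborel) = (\<integral>x. (\<integral>t. h x t \<partial>lborel) \<partial>lborel)"
      by (rule lborel_pair.Fubini_integral)
    have "(\<integral>t. h x t \<partial>lborel) = G x * unit_exp (- s * x) * of_real (\<gamma> \<epsilon> x)" for x
    proof -
      have hx: "h x t = f t * unit_exp (t * x) * (unit_exp (- s * x) * of_real (\<gamma> \<epsilon> x))" for t
      proof -
        have "(t - s) * x = t * x + (- s * x)" by (simp add: algebra_simps)
        then show ?thesis by (simp only: h_def unit_exp_add mult.assoc)
      qed
      show ?thesis unfolding G hx mult.assoc[symmetric] integral_mult_left_zero ..
    qed
    moreover have "(\<integral>x. h x t \<partial>lborel) = f t * of_real (std_normal_density ((t - s) / \<epsilon>) / \<epsilon>)" for t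
      unfolding h_def by (simp add: gi(2))
    ultimately have "(\<integral>x. G x * unit_exp (- s * x) * of_real (\<gamma> \<epsilon> x) \<partial>lborel)
       = (\<integral>t. f t * of_real (std_normal_density ((t - s) / \<epsilon>) / \<epsilon>) \<partial>lborel)"
      using sw by simp
    also have "\<dots> = \<bar>\<epsilon>\<bar> *\<^sub>R (\<integral>v. f (s + \<epsilon> * v) * of_real (std_normal_density (((s + \<epsilon> * v) - s) / \<epsilon>) / \<epsilon>) \<partial>lborel)"
      by (rule lborel_integral_real_affine) (use \<epsilon> in simp)
    also have "(\<lambda>v. f (s + \<epsilon> * v) * of_real (std_normal_density (((s + \<epsilon> * v) - s) / \<epsilon>) / \<epsilon>))
        = (\<lambda>v. f (s + \<epsilon> * v) * of_real (std_normal_density v) * of_real (1 / \<epsilon>))"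
      using \<epsilon> by (simp add: fun_eq_iff)
    finally show ?thesis using \<epsilon> by (simp add: scaleR_conv_of_real)
  qed
  define e where "e n = 1 / real (Suc n)" for n
  have e: "e \<longlonglongrightarrow> 0" "e n > 0" for n
    unfolding e_def using LIMSEQ_inverse_real_of_nat by (simp_all add: inverse_eq_divide)
  have L1: "(\<lambda>n. \<integral>x. G x * unit_exp (- s * x) * of_real (\<gamma> (e n) x) \<partial>lborel) \<longlonglongrightarrow> (\<integral>x. G x * unit_exp (- s * x) \<partial>lborel)"
  proof (rule integral_dominated_convergence[where w = "\<lambda>x. norm (G x)"])
    show "AE x in lborel. (\<lambda>n. G x * unit_exp (- s * x) * of_real (\<gamma> (e n) x)) \<longlonglongrightarrow> G x * unit_exp (- s * x)"
    proof (rule AE_I2)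
      fix x
      have "(\<lambda>n. \<gamma> (e n) x) \<longlonglongrightarrow> exp (- (2 * pi * 0 * x)\<^sup>2 / 2)"
        unfolding \<gamma>_def by (intro tendsto_intros e(1)) simp
      then have "(\<lambda>n. G x * unit_exp (- s * x) * of_real (\<gamma> (e n) x)) \<longlonglongrightarrow> G x * unit_exp (- s * x) * of_real (exp (- (2 * pi * 0 * x)\<^sup>2 / 2))"
        by (intro tendsto_mult tendsto_const tendsto_of_real)
      then show "(\<lambda>n. G x * unit_exp (- s * x) * of_real (\<gamma> (e n) x)) \<longlonglongrightarrow> G x * unit_exp (- s * x)" by simp
    qed
    show "AE x in lborel. norm (G x * unit_exp (- s * x) * of_real (\<gamma> (e n) x)) \<le> norm (G x)" for n
      using \<gamma> by (intro AE_I2) (simp add: norm_mult mult_left_le)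
  qed (use iG in \<open>simp_all\<close>)
  have L2: "(\<lambda>n. \<integral>v. f (s + e n * v) * of_real (std_normal_density v) \<partial>lborel) \<longlonglongrightarrow> (\<integral>v. f s * of_real (std_normal_density v) \<partial>lborel)"
  proof (rule integral_dominated_convergence[where w = "\<lambda>v. B * std_normal_density v"])
    show "AE v in lborel. (\<lambda>n. f (s + e n * v) * of_real (std_normal_density v)) \<longlonglongrightarrow> f s * of_real (std_normal_density v)"
    proof (rule AE_I2)
      fix v
      have "(\<lambda>n. s + e n * v) \<longlonglongrightarrow> s + 0 * v" by (intro tendsto_intros e(1))
      then have "(\<lambda>n. f (s + e n * v)) \<longlonglongrightarrow> f s"
        using f(1) by (intro continuous_on_tendsto_compose[OF f(1)]) simp_all
      then show "(\<lambda>n. f (s + e n * v) * of_real (std_normal_density v)) \<longlonglongrightarrow> f s * of_real (std_normal_density v)"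
        by (intro tendsto_mult tendsto_const)
    qed
    show "AE v in lborel. norm (f (s + e n * v) * of_real (std_normal_density v)) \<le> B * std_normal_density v" for n
      using B by (intro AE_I2) (simp add: norm_mult mult_right_mono)
    show "integrable lborel (\<lambda>v. B * std_normal_density v)"
      using integrable_std_normal_moment[of 0] by (intro integrable_mult_right) simp
  qed simp_all
  have "(\<integral>v. f s * of_real (std_normal_density v) \<partial>lborel) = f s * of_real (\<integral>v. std_normal_density v \<partial>lborel)"
    by simp
  also have "(\<integral>v. std_normal_density v \<partial>lborel) = 1"
    by (rule integral_normal_density) simp
  finally have "(\<integral>v. f s * of_real (std_normal_density v) \<partial>lborel) = f s" by simp
  with LIMSEQ_unique[OF L1] L2 key[OF e(2)] show ?thesis by simp
qed

section \<open>Decay and integrability of the transform, and the closed form of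
  \<open>M_hat\<close>\<close>

lemma cos_transform_decay:
  fixes f f1 f2 :: "real \<Rightarrow> real"
  assumes f: "\<And>t. (f has_real_derivative f1 t) (at t)" and f1: "\<And>t. (f1 has_real_derivative f2 t) (at t)"
    and f2: "continuous_on {0..1} f2" and end0: "f 1 = 0"
  shows "\<exists>C. \<forall>w. w \<noteq> 0 \<longrightarrow> \<bar>integral {0..1} (\<lambda>t. f t * cos (w * t))\<bar> \<le> C / w\<^sup>2"
proof -
  have "bounded (f2 ` {0..1})" by (intro compact_imp_bounded compact_continuous_image f2) simp
  then obtain B where B: "B > 0" "\<And>t. t \<in> {0..1} \<Longrightarrow> norm (f2 t) \<le> B" by (auto simp: bounded_pos)
  have contf: "continuous_on {0..1} f" by (intro DERIV_continuous_on[OF DERIV_subset[OF f]]) simp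
  show ?thesis
  proof (intro exI allI impI)
    fix w :: real assume w: "w \<noteq> 0"
    \<comment> \<open>The primitive found by integrating by parts twice. Its terms of order 1/w
      vanish at 0 because of the sine and at 1 because of f 1 = 0, so order 1/w^2 remains.\<close>
    define F where "F t = f t * (sin (w * t) / w) + f1 t * (cos (w * t) / w\<^sup>2)" for t
    have "((\<lambda>t. f t * cos (w * t) + f2 t * cos (w * t) / w\<^sup>2) has_integral F 1 - F 0) {0..1}"
    proof (rule fundamental_theorem_of_calculus)
      fix t :: real
      have s: "((\<lambda>t. sin (w * t) / w) has_real_derivative cos (w * t)) (at t)"
        using w by (auto intro!: derivative_eq_intros)
      have c: "((\<lambda>t. cos (w * t) / w\<^sup>2) has_real_derivative - (sin (w * t) / w)) (at t)"
        using w by (auto intro!: derivative_eq_intros simp: power2_eq_square)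
      have "(F has_real_derivative (f1 t * (sin (w * t) / w) + cos (w * t) * f t) + (f2 t * (cos (w * t) / w\<^sup>2) + - (sin (w * t) / w) * f1 t)) (at t)"
        unfolding F_def by (rule DERIV_add[OF DERIV_mult[OF f s] DERIV_mult[OF f1 c]])
      then have "(F has_real_derivative f t * cos (w * t) + f2 t * cos (w * t) / w\<^sup>2) (at t)"
        by (rule DERIV_cong) (simp add: mult.commute)
      then show "(F has_vector_derivative f t * cos (w * t) + f2 t * cos (w * t) / w\<^sup>2) (at t within {0..1})"
        by (rule has_vector_derivative_at_within[OF has_real_derivative_iff_has_vector_derivative[THEN iffD1]])
    qed simp
    then have s: "integral {0..1} (\<lambda>t. f t * cos (w * t) + f2 t * cos (w * t) / w\<^sup>2) = F 1 - F 0" by (rule integral_unique)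
    have i1: "(\<lambda>t. f t * cos (w * t)) integrable_on {0..1}"
      by (intro integrable_continuous_interval continuous_intros contf)
    have i2: "(\<lambda>t. f2 t * cos (w * t) / w\<^sup>2) integrable_on {0..1}"
      by (intro integrable_continuous_interval continuous_intros f2) (use w in auto)
    have "integral {0..1} (\<lambda>t. f t * cos (w * t)) + integral {0..1} (\<lambda>t. f2 t * cos (w * t) / w\<^sup>2) = F 1 - F 0"
      using Henstock_Kurzweil_Integration.integral_add[OF i1 i2] s by simp
    moreover have "norm (integral {0..1} (\<lambda>t. f2 t * cos (w * t) / w\<^sup>2)) \<le> B / w\<^sup>2 * (1 - 0)"
    proof (rule integral_bound)
      show "continuous_on {0..1} (\<lambda>t. f2 t * cos (w * t) / w\<^sup>2)"
        by (intro continuous_intros f2) (use w in auto)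
      fix t :: real assume "t \<in> {0..1}"
      then have "\<bar>f2 t\<bar> * \<bar>cos (w * t)\<bar> \<le> B * 1" using B by (intro mult_mono) auto
      then show "norm (f2 t * cos (w * t) / w\<^sup>2) \<le> B / w\<^sup>2" by (simp add: abs_mult divide_right_mono)
    qed simp
    moreover have "F 1 - F 0 = (f1 1 * cos w - f1 0) / w\<^sup>2" by (simp add: F_def end0 diff_divide_distrib)
    moreover have "\<bar>(f1 1 * cos w - f1 0) / w\<^sup>2\<bar> \<le> (\<bar>f1 1\<bar> + \<bar>f1 0\<bar>) / w\<^sup>2"
    proof -
      have "\<bar>f1 1 * cos w\<bar> \<le> \<bar>f1 1\<bar> * 1" unfolding abs_mult by (intro mult_left_mono) auto
      then have "\<bar>f1 1 * cos w - f1 0\<bar> \<le> \<bar>f1 1\<bar> + \<bar>f1 0\<bar>" by linarith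
      then show ?thesis by (simp add: divide_right_mono)
    qed
    moreover have "(\<bar>f1 1\<bar> + \<bar>f1 0\<bar>) / w\<^sup>2 + B / w\<^sup>2 * (1 - 0) = (\<bar>f1 1\<bar> + \<bar>f1 0\<bar> + B) / w\<^sup>2"
      by (simp add: add_divide_distrib)
    ultimately show "\<bar>integral {0..1} (\<lambda>t. f t * cos (w * t))\<bar> \<le> (\<bar>f1 1\<bar> + \<bar>f1 0\<bar> + B) / w\<^sup>2"
      unfolding real_norm_def by linarith
  qed
qed

lemma psi_decay:
  assumes l: "0 < l"
  shows "\<exists>C. \<forall>w. w \<noteq> 0 \<longrightarrow> \<bar>integral {0..1} (\<lambda>t. psi l t * cos (w * t))\<bar> \<le> C / w\<^sup>2"
proof -
  define n where "n t = (1 - t) * sinh l + l / (2 * pi) * sin (2 * pi * t)" for t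
  define n1 where "n1 t = - sinh l + l * cos (2 * pi * t)" for t
  define n2 where "n2 t = - (2 * pi * l * sin (2 * pi * t))" for t
  define d where "d t = cosh l - cos (2 * pi * t)" for t
  define d1 where "d1 t = 2 * pi * sin (2 * pi * t)" for t
  define d2 where "d2 t = 4 * pi\<^sup>2 * cos (2 * pi * t)" for t
  have dp: "d t \<noteq> 0" for t using cosh_gt_cos[OF l, of "2 * pi * t"] by (simp add: d_def)
  have D: "(n has_real_derivative n1 t) (at t)" "(n1 has_real_derivative n2 t) (at t)"
    "(d has_real_derivative d1 t) (at t)" "(d1 has_real_derivative d2 t) (at t)" for t
    unfolding n_def n1_def n2_def d_def d1_def d2_def
    by (auto intro!: derivative_eq_intros simp: power2_eq_square)
  have C: "continuous_on {0..1} n" "continuous_on {0..1} n1" "continuous_on {0..1} n2"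
    "continuous_on {0..1} d" "continuous_on {0..1} d1" "continuous_on {0..1} d2"
    unfolding n_def n1_def n2_def d_def d1_def d2_def by (intro continuous_intros)+
  show ?thesis
  proof (rule cos_transform_decay)
    have psi: "psi l = (\<lambda>t. n t / d t)" by (simp add: fun_eq_iff psi_def n_def d_def)
    show "(psi l has_real_derivative (n1 t * d t - n t * d1 t) / (d t * d t)) (at t)" for t
      unfolding psi by (rule DERIV_divide[OF D(1,3) dp])
    show "((\<lambda>t. (n1 t * d t - n t * d1 t) / (d t * d t)) has_real_derivative
       (((n2 t * d t + d1 t * n1 t) - (n1 t * d1 t + d2 t * n t)) * (d t * d t) - (n1 t * d t - n t * d1 t) * (d1 t * d t + d1 t * d t))
       / ((d t * d t) * (d t * d t))) (at t)" for t
      by (rule DERIV_divide[OF DERIV_diff[OF DERIV_mult[OF D(2,3)] DERIV_mult[OF D(1,4)]] DERIV_mult[OF D(3,3)]])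
         (simp add: dp)
    show "continuous_on {0..1} (\<lambda>t. (((n2 t * d t + d1 t * n1 t) - (n1 t * d1 t + d2 t * n t)) * (d t * d t) - (n1 t * d t - n t * d1 t) * (d1 t * d t + d1 t * d t))
       / ((d t * d t) * (d t * d t)))"
      by (intro continuous_intros C) (simp add: dp)
    show "psi l 1 = 0" by (simp add: psi_def)
  qed
qed

lemma transform_of_real:
  assumes l: "0 < l"
  shows "transform l (of_real x) = of_real (2 * integral {0..1} (\<lambda>t. psi l t * cos (2 * pi * x * t)))"
proof -
  have "(\<lambda>t. psi l t * cos (2 * pi * x * t)) integrable_on {0..1}"
    by (intro integrable_continuous_interval continuous_intros l)
  then have "((\<lambda>t. psi l t * cos (2 * pi * x * t)) has_integral integral {0..1} (\<lambda>t. psi l t * cos (2 * pi * x * t))) {0..1}"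
    by (rule integrable_integral)
  from has_integral_linear[OF has_integral_mult_right[OF this, of 2] bounded_linear_of_real[where 'a = complex]]
  have "((\<lambda>t. complex_of_real (2 * (psi l t * cos (2 * pi * x * t)))) has_integral
     of_real (2 * integral {0..1} (\<lambda>t. psi l t * cos (2 * pi * x * t)))) {0..1}"
    by (simp only: o_def)
  moreover have "complex_of_real (2 * (psi l t * cos (2 * pi * x * t)))
     = 2 * of_real (psi l t) * cos (2 * of_real pi * of_real x * of_real t)" for t
    by (simp add: cos_of_real[symmetric])
  ultimately show ?thesis unfolding transform_def by (intro integral_unique) (simp only:)
qed

lemma integrable_transform:
  assumes l: "0 < l"
  shows "integrable lborel (\<lambda>x. transform l (of_real x))"
proof -
  from psi_decay[OF l] obtain C where
    C: "\<forall>w. w \<noteq> 0 \<longrightarrow> \<bar>integral {0..1} (\<lambda>t. psi l t * cos (w * t))\<bar> \<le> C / w\<^sup>2" ..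
  define g where "g x = transform l (of_real x)" for x :: real
  have cont: "continuous_on UNIV g"
    unfolding g_def by (intro continuous_on_compose2[OF continuous_transform[OF l]] continuous_intros) simp
  have "bounded (g ` {-1..1})"
    by (intro compact_imp_bounded compact_continuous_image continuous_on_subset[OF cont]) simp_all
  then obtain B where B: "B > 0" "\<And>t. t \<in> {-1..1} \<Longrightarrow> norm (g t) \<le> B" by (auto simp: bounded_pos)
  have dec: "norm (g x) \<le> 2 * \<bar>C\<bar> / x\<^sup>2" if "x \<noteq> 0" for x
  proof -
    have w: "2 * pi * x \<noteq> 0" using that by simp
    have "norm (g x) = 2 * \<bar>integral {0..1} (\<lambda>t. psi l t * cos (2 * pi * x * t))\<bar>"
      unfolding g_def transform_of_real[OF l] norm_of_real by (simp add: abs_mult)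
    also have "\<dots> \<le> 2 * (C / (2 * pi * x)\<^sup>2)" using C w by (intro mult_left_mono) simp_all
    also have "C / (2 * pi * x)\<^sup>2 \<le> \<bar>C\<bar> / x\<^sup>2"
    proof (rule frac_le)
      have "1 \<le> (2 * pi)\<^sup>2" using pi_gt3 by (intro one_le_power) simp
      from mult_right_mono[OF this, of "x\<^sup>2"] show "x\<^sup>2 \<le> (2 * pi * x)\<^sup>2" by (simp add: power_mult_distrib)
    qed (use that in simp_all)
    finally show ?thesis by simp
  qed
  \<comment> \<open>One constant for both ranges: 1 \<le> 2 / (1 + x^2) for |x| \<le> 1, and 1 / x^2
    \<le> 2 / (1 + x^2) beyond.\<close>
  define K where "K = B + 2 * \<bar>C\<bar>"
  have K: "0 \<le> K" "B \<le> K" "2 * \<bar>C\<bar> \<le> K" using B(1) by (simp_all add: K_def)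
  have bound: "norm (g x) \<le> K * (2 * inverse (1 + x\<^sup>2))" for x
  proof -
    have p: "0 < 1 + x\<^sup>2" by (simp add: add_pos_nonneg)
    show ?thesis
    proof (cases "\<bar>x\<bar> \<le> 1")
      case True
      then have "x\<^sup>2 \<le> 1" by (simp add: abs_square_le_1)
      then have "1 \<le> 2 * inverse (1 + x\<^sup>2)" using p by (simp add: inverse_eq_divide le_divide_eq)
      then have "K * 1 \<le> K * (2 * inverse (1 + x\<^sup>2))" using K(1) by (rule mult_left_mono)
      moreover have "norm (g x) \<le> B" using B(2)[of x] True by (simp add: abs_le_iff)
      ultimately show ?thesis using K(2) by linarith
    next
      case False
      then have x: "x \<noteq> 0" "1 \<le> x\<^sup>2" using abs_square_le_1[of x] by auto
      then have "1 / x\<^sup>2 \<le> 2 * inverse (1 + x\<^sup>2)" using p by (simp add: inverse_eq_divide field_simps)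
      then have "K * (1 / x\<^sup>2) \<le> K * (2 * inverse (1 + x\<^sup>2))" using K(1) by (rule mult_left_mono)
      moreover have "2 * \<bar>C\<bar> / x\<^sup>2 \<le> K * (1 / x\<^sup>2)" using K(3) by (simp add: divide_right_mono)
      ultimately show ?thesis using dec[OF x(1)] by linarith
    qed
  qed
  have iq: "integrable lborel (\<lambda>x. K * (2 * inverse (1 + x\<^sup>2 :: real)))"
    using integrable_inverse_1_plus_square by (intro integrable_mult_right) (simp add: set_integrable_def)
  have "integrable lborel g"
  proof (rule Bochner_Integration.integrable_bound[OF iq])
    show "g \<in> borel_measurable lborel" using borel_measurable_continuous_onI[OF cont] by simp
    show "AE x in lborel. norm (g x) \<le> norm (K * (2 * inverse (1 + x\<^sup>2)))"
      unfolding real_norm_def by (intro AE_I2 order_trans[OF bound abs_ge_self])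
  qed
  then show ?thesis unfolding g_def .
qed

theorem M_hat_eq_phi:
  assumes l: "0 < l" and s: "\<bar>s\<bar> \<le> 1"
  shows "M_hat l s = of_real (phi l s)"
proof -
  \<comment> \<open>The cut-off by \<open>min\<close> is an extension by zero, as
    \<open>psi l 1\<close> = 0. This makes \<open>f\<close> even, continuous and compactly
    supported, so that its values up to |t| = 1 are recovered by inversion.\<close>
  define f where "f t = complex_of_real (psi l (min \<bar>t\<bar> 1))" for t
  have cf: "continuous_on S f" for S unfolding f_def by (intro continuous_intros l)
  have f0: "f t = 0" if "t \<notin> {-1..1}" for t
  proof -
    have "min \<bar>t\<bar> 1 = 1" using that by auto
    then show ?thesis by (simp add: f_def psi_def)
  qed
  have ind: "indicator {-1..1} t *\<^sub>R (f t * h t) = f t * h t" for t h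
    using f0[of t] by (simp split: split_indicator)
  have "set_integrable lborel {-1..1} f" by (rule borel_integrable_atLeastAtMost'[OF cf])
  then have intf: "integrable lborel f"
    using ind[of _ "\<lambda>_. 1"] by (simp add: set_integrable_def)
  have "bounded (f ` {-1..1})" by (intro compact_imp_bounded compact_continuous_image cf) simp
  then obtain B where B: "B > 0" "\<And>t. t \<in> {-1..1} \<Longrightarrow> norm (f t) \<le> B" by (auto simp: bounded_pos)
  have Bf: "norm (f t) \<le> B" for t using B(2)[of t] f0[of t] B(1) by (cases "t \<in> {-1..1}") auto
  have G: "M_fun l (of_real x) = (\<integral>t. f t * unit_exp (t * x) \<partial>lborel)" for x
  proof -
    define g where "g t = f t * unit_exp (t * x)" for t
    have cg: "continuous_on S g" for S unfolding g_def by (intro continuous_intros cf)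
    have ig: "g integrable_on {a..b}" for a b by (rule integrable_continuous_interval[OF cg])
    have "(\<integral>t. f t * unit_exp (t * x) \<partial>lborel) = (LINT t:{-1..1}|lborel. g t)"
      unfolding set_lebesgue_integral_def g_def ind[of _ "\<lambda>t. unit_exp (t * x)"] ..
    also have "\<dots> = integral {-1..1} g"
      by (rule set_borel_integral_eq_integral(2)[OF borel_integrable_atLeastAtMost'[OF cg]])
    also have "\<dots> = integral {-1..0} g + integral {0..1} g"
      by (rule Henstock_Kurzweil_Integration.integral_combine[symmetric]) (use ig in simp_all)
    also have "integral {-1..0} g = integral {0..1} (\<lambda>t. g (- t))"
      using Henstock_Kurzweil_Integration.integral_reflect_real[of 1 0 "\<lambda>t. g (- t)"] by simp
    also have "integral {0..1} (\<lambda>t. g (- t)) + integral {0..1} g = integral {0..1} (\<lambda>t. g (- t) + g t)"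
      by (rule Henstock_Kurzweil_Integration.integral_add[symmetric])
         (intro integrable_continuous_interval continuous_on_compose2[OF cg[of UNIV]] continuous_intros, simp, rule ig)
    also have "\<dots> = transform l (of_real x)"
      unfolding transform_def
    proof (rule integral_cong)
      fix t :: real assume t: "t \<in> {0..1}"
      have f: "f t = of_real (psi l t)" "f (- t) = of_real (psi l t)" using t by (simp_all add: f_def)
      have "unit_exp (- t * x) + unit_exp (t * x) = 2 * of_real (cos (2 * pi * x * t))"
        by (simp add: unit_exp_cis complex_eq_iff mult_ac)
      also have "\<dots> = 2 * cos (2 * of_real pi * of_real x * of_real t)" by (simp add: cos_of_real[symmetric])
      finally have e: "unit_exp (- t * x) + unit_exp (t * x) = 2 * cos (2 * of_real pi * of_real x * of_real t)" .
      show "g (- t) + g t = 2 * of_real (psi l t) * cos (2 * of_real pi * of_real x * of_real t)"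
        unfolding g_def f distrib_left[symmetric] e by simp
    qed
    finally show ?thesis by (simp only: M_fun_eq_transform[OF l])
  qed
  have "M_hat l s = f s"
    unfolding M_hat_def
    by (rule fourier_inversion[OF cf intf Bf G]) (use integrable_transform[OF l] in \<open>simp add: M_fun_eq_transform[OF l]\<close>)
  also have "\<dots> = of_real (phi l s)" using s by (simp add: f_def phi_eq_psi)
  finally show ?thesis .
qed

section \<open>The function p\<close>

text \<open>For x in [0, 1] the number x + m is nonnegative for m \<ge> 0 and nonpositive for m
  \<le> -1, so both halves of the sum are geometric.\<close>

lemma p_fun_has_sum:
  assumes l: "0 < l" and x: "0 \<le> x" "x \<le> 1"
  shows "((\<lambda>m. exp (- l * \<bar>x + of_int m\<bar>)) has_sum periodized l x) (UNIV :: int set)"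
proof -
  define f where "f m = exp (- l * \<bar>x + of_int m\<bar>)" for m :: int
  define r where "r = exp (- l)"
  define X where "X = exp (l * x)"
  have r: "0 < r" "r < 1" using l by (simp_all add: r_def)
  have X: "0 < X" by (simp add: X_def)
  have f0: "f 0 = 1 / X" using x by (simp add: f_def X_def exp_minus inverse_eq_divide)
  have rk: "r ^ k = exp (- (l * real k))" for k using exp_of_nat2_mult[of "- l" k] by (simp add: r_def)
  have fp: "f (int (Suc n)) = 1 / X * r ^ Suc n" for n
  proof -
    have "\<bar>x + of_int (int (Suc n))\<bar> = x + real (Suc n)" using x by simp
    then have "- l * \<bar>x + of_int (int (Suc n))\<bar> = - (l * x) + - (l * real (Suc n))"
      by (simp only: distrib_left minus_add_distrib mult_minus_left)
    then show ?thesis unfolding f_def rk X_def by (simp only: exp_add exp_minus inverse_eq_divide)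
  qed
  have fm: "f (- int (Suc n)) = X * r ^ Suc n" for n
  proof -
    have "\<bar>x + of_int (- int (Suc n))\<bar> = real (Suc n) - x" using x by simp
    then have "- l * \<bar>x + of_int (- int (Suc n))\<bar> = l * x + - (l * real (Suc n))"
      by (simp only: right_diff_distrib mult_minus_left)
    then show ?thesis unfolding f_def rk X_def by (simp only: exp_add)
  qed
  have gs: "(\<lambda>n. r ^ Suc n) sums (r * (1 / (1 - r)))"
    unfolding power_Suc using r by (intro sums_mult geometric_sums) simp
  have "summable (\<lambda>n. norm (f (int (Suc n))))" "summable (\<lambda>n. norm (f (- int (Suc n))))"
    unfolding fp fm using r X gs by (auto simp: abs_mult intro!: summable_mult sums_summable[OF gs, unfolded power_Suc])
  from has_sum_int[OF this]
  have "(f has_sum (f 0 + (\<Sum>n. f (int (Suc n)) + f (- int (Suc n))))) UNIV" .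
  also have "(\<Sum>n. f (int (Suc n)) + f (- int (Suc n))) = 1 / X * (r * (1 / (1 - r))) + X * (r * (1 / (1 - r)))"
    unfolding fp fm by (rule sums_unique[symmetric]) (intro sums_add sums_mult gs)
  also have "f 0 + \<dots> = periodized l x"
  proof -
    define h where "h = exp (l / 2)"
    have h: "1 < h" using l by (simp add: h_def)
    have rh: "r = 1 / h\<^sup>2"
      by (simp add: r_def h_def exp_minus inverse_eq_divide power2_eq_square exp_add[symmetric])
    have h2: "h\<^sup>2 - 1 > 0" using h by (simp add: power2_eq_square mult_strict_mono'[of 1 h 1 h, simplified])
    have a: "l * (x - 1 / 2) = l * x - l / 2" by (simp add: right_diff_distrib)
    have b: "- (l * x - l / 2) = l / 2 - l * x" by simp
    have "periodized l x = ((X / h + h / X) / 2) / ((h - 1 / h) / 2)"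
      unfolding periodized_def a cosh_field_def sinh_field_def b exp_diff X_def h_def exp_minus inverse_eq_divide ..
    also have "\<dots> = (X / h + h / X) / (h - 1 / h)"
    proof -
      have "(u / 2) / (v / 2) = u / v" for u v :: real by simp
      then show ?thesis .
    qed
    also have "\<dots> = (X + h\<^sup>2 / X) / (h\<^sup>2 - 1)"
    proof -
      have "X / h + h / X = (X + h\<^sup>2 / X) / h" "h - 1 / h = (h\<^sup>2 - 1) / h"
        using h X by (simp_all add: field_simps power2_eq_square)
      then show ?thesis using h by simp
    qed
    also have "\<dots> = 1 / X + (1 / X * (1 / (h\<^sup>2 - 1)) + X * (1 / (h\<^sup>2 - 1)))"
    proof -
      have "(X + (d + 1) / X) / d = 1 / X + (1 / X * (1 / d) + X * (1 / d))" if "d > 0" for d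
        using that X by (simp add: field_simps)
      from this[OF h2] show ?thesis by simp
    qed
    also have "1 / (h\<^sup>2 - 1) = r * (1 / (1 - r))" unfolding rh using h h2 by (simp add: field_simps)
    finally show ?thesis unfolding f0 by simp
  qed
  finally show ?thesis unfolding f_def .
qed

lemma p_fun_eq:
  assumes "0 < l" "0 \<le> x" "x \<le> 1"
  shows "p_fun l x = periodized l x - 2 / l"
  unfolding p_fun_def infsumI[OF p_fun_has_sum[OF assms]] by simp

lemma p_fun_periodic: "p_fun l (x + of_int k) = p_fun l x"
proof -
  have "bij_betw (\<lambda>m. m + k) UNIV (UNIV :: int set)"
    by (rule bij_betw_byWitness[where f' = "\<lambda>m. m - k"]) auto
  from infsum_reindex_bij_betw[OF this, of "\<lambda>m. exp (- l * \<bar>x + of_int m\<bar>)"]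
  show ?thesis unfolding p_fun_def by (simp add: add_ac)
qed

section \<open>Bounds of order min 1 l\<close>

lemma sinh_bounds:
  assumes "0 < (y :: real)"
  shows "y \<le> sinh y" "sinh y \<le> y * cosh y" "cosh y \<le> 1 + y * sinh y" "cosh y - 1 \<le> sinh y" "y * cosh y \<le> (1 + y) * sinh y"
proof -
  have mvt: "\<exists>c>0. c < y \<and> sinh y - sinh 0 = (y - 0) * cosh c" if "0 < y" for y :: real
    by (rule MVT2[OF that]) (auto intro!: derivative_eq_intros)
  have b: "y \<le> sinh y \<and> sinh y \<le> y * cosh y" if pos: "0 < y" for y :: real
  proof -
    obtain c where c: "0 < c" "c < y" "sinh y = y * cosh c" using mvt[OF pos] by auto
    have "1 \<le> cosh c" by (rule cosh_real_ge_1)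
    moreover have "cosh c \<le> cosh y" using c by (simp add: cosh_real_nonneg_le_iff)
    ultimately show ?thesis using pos unfolding c(3) by (simp add: mult_left_le mult_left_mono)
  qed
  show "y \<le> sinh y" "sinh y \<le> y * cosh y" using b[OF assms] by auto
  define z where "z = y / 2"
  have z: "0 < z" "y = 2 * z" using assms by (simp_all add: z_def)
  have e: "exp (- y) = cosh y - sinh y" by (simp add: cosh_minus_sinh)
  show "cosh y - 1 \<le> sinh y" using e assms exp_le_one_iff[of "- y"] by linarith
  have "cosh y - 1 = 2 * sinh z * sinh z"
    unfolding z(2) cosh_double using hyperbolic_pythagoras[of z] by (simp add: power2_eq_square)
  also have "\<dots> \<le> 2 * sinh z * (z * cosh z)" using b[OF z(1)] z by (intro mult_left_mono) auto
  also have "\<dots> \<le> y * sinh y" unfolding z(2) sinh_double using z by (simp add: mult_left_mono)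
  finally show "cosh y \<le> 1 + y * sinh y" by simp
  have "y * exp (- y) \<le> sinh y"
  proof -
    have "2 * y \<le> exp (2 * y) - 1" using exp_ge_add_one_self[of "2 * y"] by linarith
    from mult_right_mono[OF this, of "exp (- y)"]
    have "2 * y * exp (- y) \<le> (exp (2 * y) - 1) * exp (- y)" by simp
    also have "\<dots> = exp y - exp (- y)" by (simp add: left_diff_distrib exp_add[symmetric])
    also have "\<dots> = 2 * sinh y" by (simp add: sinh_field_def)
    finally show ?thesis by simp
  qed
  then have "y * (cosh y - sinh y) \<le> sinh y" unfolding e .
  then show "y * cosh y \<le> (1 + y) * sinh y" by (simp add: algebra_simps)
qed

text \<open>The quantity coth y - 1/y occurs twice: with y = l/2 it is the value of p at its peak x
  = 0, and with y = l/(2N+2), divided by N+1, it is the integrand of the zeroth coefficient of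
  h.\<close>

lemma coth_bounds:
  assumes y: "0 < y"
  shows "0 \<le> coth y - 1 / y" "coth y - 1 / y \<le> 1" "coth y - 1 / y \<le> y"
proof -
  note b = sinh_bounds[OF y]
  have s: "0 < sinh y" using y by simp
  have e: "coth y - 1 / y = (y * cosh y - sinh y) / (y * sinh y)" using y s by (simp add: coth_def field_simps)
  show "0 \<le> coth y - 1 / y" unfolding e using b(2) y s by simp
  have "y * cosh y - sinh y \<le> 1 * (y * sinh y)" using b(5) by (simp add: algebra_simps)
  then show "coth y - 1 / y \<le> 1" unfolding e using y s by (simp add: divide_le_eq)
  have "y * cosh y \<le> y * (1 + y * sinh y)" using b(3) y by (intro mult_left_mono) simp_all
  then have "y * cosh y - sinh y \<le> y * (y * sinh y)" using b(1) by (simp add: algebra_simps)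
  then show "coth y - 1 / y \<le> y" unfolding e using y s by (simp add: divide_le_eq)
qed

text \<open>With y = l/2, the function lies between its value 1/sinh y - 1/y at x = 1/2 and its
  value coth y - 1/y at the endpoints. Both are of order l near 0 and bounded by 1.\<close>

lemma p_fun_bound:
  assumes l: "0 < l" and x: "0 \<le> x" "x \<le> 1"
  shows "\<bar>p_fun l x\<bar> \<le> min 1 l"
proof -
  define y where "y = l / 2"
  have y: "0 < y" "2 / l = 1 / y" "y \<le> l" using l by (simp_all add: y_def)
  note b = sinh_bounds[OF y(1)]
  have s: "0 < sinh y" using y by simp
  have "\<bar>l * (x - 1 / 2)\<bar> \<le> \<bar>y\<bar>"
  proof -
    have "\<bar>x - 1 / 2\<bar> \<le> 1 / 2" using x by linarith
    then have "l * \<bar>x - 1 / 2\<bar> \<le> l * (1 / 2)" using l by (intro mult_left_mono) simp_all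
    then show ?thesis using l by (simp add: abs_mult y_def)
  qed
  then have "cosh (\<bar>l * (x - 1 / 2)\<bar>) \<le> cosh \<bar>y\<bar>" by (subst cosh_real_nonneg_le_iff) simp_all
  then have c: "cosh (l * (x - 1 / 2)) \<le> cosh y" "1 \<le> cosh (l * (x - 1 / 2))"
    by (simp_all add: cosh_real_abs cosh_real_ge_1)
  have "p_fun l x \<le> coth y - 1 / y"
    unfolding p_fun_eq[OF assms] periodized_def y(2) coth_def y_def[symmetric] using c s by (simp add: divide_right_mono)
  then have up: "p_fun l x \<le> min 1 l" using coth_bounds[OF y(1)] y(3) by linarith
  have "1 / y - 1 / sinh y = (sinh y - y) / (y * sinh y)" using y s by (simp add: field_simps)
  also have "\<dots> \<le> (y * cosh y - y) / (y * sinh y)" using b(2) y s by (intro divide_right_mono) simp_all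
  also have "\<dots> = (y * (cosh y - 1)) / (y * sinh y)" by (simp only: right_diff_distrib mult_1_right)
  also have "\<dots> = (cosh y - 1) / sinh y" using y(1) by simp
  finally have lo: "1 / y - 1 / sinh y \<le> (cosh y - 1) / sinh y" .
  have "(cosh y - 1) / sinh y \<le> 1" "(cosh y - 1) / sinh y \<le> y"
    using b(3,4) s by (simp_all add: divide_le_eq)
  moreover have "1 / sinh y - 1 / y \<le> p_fun l x"
    unfolding p_fun_eq[OF assms] periodized_def y(2) y_def[symmetric] using c s by (simp add: divide_right_mono)
  ultimately have "- min 1 l \<le> p_fun l x" using lo y(3) by linarith
  with up show ?thesis by linarith
qed

text \<open>Off the integers cos (2 pi t) stays below 1, so the denominator is at least (1 - c) cosh
  l, while the numerator is at most 2 min 1 l cosh l. The constant may depend on t, since only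
  finitely many t occur. At t = 0 there is no such bound: \<open>phi l 0\<close> = coth (l/2)
  behaves like 2/l.\<close>

lemma phi_bound:
  assumes t: "0 < \<bar>t\<bar>" "\<bar>t\<bar> < 1"
  shows "\<exists>C\<ge>0. \<forall>l>0. \<bar>phi l t\<bar> \<le> C * min 1 l"
proof -
  define c where "c = max 0 (cos (2 * pi * t))"
  have "(sin (pi * \<bar>t\<bar>))\<^sup>2 > 0" using sin_pi_times_pos[OF t] by simp
  then have "(sin (pi * t))\<^sup>2 > 0" by (cases "t \<ge> 0") simp_all
  then have "cos (2 * pi * t) < 1" using cos_double_sin[of "pi * t"] by (simp add: mult.assoc)
  then have c: "0 \<le> c" "c < 1" by (simp_all add: c_def)
  show ?thesis
  proof (intro exI[of _ "2 / (1 - c)"] conjI allI impI)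
    show "0 \<le> 2 / (1 - c)" using c by simp
    fix l :: real assume l: "0 < l"
    have C1: "1 \<le> cosh l" by (rule cosh_real_ge_1)
    have "(1 - c) * cosh l \<le> cosh l - cos (2 * pi * t)"
    proof -
      have "cos (2 * pi * t) \<le> c * 1" by (simp add: c_def)
      also have "\<dots> \<le> c * cosh l" using c C1 by (intro mult_left_mono) simp_all
      finally show ?thesis by (simp add: left_diff_distrib)
    qed
    moreover have "\<bar>(1 - \<bar>t\<bar>) * sinh l + l / (2 * pi) * sin (2 * pi * \<bar>t\<bar>)\<bar> \<le> 2 * (min 1 l * cosh l)"
    proof -
      have "\<bar>(1 - \<bar>t\<bar>) * sinh l\<bar> \<le> 1 * sinh l" unfolding abs_mult using t l by (intro mult_mono) simp_all
      moreover have "sinh l \<le> min 1 l * cosh l"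
        using sinh_bounds(2)[OF l] sinh_le_cosh_real[of l] by (simp add: min_def)
      moreover have "\<bar>l / (2 * pi) * sin (2 * pi * \<bar>t\<bar>)\<bar> \<le> l / (2 * pi) * 1"
        unfolding abs_mult using l by (intro mult_mono) auto
      moreover have "l / (2 * pi) * 1 \<le> l" using l pi_gt3 by (simp add: divide_le_eq mult_left_mono)
      moreover have "l \<le> min 1 l * cosh l"
      proof -
        have "l \<le> cosh l" using sinh_bounds(1)[OF l] sinh_le_cosh_real[of l] by linarith
        moreover have "l * 1 \<le> l * cosh l" using l C1 by (intro mult_left_mono) simp_all
        ultimately show ?thesis by (simp add: min_def)
      qed
      ultimately show ?thesis by linarith
    qed
    ultimately have "\<bar>phi l t\<bar> \<le> 2 * (min 1 l * cosh l) / ((1 - c) * cosh l)"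
      unfolding phi_def abs_divide using cosh_gt_cos[OF l, of "2 * pi * t"] c C1 l
      by (intro frac_le) simp_all
    also have "\<dots> = 2 / (1 - c) * min 1 l" using C1 by simp
    finally show "\<bar>phi l t\<bar> \<le> 2 / (1 - c) * min 1 l" .
  qed
qed

section \<open>Trigonometric polynomials\<close>

definition trig_sum :: "nat \<Rightarrow> (int \<Rightarrow> complex) \<Rightarrow> real \<Rightarrow> complex" where
  "trig_sum N c x = (\<Sum>n\<in>{- int N..int N}. c n * unit_exp (of_int n * x))"

lemma real_trig_poly_iff: "real_trig_poly N g \<longleftrightarrow> (\<exists>c. \<forall>x. of_real (g x) = trig_sum N c x)"
  by (simp add: real_trig_poly_def trig_sum_def)

lemma trig_sum_periodic: "trig_sum N c (x + of_int k) = trig_sum N c x"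
proof -
  have "unit_exp (of_int n * (x + of_int k)) = unit_exp (of_int n * x)" for n :: int
  proof -
    have "of_int n * (x + of_int k) = of_int n * x + of_int (n * k)" by (simp add: distrib_left)
    then show ?thesis by (simp only: unit_exp_add unit_exp_of_int mult_1_right)
  qed
  then show ?thesis by (simp add: trig_sum_def)
qed

lemma unit_exp_has_vector_derivative:
  "((\<lambda>x. unit_exp (of_int n * x)) has_vector_derivative 2 * pi * \<i> * of_int n * unit_exp (of_int n * x)) (at x within S)"
proof -
  have "((\<lambda>z. exp (2 * of_real pi * \<i> * (of_int n * z))) has_field_derivative
      exp (2 * of_real pi * \<i> * (of_int n * z)) * (2 * of_real pi * \<i> * of_int n)) (at z)" for z :: complex
    by (auto intro!: derivative_eq_intros)
  from has_vector_derivative_real_field[OF this[of "of_real x"], of S]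
  show ?thesis by (simp add: unit_exp_def mult_ac)
qed

lemma trig_sum_has_vector_derivative:
  "(trig_sum N c has_vector_derivative 2 * pi * \<i> * trig_sum N (\<lambda>n. of_int n * c n) x) (at x within S)"
proof -
  have "(trig_sum N c has_vector_derivative (\<Sum>n\<in>{- int N..int N}. c n * (2 * pi * \<i> * of_int n * unit_exp (of_int n * x)))) (at x within S)"
    unfolding trig_sum_def by (intro has_vector_derivative_sum has_vector_derivative_mult_right unit_exp_has_vector_derivative)
  moreover have "(\<Sum>n\<in>{- int N..int N}. c n * (2 * pi * \<i> * of_int n * unit_exp (of_int n * x)))
     = 2 * pi * \<i> * trig_sum N (\<lambda>n. of_int n * c n) x"
    unfolding trig_sum_def sum_distrib_left by (intro sum.cong refl) (simp add: mult_ac)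
  ultimately show ?thesis by (simp only:)
qed

lemma continuous_trig_sum: "continuous_on S (trig_sum N c)"
  unfolding trig_sum_def by (intro continuous_intros)

lemma real_trig_sum_derivative:
  assumes g: "\<And>x. of_real (g x) = trig_sum N c x"
  obtains g' where "(g has_real_derivative g') (at x)"
    "of_real g' = 2 * pi * \<i> * trig_sum N (\<lambda>n. of_int n * c n) x"
proof -
  define D where "D = 2 * pi * \<i> * trig_sum N (\<lambda>n. of_int n * c n) x"
  have "((\<lambda>x. complex_of_real (g x)) has_vector_derivative D) (at x)"
    unfolding g D_def by (rule trig_sum_has_vector_derivative)
  from bounded_linear.has_vector_derivative[OF bounded_linear_Re this]
    bounded_linear.has_vector_derivative[OF bounded_linear_Im this]
  have 1: "(g has_vector_derivative Re D) (at x)" and 2: "((\<lambda>x. 0 :: real) has_vector_derivative Im D) (at x)"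
    by simp_all
  have "Im D = 0" by (rule vector_derivative_unique_at[OF 2 has_vector_derivative_const])
  then have D: "of_real (Re D) = D" by (simp add: complex_eq_iff)
  have "(g has_real_derivative Re D) (at x)"
    using 1 by (simp add: has_real_derivative_iff_has_vector_derivative)
  then show thesis by (rule that) (simp only: D, simp only: D_def)
qed

lemma integral_unit_exp:
  "integral {0..1} (\<lambda>x. unit_exp (of_int n * x)) = (if n = 0 then 1 else 0)"
proof (cases "n = 0")
  case False
  define a where "a = 1 / (2 * of_real pi * \<i> * of_int n :: complex)"
  have a: "a * (2 * pi * \<i> * of_int n) = 1" using False by (simp add: a_def)
  have "((\<lambda>x. unit_exp (of_int n * x)) has_integral (a * unit_exp (of_int n * 1) - a * unit_exp (of_int n * 0))) {0..1}"
  proof (rule fundamental_theorem_of_calculus)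
    fix x :: real
    have "((\<lambda>x. a * unit_exp (of_int n * x)) has_vector_derivative a * (2 * pi * \<i> * of_int n * unit_exp (of_int n * x))) (at x within {0..1})"
      by (intro has_vector_derivative_mult_right unit_exp_has_vector_derivative)
    moreover have "a * (2 * pi * \<i> * of_int n * unit_exp (of_int n * x)) = unit_exp (of_int n * x)"
      using a by (simp only: mult.assoc[symmetric] mult_1_left)
    ultimately show "((\<lambda>x. a * unit_exp (of_int n * x)) has_vector_derivative unit_exp (of_int n * x)) (at x within {0..1})"
      by (simp only:)
  qed simp
  then show ?thesis using False by (simp add: integral_unique)
qed simp

lemma circle_integral_trig_sum:
  assumes g: "\<And>x. of_real (g x) = trig_sum N c x"
  shows "of_real (circle_integral g) = c 0"
proof -
  have cg: "continuous_on {0..1} g"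
  proof -
    have "continuous_on {0..1} (\<lambda>x. Re (trig_sum N c x))" by (intro continuous_intros continuous_trig_sum)
    then show ?thesis unfolding g[symmetric] by simp
  qed
  have "circle_integral g = integral {0..1} g"
    by (rule set_borel_integral_eq_integral(2)[OF borel_integrable_atLeastAtMost'[OF cg]])
  moreover have "((\<lambda>x. complex_of_real (g x)) has_integral of_real (integral {0..1} g)) {0..1}"
    using has_integral_linear[OF integrable_integral[OF integrable_continuous_interval[OF cg]] bounded_linear_of_real[where 'a = complex]]
    by (simp only: o_def)
  ultimately have "of_real (circle_integral g) = integral {0..1} (trig_sum N c)"
    unfolding g by (simp add: integral_unique)
  also have "\<dots> = (\<Sum>n\<in>{- int N..int N}. integral {0..1} (\<lambda>x. c n * unit_exp (of_int n * x)))"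
    unfolding trig_sum_def
    by (rule Henstock_Kurzweil_Integration.integral_sum) (auto intro!: integrable_continuous_interval continuous_intros)
  also have "\<dots> = (\<Sum>n\<in>{- int N..int N}. if n = 0 then c n else 0)"
    by (intro sum.cong refl) (simp add: integral_unit_exp)
  also have "\<dots> = c 0" by simp
  finally show ?thesis .
qed

text \<open>Among the frequencies from -N to N only 0 is a multiple of N+1, so the mean over the
  grid is exact for degree N.\<close>

lemma trig_sum_quadrature:
  "(\<Sum>j<Suc N. trig_sum N c (of_nat j / (real N + 1))) = of_nat (Suc N) * c 0"
proof -
  have e: "of_int n * (of_nat j / (real N + 1)) = of_int n * of_nat j / of_nat (Suc N)" for n :: int and j :: nat
    by (simp add: add.commute)
  have dvd: "int (Suc N) dvd n \<longleftrightarrow> n = 0" if "n \<in> {- int N..int N}" for n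
    using dvd_imp_le_int[of n "int (Suc N)"] that by fastforce
  have "(\<Sum>j<Suc N. trig_sum N c (of_nat j / (real N + 1)))
     = (\<Sum>n\<in>{- int N..int N}. c n * (\<Sum>j<Suc N. unit_exp (of_int n * of_nat j / of_nat (Suc N))))"
    unfolding trig_sum_def e by (subst sum.swap) (simp only: sum_distrib_left)
  also have "\<dots> = (\<Sum>n\<in>{- int N..int N}. if n = 0 then c n * of_nat (Suc N) else 0)"
    by (intro sum.cong refl) (simp add: sum_unit_exp_multiples[OF zero_less_Suc] dvd del: of_nat_Suc sum.lessThan_Suc)
  also have "\<dots> = of_nat (Suc N) * c 0" by (simp add: mult.commute)
  finally show ?thesis .
qed

lemma circle_integral_quadrature:
  assumes g: "\<And>x. of_real (g x) = trig_sum N c x"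
  shows "(\<Sum>j<Suc N. g (of_nat j / (real N + 1))) = (real N + 1) * circle_integral g"
proof -
  have "complex_of_real (\<Sum>j<Suc N. g (of_nat j / (real N + 1))) = of_nat (Suc N) * c 0"
    unfolding of_real_sum g by (rule trig_sum_quadrature)
  also have "\<dots> = of_real ((real N + 1) * circle_integral g)"
    unfolding of_real_mult circle_integral_trig_sum[OF g] by simp
  finally show ?thesis by (simp only: of_real_eq_iff)
qed

text \<open>By discrete Fourier inversion the values give \<open>d n + d (n - N - 1) = 0\<close>, and the derivatives
  give \<open>n d n + (n - N - 1) d (n - N - 1) = S / (N + 1)\<close> with an unknown \<open>S\<close>, the derivative at the
  simple zero 0; the equation for \<open>n = 0\<close> forces \<open>S = 0\<close>.\<close>

theorem trig_sum_double_zeros: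
  assumes z: "\<And>j. j < Suc N \<Longrightarrow> trig_sum N d (of_nat j / (real N + 1)) = 0"
    and z': "\<And>j. 0 < j \<Longrightarrow> j < Suc N \<Longrightarrow> trig_sum N (\<lambda>n. of_int n * d n) (of_nat j / (real N + 1)) = 0"
    and n: "n \<in> {- int N..int N}"
  shows "d n = 0"
proof -
  let ?L = "Suc N"
  have e: "of_nat n * (of_nat j / (real N + 1)) = 1 * (of_nat n * of_nat j / of_nat (Suc N))" for n j
    by (simp add: add.commute)
  have fold: "trig_sum N a (of_nat j / (real N + 1)) = (\<Sum>n<?L. (a (int n) + (if n = 0 then 0 else a (int n - int ?L)))
      * unit_exp (1 * (of_nat n * of_nat j / of_nat ?L)))" for a j
    using sum_symmetric_fold[of a "int j" N] unfolding of_int_of_nat_eq e trig_sum_def .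
  have inv: "of_nat ?L * (a (int m) + (if m = 0 then 0 else a (int m - int ?L)))
     = (\<Sum>j<?L. trig_sum N a (of_nat j / (real N + 1)) * unit_exp (- 1 * (of_nat m * of_nat j / of_nat ?L)))" if "m < ?L" for a m
    unfolding fold by (rule discrete_fourier_inversion[OF that, symmetric]) simp
  have A: "d (int m) + (if m = 0 then 0 else d (int m - int ?L)) = 0" if "m < ?L" for m
    using inv[OF that, of d] z by (simp del: of_nat_Suc sum.lessThan_Suc)
  define S where "S = trig_sum N (\<lambda>n. of_int n * d n) 0"
  have B: "of_nat ?L * (of_int (int m) * d (int m) + (if m = 0 then 0 else of_int (int m - int ?L) * d (int m - int ?L))) = S"
    if "m < ?L" for m
  proof -
    have "(\<Sum>j<?L. trig_sum N (\<lambda>n. of_int n * d n) (of_nat j / (real N + 1)) * unit_exp (- 1 * (of_nat m * of_nat j / of_nat ?L)))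
      = (\<Sum>j\<in>{0}. trig_sum N (\<lambda>n. of_int n * d n) (of_nat j / (real N + 1)) * unit_exp (- 1 * (of_nat m * of_nat j / of_nat ?L)))"
      by (rule sum.mono_neutral_right) (use z' in auto)
    also have "\<dots> = S" by (simp add: S_def)
    finally show ?thesis by (rule trans[OF inv[OF that, of "\<lambda>n. of_int n * d n"]])
  qed
  have S0: "S = 0" using B[of 0] by simp
  have pos: "d (int m) = 0 \<and> d (int m - int ?L) = 0" if m: "0 < m" "m < ?L" for m
  proof -
    \<comment> \<open>With opposite coefficients the derivative equation becomes (m - (m - (N+1))) d
      m = 0.\<close>
    have a: "d (int m - int ?L) = - d (int m)" using A[OF m(2)] m(1) by (simp add: add_eq_0_iff)
    have "of_int (int m) * d (int m) + of_int (int m - int ?L) * d (int m - int ?L) = 0"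
      using B[OF m(2)] m(1) S0 by (simp del: of_nat_Suc of_int_diff)
    then have "of_nat ?L * d (int m) = 0" unfolding a by (simp add: algebra_simps)
    then show ?thesis using a by (simp del: of_nat_Suc)
  qed
  consider "n = 0" | "0 < n" | "n < 0" by linarith
  then show ?thesis
  proof cases
    case 1
    then show ?thesis using A[of 0] by simp
  next
    case 2
    then show ?thesis using pos[of "nat n"] n by simp
  next
    case 3
    then show ?thesis using pos[of "nat (n + int ?L)"] n by simp
  qed
qed

section \<open>Integration over the parameter\<close>

lemma measurable_sinh_cosh [measurable]:
  "(sinh :: real \<Rightarrow> real) \<in> borel_measurable borel" "(cosh :: real \<Rightarrow> real) \<in> borel_measurable borel"
  by (intro borel_measurable_continuous_onI continuous_intros)+

text \<open>The sum of the tangent inequalities of exp at b and at -b.\<close>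

lemma cosh_ge_tangent: "cosh b + (a - b) * sinh b \<le> cosh (a :: real)"
proof -
  have e: "exp v * (1 + (u - v)) \<le> exp u" for u v :: real
  proof -
    have "exp v * (1 + (u - v)) \<le> exp v * exp (u - v)" using exp_ge_add_one_self[of "u - v"] by (intro mult_left_mono) simp_all
    then show ?thesis by (simp add: exp_add[symmetric])
  qed
  have "2 * (cosh b + (a - b) * sinh b) = exp b * (1 + (a - b)) + exp (- b) * (1 + (- a - - b))"
    unfolding cosh_field_def sinh_field_def by (simp add: field_simps)
  also have "\<dots> \<le> exp a + exp (- a)" using e[of b a] e[of "- b" "- a"] by simp
  also have "\<dots> = 2 * cosh a" by (simp add: cosh_field_def)
  finally show ?thesis by simp
qed

lemma periodized_ge_tangent:
  assumes "0 < l"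
  shows "periodized l y + (x - y) * (l * sinh (l * (y - 1 / 2)) / sinh (l / 2)) \<le> periodized l x"
proof -
  have "cosh (l * (y - 1 / 2)) + (l * (x - 1 / 2) - l * (y - 1 / 2)) * sinh (l * (y - 1 / 2)) \<le> cosh (l * (x - 1 / 2))"
    by (rule cosh_ge_tangent)
  from divide_right_mono[OF this, of "sinh (l / 2)"] assms show ?thesis
    by (simp add: periodized_def add_divide_distrib right_diff_distrib left_diff_distrib mult_ac)
qed

text \<open>The subtraction of the mean 2/l is built into the zeroth coefficient because neither
  part need be integrable near l = 0 on its own.\<close>

definition reduced_coeff :: "nat \<Rightarrow> int \<Rightarrow> real \<Rightarrow> real" where
  "reduced_coeff N n l = interp_coeff N l n - (if n = 0 then 2 / l else 0)"

lemma reduced_coeff_0: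
  assumes l: "0 < l"
  shows "reduced_coeff N 0 l = 1 / (real N + 1) * coth (l / (2 * real N + 2)) - 2 / l"
proof -
  define y where "y = l / (2 * real N + 2)"
  have p: "0 < 2 * real N + 2" by simp
  have y: "0 < y" "l / (real N + 1) = 2 * y" using l p by (simp_all add: y_def field_simps)
  have s: "sinh y \<noteq> 0" using y by simp
  have "cosh (2 * y) - 1 = 2 * (sinh y * sinh y)"
    unfolding cosh_double using hyperbolic_pythagoras[of y] by (simp add: power2_eq_square)
  moreover have "sinh (2 * y) = 2 * sinh y * cosh y" by (rule sinh_double)
  ultimately have "poisson (2 * y) 0 = coth y" unfolding poisson_def coth_def using s by simp
  then show ?thesis unfolding reduced_coeff_def interp_coeff_def y(2) y_def[symmetric] by (simp add: phi_0)
qed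

lemma reduced_coeff_bound:
  assumes n: "n \<in> {- int N..int N}"
  shows "\<exists>C\<ge>0. \<forall>l>0. \<bar>reduced_coeff N n l\<bar> \<le> C * min 1 l"
proof (cases "n = 0")
  case True
  show ?thesis
  proof (intro exI[of _ 1] conjI allI impI)
    fix l :: real assume l: "0 < l"
    define y where "y = l / (2 * real N + 2)"
    have p: "0 < 2 * real N + 2" by simp
    have y: "0 < y" "y \<le> l" using l p mult_left_mono[of 1 "2 * real N + 2" l] by (simp_all add: y_def divide_le_eq)
    \<comment> \<open>For this y the mean 2/l is exactly (1/y) / (N+1), so the poles at l = 0 cancel
      and (coth y - 1/y) / (N+1) is left.\<close>
    have "1 / y = (real N + 1) * (2 / l)" by (simp add: y_def algebra_simps add_divide_distrib)
    moreover have "z = 1 / (real N + 1) * ((real N + 1) * z)" for z by simp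
    ultimately have "2 / l = 1 / (real N + 1) * (1 / y)" by (simp only:)
    then have "reduced_coeff N n l = 1 / (real N + 1) * (coth y - 1 / y)"
      unfolding True reduced_coeff_0[OF l] y_def[symmetric] right_diff_distrib by (simp only:)
    also have "\<bar>\<dots>\<bar> \<le> 1 * (coth y - 1 / y)"
      unfolding abs_mult using coth_bounds(1)[OF y(1)] by (intro mult_mono) simp_all
    also have "\<dots> \<le> 1 * min 1 l" using coth_bounds(2,3)[OF y(1)] y(2) by simp
    finally show "\<bar>reduced_coeff N n l\<bar> \<le> 1 * min 1 l" .
  qed simp
next
  case False
  define t where "t = of_int n / (real N + 1)"
  have "\<bar>real_of_int n\<bar> \<le> real N" using n by (simp add: abs_le_iff)
  then have t: "0 < \<bar>t\<bar>" "\<bar>t\<bar> < 1" using False by (simp_all add: t_def)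
  from phi_bound[OF t] obtain C where C: "C \<ge> 0 \<and> (\<forall>l>0. \<bar>phi l t\<bar> \<le> C * min 1 l)" ..
  show ?thesis
  proof (intro exI[of _ C] conjI allI impI)
    show "0 \<le> C" using C by simp
    fix l :: real assume l: "0 < l"
    have k: "0 < l / (real N + 1)" "l / (real N + 1) \<le> l"
      using l mult_left_mono[of 1 "real N + 1" l] by (simp_all add: divide_le_eq)
    have "\<bar>reduced_coeff N n l\<bar> = \<bar>phi (l / (real N + 1)) t\<bar> / (real N + 1)"
      using False by (simp add: reduced_coeff_def interp_coeff_def t_def)
    also have "\<dots> \<le> \<bar>phi (l / (real N + 1)) t\<bar>" by (simp add: divide_le_eq mult_left_le_one_le mult_le_cancel_left1)
    also have "\<dots> \<le> C * min 1 (l / (real N + 1))" using C k(1) by blast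
    also have "\<dots> \<le> C * min 1 l" using C k(2) by (intro mult_left_mono) auto
    finally show "\<bar>reduced_coeff N n l\<bar> \<le> C * min 1 l" .
  qed
qed

lemma measurable_reduced_coeff [measurable]: "reduced_coeff N n \<in> borel_measurable borel"
  unfolding reduced_coeff_def interp_coeff_def phi_def by measurable

lemma measurable_periodized [measurable]: "(\<lambda>l. periodized l x) \<in> borel_measurable borel"
  unfolding periodized_def by measurable

lemma interp_eq_reduced:
  "interp N l x - 2 / l = (\<Sum>n\<in>{- int N..int N}. reduced_coeff N n l * cos (2 * pi * (of_int n * x)))"
proof -
  have "(\<Sum>n\<in>{- int N..int N}. reduced_coeff N n l * cos (2 * pi * (of_int n * x)))
     = interp N l x - (\<Sum>n\<in>{- int N..int N}. (if n = 0 then 2 / l else 0) * cos (2 * pi * (of_int n * x)))"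
    unfolding reduced_coeff_def interp_def left_diff_distrib sum_subtractf ..
  also have "(\<Sum>n\<in>{- int N..int N}. (if n = 0 then 2 / l else 0) * cos (2 * pi * (of_int n * x)))
     = (\<Sum>n\<in>{- int N..int N}. if n = 0 then 2 / l else 0)"
    by (intro sum.cong refl) simp
  also have "\<dots> = 2 / l" by simp
  finally show ?thesis by simp
qed

lemma interp_deriv_eq_reduced:
  "interp_deriv N l x = (\<Sum>n\<in>{- int N..int N}. reduced_coeff N n l * (- (2 * pi * of_int n) * sin (2 * pi * (of_int n * x))))"
  unfolding interp_deriv_def reduced_coeff_def by (intro sum.cong refl) simp

text \<open>Links the size min 1 l of all integrands to the weight l / (l + 1) in the hypothesis on
  the measure.\<close>

lemma min_1_le: "0 < (l :: real) \<Longrightarrow> min 1 l \<le> 2 * (l / (l + 1))"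
  by (cases "l \<le> 1") (simp_all add: le_divide_eq mult_le_one distrib_left)

section \<open>The majorant of a fixed measure and its extremality\<close>

locale majorant_measure =
  fixes \<mu> :: "real measure" and N :: nat
  assumes sets_mu: "sets \<mu> = sets (restrict_space borel {0<..})"
    and finite_mu: "(\<integral>\<^sup>+ l. ennreal (l / (l + 1)) \<partial>\<mu>) < \<infinity>"
begin

lemma space_mu: "space \<mu> = {0<..}"
  using sets_eq_imp_space_eq[OF sets_mu] by (simp add: space_restrict_space)

lemma measurable_mu: "f \<in> borel_measurable borel \<Longrightarrow> f \<in> borel_measurable \<mu>"
  unfolding measurable_cong_sets[OF sets_mu refl] by (rule measurable_restrict_space1)

lemma integrable_mu:
  fixes f :: "real \<Rightarrow> real"
  assumes f: "f \<in> borel_measurable borel" and b: "\<And>l. 0 < l \<Longrightarrow> \<bar>f l\<bar> \<le> C * min 1 l" and C: "0 \<le> C"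
  shows "integrable \<mu> f"
proof (rule Bochner_Integration.integrable_bound)
  have "(\<lambda>l :: real. l / (l + 1)) \<in> borel_measurable borel" by measurable
  then have "integrable \<mu> (\<lambda>l. l / (l + 1))"
    using finite_mu by (intro integrableI_nonneg measurable_mu AE_I2) (simp_all add: space_mu)
  then show "integrable \<mu> (\<lambda>l. C * (2 * (l / (l + 1))))" by (intro integrable_mult_right)
  show "f \<in> borel_measurable \<mu>" by (rule measurable_mu[OF f])
  show "AE l in \<mu>. norm (f l) \<le> norm (C * (2 * (l / (l + 1))))"
  proof (rule AE_I2)
    fix l assume "l \<in> space \<mu>"
    then have l: "0 < l" by (simp add: space_mu)
    have "\<bar>f l\<bar> \<le> C * min 1 l" by (rule b[OF l])
    also have "\<dots> \<le> C * (2 * (l / (l + 1)))" by (rule mult_left_mono[OF min_1_le[OF l] C])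
    finally show "norm (f l) \<le> norm (C * (2 * (l / (l + 1))))"
      unfolding real_norm_def by (rule order_trans[OF _ abs_ge_self])
  qed
qed

lemma integrable_reduced_coeff:
  assumes "n \<in> {- int N..int N}"
  shows "integrable \<mu> (reduced_coeff N n)"
proof -
  from reduced_coeff_bound[OF assms] obtain C where "C \<ge> 0 \<and> (\<forall>l>0. \<bar>reduced_coeff N n l\<bar> \<le> C * min 1 l)" ..
  then show ?thesis by (intro integrable_mu[of _ C]) auto
qed

definition H :: "int \<Rightarrow> real" where "H n = (\<integral>l. reduced_coeff N n l \<partial>\<mu>)"

definition h :: "real \<Rightarrow> real" where
  "h x = (\<Sum>n\<in>{- int N..int N}. H n * cos (2 * pi * (of_int n * x)))"

definition h_deriv :: "real \<Rightarrow> real" where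
  "h_deriv x = (\<Sum>n\<in>{- int N..int N}. H n * (- (2 * pi * of_int n) * sin (2 * pi * (of_int n * x))))"

text \<open>For n different from 0 the argument n/(N+1) lies in [-1, 1], where \<open>M_hat\<close>
  has its closed form; for n = 0 the coth expression is the reduced coefficient itself.\<close>

lemma h_hat_eq:
  assumes n: "n \<in> {- int N..int N}"
  shows "h_hat \<mu> N n = of_real (H n)"
proof (cases "n = 0")
  case True
  have "(\<integral>l. 1 / (real N + 1) * coth (l / (2 * real N + 2)) - 2 / l \<partial>\<mu>) = (\<integral>l. reduced_coeff N 0 l \<partial>\<mu>)"
    by (intro Bochner_Integration.integral_cong refl) (simp add: space_mu reduced_coeff_0)
  then show ?thesis using True by (simp add: h_hat_def H_def)
next
  case False
  have "\<bar>real_of_int n\<bar> \<le> real N" using n by (simp add: abs_le_iff)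
  then have t: "\<bar>of_int n / (real N + 1)\<bar> \<le> 1" by simp
  have "(\<integral>l. M_hat (l / (real N + 1)) (of_int n / (real N + 1)) \<partial>\<mu>) = (\<integral>l. of_real ((real N + 1) * reduced_coeff N n l) \<partial>\<mu>)"
  proof (intro Bochner_Integration.integral_cong refl)
    fix l assume "l \<in> space \<mu>"
    then have "0 < l / (real N + 1)" by (simp add: space_mu)
    from M_hat_eq_phi[OF this t]
    show "M_hat (l / (real N + 1)) (of_int n / (real N + 1)) = of_real ((real N + 1) * reduced_coeff N n l)"
      using False by (simp add: reduced_coeff_def interp_coeff_def)
  qed
  also have "\<dots> = of_real ((real N + 1) * H n)"
    unfolding H_def by (subst integral_complex_of_real) simp
  finally show ?thesis
    using False of_nat_neq_0[of N, where 'a = complex] by (simp add: h_hat_def add.commute)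
qed

lemma h_fun_trig_sum: "h_fun \<mu> N x = trig_sum N (\<lambda>n. of_real (H n)) x"
  unfolding h_fun_def trig_sum_def by (intro sum.cong refl) (simp add: h_hat_eq)

lemma of_real_h: "of_real (h x) = trig_sum N (\<lambda>n. of_real (H n)) x"
proof (rule complex_eqI)
  have "H (- n) = H n" for n by (simp add: H_def reduced_coeff_def)
  then show "Im (of_real (h x)) = Im (trig_sum N (\<lambda>n. of_real (H n)) x)"
    using sum_odd_symmetric[of "\<lambda>n. H n * sin (2 * pi * (of_int n * x))" N]
    by (simp add: trig_sum_def unit_exp_cis)
qed (simp add: h_def trig_sum_def unit_exp_cis)

lemma h_fun_eq: "h_fun \<mu> N x = of_real (h x)"
  by (simp only: h_fun_trig_sum of_real_h)

lemma h_has_derivative: "(h has_real_derivative h_deriv x) (at x)"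
  unfolding h_def[abs_def] h_deriv_def
  by (intro DERIV_sum DERIV_cmult) (auto intro!: derivative_eq_intros)

lemma
  shows integrable_interp: "integrable \<mu> (\<lambda>l. interp N l x - 2 / l)"
    and integral_interp: "(\<integral>l. interp N l x - 2 / l \<partial>\<mu>) = h x"
    and integrable_interp_deriv: "integrable \<mu> (\<lambda>l. interp_deriv N l x)"
    and integral_interp_deriv: "(\<integral>l. interp_deriv N l x \<partial>\<mu>) = h_deriv x"
  unfolding interp_eq_reduced interp_deriv_eq_reduced h_def h_deriv_def H_def
  by (auto intro!: Bochner_Integration.integrable_sum integrable_mult_left integrable_reduced_coeff sum.cong
      simp: Bochner_Integration.integral_sum integrable_reduced_coeff)

lemma
  assumes x: "0 \<le> x" "x \<le> 1"
  shows integrable_periodized: "integrable \<mu> (\<lambda>l. periodized l x - 2 / l)"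
    and q_fun_eq: "q_fun \<mu> x = (\<integral>l. periodized l x - 2 / l \<partial>\<mu>)"
proof -
  show "integrable \<mu> (\<lambda>l. periodized l x - 2 / l)"
  proof (rule integrable_mu[of _ 1])
    show "(\<lambda>l. periodized l x - 2 / l) \<in> borel_measurable borel" by measurable
    show "\<bar>periodized l x - 2 / l\<bar> \<le> 1 * min 1 l" if "0 < l" for l
      using p_fun_bound[OF that x] unfolding p_fun_eq[OF that x] by simp
  qed simp
  show "q_fun \<mu> x = (\<integral>l. periodized l x - 2 / l \<partial>\<mu>)"
    unfolding q_fun_def by (intro Bochner_Integration.integral_cong refl) (simp add: space_mu p_fun_eq x)
qed

lemma q_fun_le_h_unit:
  assumes x: "0 \<le> x" "x \<le> 1"
  shows "q_fun \<mu> x \<le> h x"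
  unfolding q_fun_eq[OF x] integral_interp[symmetric]
  by (intro integral_mono_AE integrable_periodized x integrable_interp AE_I2)
     (simp add: space_mu periodized_le_interp x)

lemma q_fun_le_h: "q_fun \<mu> x \<le> h x"
proof -
  define k where "k = \<lfloor>x\<rfloor>"
  define y where "y = x - of_int k"
  have y: "x = y + of_int k" "0 \<le> y" "y \<le> 1" unfolding y_def k_def by linarith+
  have "q_fun \<mu> x = q_fun \<mu> y" unfolding q_fun_def y(1) p_fun_periodic ..
  moreover have "complex_of_real (h x) = of_real (h y)" unfolding of_real_h y(1) by (rule trig_sum_periodic)
  ultimately show ?thesis using q_fun_le_h_unit[OF y(2,3)] by simp
qed

lemma node_unit: "j \<le> Suc N \<Longrightarrow> 0 \<le> real j / (real N + 1) \<and> real j / (real N + 1) \<le> 1"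
  by (simp add: divide_le_eq)

lemma q_fun_node:
  assumes "j \<le> Suc N"
  shows "q_fun \<mu> (real j / (real N + 1)) = h (real j / (real N + 1))"
proof -
  have x: "0 \<le> real j / (real N + 1)" "real j / (real N + 1) \<le> 1" using node_unit[OF assms] by simp_all
  show ?thesis
    unfolding q_fun_eq[OF x] integral_interp[symmetric]
    by (intro Bochner_Integration.integral_cong refl) (simp add: space_mu interp_node assms)
qed

text \<open>Convexity of \<open>p(l, x)\<close> on \<open>[0, 1]\<close> replaces differentiation of \<open>q\<close> under the integral sign.\<close>

lemma q_fun_ge_tangent:
  assumes j: "0 < j" "j < Suc N" and x: "0 \<le> x" "x \<le> 1"
  defines "y \<equiv> real j / (real N + 1)"
  shows "h y + (x - y) * h_deriv y \<le> q_fun \<mu> x"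
proof -
  have "h y + (x - y) * h_deriv y = (\<integral>l. (interp N l y - 2 / l) + (x - y) * interp_deriv N l y \<partial>\<mu>)"
    unfolding integral_interp[symmetric] integral_interp_deriv[symmetric]
    by (simp add: integrable_interp integrable_interp_deriv)
  also have "\<dots> \<le> (\<integral>l. periodized l x - 2 / l \<partial>\<mu>)"
  proof (intro integral_mono_AE AE_I2)
    show "integrable \<mu> (\<lambda>l. (interp N l y - 2 / l) + (x - y) * interp_deriv N l y)"
      by (intro Bochner_Integration.integrable_add integrable_mult_right integrable_interp integrable_interp_deriv)
    show "integrable \<mu> (\<lambda>l. periodized l x - 2 / l)" by (rule integrable_periodized[OF x])
    fix l assume "l \<in> space \<mu>"
    then have l: "0 < l" by (simp add: space_mu)
    show "(interp N l y - 2 / l) + (x - y) * interp_deriv N l y \<le> periodized l x - 2 / l"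
      using periodized_ge_tangent[OF l, of y x] interp_node[OF l, of j N] interp_deriv_node[OF l j] j
      unfolding y_def by simp
  qed
  finally show ?thesis unfolding q_fun_eq[OF x] .
qed

text \<open>The integral of a polynomial of degree N is its mean over the grid, and on the grid h
  equals q, which lies below g. Equality of the integrals makes every nonnegative difference g - h
  on the grid vanish; comparison with tangent lines below q then gives equal derivatives at the
  inner nodes, and the difference of the coefficient families has the zeros required by
  \<open>trig_sum_double_zeros\<close>.\<close>

lemma extremal:
  assumes g: "\<And>x. of_real (g x) = trig_sum N c x" and maj: "\<And>x. q_fun \<mu> x \<le> g x"
  shows "circle_integral h \<le> circle_integral g"
    and "circle_integral h = circle_integral g \<Longrightarrow> g x = h x"
proof -
  let ?x = "\<lambda>j. real j / (real N + 1)"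
  have node: "h (?x j) \<le> g (?x j)" if "j < Suc N" for j
    using maj[of "?x j"] q_fun_node[of j] that by simp
  have le: "(\<Sum>j<Suc N. h (?x j)) \<le> (\<Sum>j<Suc N. g (?x j))"
    by (intro sum_mono node) simp
  then have "(real N + 1) * circle_integral h \<le> (real N + 1) * circle_integral g"
    unfolding circle_integral_quadrature[OF of_real_h] circle_integral_quadrature[OF g] .
  then show "circle_integral h \<le> circle_integral g" by (rule mult_left_le_imp_le) simp
  assume eq: "circle_integral h = circle_integral g"
  have "(\<Sum>j<Suc N. g (?x j) - h (?x j)) = 0"
    unfolding sum_subtractf circle_integral_quadrature[OF of_real_h] circle_integral_quadrature[OF g] eq by simp
  then have "\<forall>j\<in>{..<Suc N}. g (?x j) - h (?x j) = 0"
    by (subst (asm) sum_nonneg_eq_0_iff) (use node in auto)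
  then have gh: "g (?x j) = h (?x j)" if "j < Suc N" for j using that by simp
  define d where "d n = c n - of_real (H n)" for n
  have td: "trig_sum N (\<lambda>n. a n * d n) y = trig_sum N (\<lambda>n. a n * c n) y - trig_sum N (\<lambda>n. a n * of_real (H n)) y" for a y
    unfolding trig_sum_def d_def by (simp add: right_diff_distrib left_diff_distrib sum_subtractf)
  have d0: "d n = 0" if n: "n \<in> {- int N..int N}" for n
  proof (rule trig_sum_double_zeros[OF _ _ n])
    fix j assume j: "j < Suc N"
    show "trig_sum N d (?x j) = 0"
      using td[of "\<lambda>_. 1" "?x j"] g[of "?x j"] of_real_h[of "?x j"] gh[OF j] by simp
  next
    fix j assume j: "0 < j" "j < Suc N"
    obtain g' where g': "(g has_real_derivative g') (at (?x j))"
      "of_real g' = 2 * pi * \<i> * trig_sum N (\<lambda>n. of_int n * c n) (?x j)"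
      by (rule real_trig_sum_derivative[OF g])
    obtain h' where h': "(h has_real_derivative h') (at (?x j))"
      "of_real h' = 2 * pi * \<i> * trig_sum N (\<lambda>n. of_int n * of_real (H n)) (?x j)"
      by (rule real_trig_sum_derivative[OF of_real_h])
    have h'_eq: "h' = h_deriv (?x j)" by (rule DERIV_unique[OF h'(1) h_has_derivative])
    have y: "0 < ?x j" "?x j < 1" using j by simp_all
    \<comment> \<open>This radius keeps x in [0, 1], where the tangent line is known to lie below
      q.\<close>
    define e where "e = min (?x j) (1 - ?x j)"
    have e: "0 < e" using y by (simp add: e_def)
    \<comment> \<open>Near the node g \<ge> q and q lies above the tangent line of h, with equality
      at the node. So g minus this line has a local minimum there, which forces the slopes to
      agree.\<close>
    have "((\<lambda>x. g x - (h (?x j) + (x - ?x j) * h_deriv (?x j))) has_real_derivative g' - (0 + ((1 - 0) * h_deriv (?x j)))) (at (?x j))"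
      by (intro DERIV_diff g' DERIV_add DERIV_const DERIV_cmult_right DERIV_ident)
    then have "g' - (0 + ((1 - 0) * h_deriv (?x j))) = 0"
    proof (rule DERIV_local_min[OF _ e], intro allI impI)
      fix x assume x: "\<bar>?x j - x\<bar> < e"
      then have "0 \<le> x" "x \<le> 1" unfolding e_def by linarith+
      then show "g (?x j) - (h (?x j) + (?x j - ?x j) * h_deriv (?x j)) \<le> g x - (h (?x j) + (x - ?x j) * h_deriv (?x j))"
        using q_fun_ge_tangent[OF j, of x] maj[of x] gh[OF j(2)] by simp
    qed
    then have "g' = h'" unfolding h'_eq by simp
    then have "2 * pi * \<i> * trig_sum N (\<lambda>n. of_int n * c n) (?x j) = 2 * pi * \<i> * trig_sum N (\<lambda>n. of_int n * of_real (H n)) (?x j)"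
      unfolding g'(2)[symmetric] h'(2)[symmetric] by simp
    then show "trig_sum N (\<lambda>n. of_int n * d n) (?x j) = 0"
      unfolding td by simp
  qed
  have "trig_sum N c x = trig_sum N (\<lambda>n. of_real (H n)) x"
    unfolding trig_sum_def using d0 by (intro sum.cong refl) (simp add: d_def)
  then have "complex_of_real (g x) = of_real (h x)" unfolding g of_real_h .
  then show "g x = h x" by simp
qed

end

theorem theorem6p4:
  fixes \<mu> :: "real measure" and N :: nat
  assumes "sets \<mu> = sets (restrict_space borel {0<..})"
    and "0 < (\<integral>\<^sup>+ l. ennreal (l / (l + 1)) \<partial>\<mu>)"
    and "(\<integral>\<^sup>+ l. ennreal (l / (l + 1)) \<partial>\<mu>) < \<infinity>"
  shows "(\<forall>x. h_fun \<mu> N x \<in> \<real> \<and> q_fun \<mu> x \<le> Re (h_fun \<mu> N x)) \<and>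
    (\<forall>g. real_trig_poly N g \<and> (\<forall>x. q_fun \<mu> x \<le> g x) \<longrightarrow>
       circle_integral (\<lambda>x. Re (h_fun \<mu> N x)) \<le> circle_integral g \<and>
       (circle_integral (\<lambda>x. Re (h_fun \<mu> N x)) = circle_integral g \<longleftrightarrow>
          (\<forall>x. complex_of_real (g x) = h_fun \<mu> N x)))"
proof -
  interpret majorant_measure \<mu> N by unfold_locales (fact assms)+
  have Re: "(\<lambda>x. Re (h_fun \<mu> N x)) = h" by (simp add: h_fun_eq fun_eq_iff)
  show ?thesis
    unfolding Re
  proof (intro conjI allI impI)
    show "h_fun \<mu> N x \<in> \<real>" "q_fun \<mu> x \<le> Re (h_fun \<mu> N x)" for x
      by (simp_all add: h_fun_eq q_fun_le_h)
    fix g assume "real_trig_poly N g \<and> (\<forall>x. q_fun \<mu> x \<le> g x)"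
    then obtain c where c: "\<And>x. of_real (g x) = trig_sum N c x" and maj: "\<And>x. q_fun \<mu> x \<le> g x"
      unfolding real_trig_poly_iff by metis
    show "circle_integral h \<le> circle_integral g" by (rule extremal(1)[OF c maj])
    show "circle_integral h = circle_integral g \<longleftrightarrow> (\<forall>x. complex_of_real (g x) = h_fun \<mu> N x)"
    proof
      assume "circle_integral h = circle_integral g"
      then show "\<forall>x. complex_of_real (g x) = h_fun \<mu> N x"
        using extremal(2)[OF c maj] by (simp add: h_fun_eq)
    next
      assume "\<forall>x. complex_of_real (g x) = h_fun \<mu> N x"
      then have "g = h" by (simp add: h_fun_eq fun_eq_iff)
      then show "circle_integral h = circle_integral g" by simp
    qed
  qed
qed

end
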